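(* Let $a>0$. If $S,T\in\mathcal{A}(2\pi)$ satisfy $S(ia)=T(ia)=0$ and $$S(x)\le x_+^0\le T(x)\qquad\text{for all real }x,$$ then $$\int_{-\infty}^\infty\bigl(T(x)-S(x)\bigr)\,dx\ \ge\ \frac{\pi a}{\pi a-\tanh(\pi a)}.$$ Moreover, there exist $S_a^+,S_a^-\in\mathcal{A}(2\pi)$ such that $S=S_a^-$ and $T=S_a^+$ satisfy these conditions ($S_a^\pm(ia)=0$ and $S_a^-(x)\le x_+^0\le S_a^+(x)$ for all real $x$) and equality holds in the integral inequality for $S=S_a^-$ and $T=S_a^+$.
   Context: For $\delta\ge0$, $\mathcal{A}(\delta)$ denotes the class of entire functions $F$ of exponential type $\delta$, meaning: for every $\varepsilon>0$ there is $C_\varepsilon>0$ with $|F(z)|\le C_\varepsilon e^{(\delta+\varepsilon)|z|}$ for all $z\in\mathbb{C}$. The function $x_+^0$ equals $1$ if $x\ge0$ and $0$ if $x<0$. *)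

theory Defs
  imports "HOL-Complex_Analysis.Complex_Analysis"
begin

definition exp_type_class :: "real \<Rightarrow> (complex \<Rightarrow> complex) set" where
  "exp_type_class \<delta> =
     {F. F holomorphic_on UNIV \<and>
         (\<forall>\<epsilon>>0. \<exists>C>0. \<forall>z. norm (F z) \<le> C * exp ((\<delta> + \<epsilon>) * norm z))}"

definition step0 :: "real \<Rightarrow> real" where
  "step0 x = (if x \<ge> 0 then 1 else 0)"

text \<open>An inequality between a complex-valued function and a real one includes the claim
  that the complex values are real.\<close>

definition minorant_on_reals :: "(complex \<Rightarrow> complex) \<Rightarrow> (real \<Rightarrow> real) \<Rightarrow> bool" where
  "minorant_on_reals S f \<longleftrightarrow>
     (\<forall>x::real. S (of_real x) \<in> \<real> \<and> Re (S (of_real x)) \<le> f x)"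

definition majorant_on_reals :: "(complex \<Rightarrow> complex) \<Rightarrow> (real \<Rightarrow> real) \<Rightarrow> bool" where
  "majorant_on_reals T f \<longleftrightarrow>
     (\<forall>x::real. T (of_real x) \<in> \<real> \<and> f x \<le> Re (T (of_real x)))"

definition admissible_pair ::
    "real \<Rightarrow> (complex \<Rightarrow> complex) \<Rightarrow> (complex \<Rightarrow> complex) \<Rightarrow> bool" where
  "admissible_pair a S T \<longleftrightarrow>
     S \<in> exp_type_class (2 * pi) \<and> T \<in> exp_type_class (2 * pi) \<and>
     S (\<i> * of_real a) = 0 \<and> T (\<i> * of_real a) = 0 \<and>
     minorant_on_reals S step0 \<and> majorant_on_reals T step0"

text \<open>The integrand is nonnegative for admissible pairs, so its integral is taken in
  \<open>[0, \<infinity>]\<close>; a Bochner integral would be 0 for a non-integrable difference.\<close>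

definition gap_integral :: "(complex \<Rightarrow> complex) \<Rightarrow> (complex \<Rightarrow> complex) \<Rightarrow> ennreal" where
  "gap_integral S T =
     (\<integral>\<^sup>+ x. ennreal (Re (T (of_real x)) - Re (S (of_real x))) \<partial>lborel)"

end

theory Submission
  imports Defs "HOL-Real_Asymp.Real_Asymp"
begin

text \<open>
  Lower bound.  Let \<open>F = T - S\<close>; it is nonnegative on the real line, has \<open>F 0 \<ge> 1\<close> and vanishes at
  \<open>\<i> * a\<close>.  Put \<open>\<theta> z = r * exp (\<i> * q * z) * (a - \<i> * t * z) / (a + \<i> * t * z)\<close> with \<open>q > 2 * pi\<close>,
  \<open>r = exp (- s) < 1\<close> and \<open>t = tanh ((q * a + s) / 2)\<close>.  Then \<open>\<bar>\<theta>\<bar> = r\<close> on the real line, and the choice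
  of \<open>t\<close> makes \<open>\<i> * a\<close> a simple zero of \<open>1 - \<theta>\<close>, the only one in the closed upper half-plane.  As
  \<open>F\<close> vanishes there, \<open>F * 2 * \<theta> / (1 - \<theta>)\<close> is holomorphic in the upper half-plane and (after multiplying
  \<open>F\<close> by a Fejer factor, and using Phragmen-Lindelof) small at infinity, so it integrates to \<open>0\<close>.
  Hence \<open>\<integral> F = \<integral> F * P\<close> for the positive kernel \<open>P = Re ((1 + \<theta>) / (1 - \<theta>))\<close>, which for \<open>s \<rightarrow> 0\<close> puts a point
  mass at \<open>0\<close> whose weight tends to \<open>pi * a / (pi * a - tanh (pi * a))\<close> as \<open>q \<rightarrow> 2 * pi\<close>.

  Extremal functions.  Let \<open>b z\<close> be a multiple of
  \<open>(a * sin (pi * z) - tanh (pi * a) * z * cos (pi * z)) / (z * (z\<^sup>2 + a\<^sup>2))\<close>, an even entire function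
  without zeros on the imaginary axis, and let \<open>G (z\<^sup>2) = b z ^ 2\<close>, \<open>k v = 1 / G (- (v\<^sup>2))\<close>.
  The difference of the two extremal functions is the multiple of \<open>(z\<^sup>2 + a\<^sup>2) * b z ^ 2\<close> with value \<open>1\<close> at \<open>0\<close>, and
  the majorant is \<open>b z ^ 2\<close> times the sum of a quadratic polynomial and the Cauchy transform
  \<open>- (z / pi) * \<integral> k v / (v\<^sup>2 + z\<^sup>2)\<close> over \<open>v > 0\<close>, plus \<open>1\<close> for \<open>Re z > 0\<close>.  Writing the jump as
  \<open>1 / 2 + (z / pi) * \<integral> 1 / (v\<^sup>2 + z\<^sup>2)\<close> turns the integrand into a divided difference of \<open>G\<close>, so the function
  is entire.  The two inequalities on the real line reduce to a bound on the integrals of \<open>k\<close> that follows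
  from the monotonicity and convexity of \<open>s \<mapsto> k (sqrt s)\<close>, needed only at the triple \<open>0\<close>, \<open>a\<^sup>2\<close>, \<open>s\<close>.
\<close>

section \<open>Functions of exponential type integrable on the real line\<close>

lemma exp_powr_three_halves_bound:
  fixes C k c M :: real
  assumes "c > 0" "M > 0" "C > 0" "k > 0"
  shows "eventually (\<lambda>R. C * exp (k * R) * exp (- (c * R powr (3/2))) \<le> M) at_top"
proof -
  have "((\<lambda>R. C * exp (k * R) * exp (- (c * R powr (3/2)))) \<longlongrightarrow> 0) at_top"
    using assms by real_asymp
  from order_tendstoD(2)[OF this \<open>M > 0\<close>] show ?thesis
    by (rule eventually_mono) simp
qed

text \<open>The argument of \<open>w\<close> is at most \<open>pi / 4\<close> in modulus, so that of
  the power stays within \<open>3 * pi / 8 < pi / 2\<close>. The exponent \<open>3/2\<close> lies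
  above the growth order 1 and below 2, the critical exponent for a right angle.\<close>

lemma Re_powr_three_halves_ge:
  assumes "\<bar>Im w\<bar> \<le> Re w" "w \<noteq> 0"
  shows "Re (w powr (3/2)) \<ge> cos (3 * pi / 8) * norm w powr (3/2)"
proof -
  have Re: "Re w > 0" using assms by (cases w) (auto simp: complex_eq_iff)
  have Arg: "\<bar>Im (Ln w)\<bar> \<le> pi / 4"
  proof -
    have "\<bar>Im w / Re w\<bar> \<le> 1" using assms Re by auto
    then show ?thesis
      using arctan_le_pi4[of "Im w / Re w"] arg_conv_arctan[OF Re] Arg_eq_Im_Ln[OF assms(2)] by simp
  qed
  have "\<bar>3/2 * Im (Ln w)\<bar> \<le> 3 * pi / 8" using Arg by (simp add: abs_mult)
  then have "cos (3 * pi / 8) \<le> cos \<bar>3/2 * Im (Ln w)\<bar>"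
    by (intro cos_monotone_0_pi_le) auto
  then have c: "cos (3 * pi / 8) \<le> cos (3/2 * Im (Ln w))" by (simp only: cos_abs_real)
  have "w powr (3/2) = exp (3/2 * Ln w)" using assms by (simp add: powr_def)
  then have "Re (w powr (3/2)) = exp (3/2 * ln (norm w)) * cos (3/2 * Im (Ln w))"
    using assms by (simp add: Re_exp)
  moreover have "norm w powr (3/2) = exp (3/2 * ln (norm w))"
    using assms by (simp add: powr_def)
  ultimately show ?thesis using c by (simp add: mult.commute)
qed

text \<open>Damping by the exponential of a negative multiple of the power \<open>3/2\<close> beats
  the growth of \<open>f\<close> on a large arc, so the maximum modulus principle on the truncated
  sector bounds the damped function by \<open>M\<close>. Then \<open>\<delta>\<close> tends to
  0.\<close>

lemma Phragmen_Lindelof_quarter_sector: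
  fixes f :: "complex \<Rightarrow> complex"
  assumes hol: "f holomorphic_on UNIV"
    and growth: "\<And>z. \<bar>Im z\<bar> \<le> Re z \<Longrightarrow> norm (f z) \<le> C * exp (k * norm z)"
    and bdry: "\<And>z. \<bar>Im z\<bar> = Re z \<Longrightarrow> norm (f z) \<le> M"
    and pos: "M > 0" "C > 0" "k > 0" and z: "\<bar>Im z\<bar> \<le> Re z"
  shows "norm (f z) \<le> M"
proof -
  define c where "c = cos (3 * pi / 8)"
  have "c > 0" unfolding c_def by (rule cos_gt_zero_pi) auto
  have bound: "norm (f z) * exp (- (\<delta> * Re ((z + 1) powr (3/2)))) \<le> M" if "\<delta> > 0" for \<delta> :: real
  proof -
    \<comment> \<open>The shift by 1 keeps the whole sector, vertex included, off the branch cut of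
      the power.\<close>
    define h where "h w = f w * exp (- (of_real \<delta> * (w + 1) powr (3/2)))" for w
    have normh: "norm (h w) = norm (f w) * exp (- (\<delta> * Re ((w + 1) powr (3/2))))" for w
      by (simp add: h_def norm_mult)
    have "eventually (\<lambda>R. C * exp (k * R) * exp (- (\<delta> * c * R powr (3/2))) \<le> M \<and> R > norm z) at_top"
      using \<open>\<delta> > 0\<close> \<open>c > 0\<close> pos
      by (intro eventually_conj exp_powr_three_halves_bound eventually_gt_at_top) auto
    then have "\<exists>R. C * exp (k * R) * exp (- (\<delta> * c * R powr (3/2))) \<le> M \<and> R > norm z"
      by (rule eventually_happens'[OF trivial_limit_at_top_linorder])
    then obtain R where R: "C * exp (k * R) * exp (- (\<delta> * c * R powr (3/2))) \<le> M" "R > norm z"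
      by blast
    define S where "S = {w. \<bar>Im w\<bar> \<le> Re w} \<inter> cball 0 R"
    have decay: "Re ((w + 1) powr (3/2)) \<ge> c * norm w powr (3/2)" if "\<bar>Im w\<bar> \<le> Re w" for w
    proof -
      have "Re w \<ge> 0" using that by linarith
      have "norm w \<le> norm (w + 1)"
        using \<open>Re w \<ge> 0\<close> by (auto simp: norm_complex_def power2_eq_square algebra_simps intro!: real_sqrt_le_mono)
      then have "norm w powr (3/2) \<le> norm (w + 1) powr (3/2)" by (intro powr_mono2) auto
      moreover have "w + 1 \<noteq> 0" using \<open>Re w \<ge> 0\<close> by (auto simp: complex_eq_iff)
      ultimately show ?thesis
        using Re_powr_three_halves_ge[of "w + 1"] that \<open>c > 0\<close> unfolding c_def[symmetric]
        by (smt (verit) mult_left_mono Re_complex_of_real plus_complex.sel Im_complex_of_real one_complex.sel)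
    qed
    have clS: "closed S" unfolding S_def
      by (intro closed_Int closed_cball closed_Collect_le continuous_intros)
    have holh: "h holomorphic_on {w. Re w > -1}"
      unfolding h_def
      by (intro holomorphic_intros holomorphic_on_subset[OF hol]) (auto simp: complex_nonpos_Reals_iff)
    have SU: "S \<subseteq> {w. Re w > -1}" by (auto simp: S_def)
    have "norm (h z) \<le> M"
    proof (rule maximum_modulus_frontier[of h S])
      show "h holomorphic_on interior S"
        using holh SU interior_subset holomorphic_on_subset by (metis subset_trans)
      show "continuous_on (closure S) h"
        using holomorphic_on_imp_continuous_on[OF holh] SU clS by (simp add: continuous_on_subset)
      show "bounded S" unfolding S_def by (simp add: bounded_Int)
      show "z \<in> S" using z R by (simp add: S_def)
      fix w assume "w \<in> frontier S"
      then have w: "w \<in> S" "w \<notin> interior S" using clS by (auto simp: frontier_def)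
      then have wS: "\<bar>Im w\<bar> \<le> Re w" "norm w \<le> R" by (auto simp: S_def)
      have "\<bar>Im w\<bar> = Re w \<or> norm w = R"
      proof (rule ccontr)
        assume "\<not> ?thesis"
        then have "w \<in> {w. \<bar>Im w\<bar> < Re w} \<inter> ball 0 R" using wS by auto
        moreover have "open ({w. \<bar>Im w\<bar> < Re w} \<inter> ball (0::complex) R)"
          by (intro open_Int open_ball open_Collect_less continuous_intros)
        moreover have "{w. \<bar>Im w\<bar> < Re w} \<inter> ball 0 R \<subseteq> S" by (auto simp: S_def)
        ultimately show False using w interiorI by blast
      qed
      then show "norm (h w) \<le> M"
      proof
        assume "\<bar>Im w\<bar> = Re w"
        moreover have "0 \<le> \<delta> * (c * norm w powr (3/2))" using \<open>\<delta> > 0\<close> \<open>c > 0\<close> by simp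
        moreover have "\<delta> * (c * norm w powr (3/2)) \<le> \<delta> * Re ((w + 1) powr (3/2))"
          using decay[OF wS(1)] \<open>\<delta> > 0\<close> by (intro mult_left_mono) auto
        ultimately have "norm (h w) \<le> norm (f w) * 1" "norm (f w) \<le> M"
          unfolding normh using bdry by (auto intro!: mult_left_le)
        then show ?thesis by simp
      next
        assume "norm w = R"
        have "norm (h w) \<le> (C * exp (k * norm w)) * exp (- (\<delta> * c * norm w powr (3/2)))"
          unfolding normh using growth[OF wS(1)] decay[OF wS(1)] \<open>\<delta> > 0\<close>
          by (intro mult_mono) (auto simp: mult.assoc intro: order_trans[OF norm_ge_zero])
        then show ?thesis using R \<open>norm w = R\<close> by simp
      qed
    qed
    then show ?thesis by (simp add: normh)
  qed
  have "((\<lambda>\<delta>. norm (f z) * exp (- (\<delta> * Re ((z + 1) powr (3/2))))) \<longlongrightarrow> norm (f z) * exp (- (0 * Re ((z + 1) powr (3/2))))) (at_right 0)"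
    by (intro tendsto_intros)
  then show ?thesis
    by (intro tendsto_upperbound[where F = "at_right (0::real)"])
       (auto simp: eventually_at_filter intro!: bound always_eventually)
qed

text \<open>Multiplication by \<open>e\<close> or \<open>\<i> * e\<close> carries the sector around
  the positive real axis onto one of the two quadrants. The imaginary half-axis is their common
  edge, hence the bound there.\<close>

lemma Phragmen_Lindelof_half_plane:
  fixes f :: "complex \<Rightarrow> complex"
  assumes hol: "f holomorphic_on UNIV"
    and growth: "\<And>z. norm (f z) \<le> C * exp (k * norm z)"
    and real: "\<And>x::real. norm (f (of_real x)) \<le> M"
    and imag: "\<And>y::real. y \<ge> 0 \<Longrightarrow> norm (f (\<i> * of_real y)) \<le> M"
    and pos: "M > 0" "C > 0" "k > 0" and z: "Im z \<ge> 0"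
  shows "norm (f z) \<le> M"
proof -
  define e where "e = cis (pi / 4)"
  have e: "e = Complex (sqrt 2 / 2) (sqrt 2 / 2)"
    by (simp add: e_def complex_eq_iff cos_45 sin_45)
  have e0: "norm e = 1" "e \<noteq> 0" by (simp_all add: e_def)
  have main: "norm (f w) \<le> M" if "\<bar>Im (w / u)\<bar> \<le> Re (w / u)"
    "norm u = 1" "\<And>v. \<bar>Im v\<bar> = Re v \<Longrightarrow> norm (f (u * v)) \<le> M" for u w
  proof -
    have "norm (f (u * (w / u))) \<le> M"
    proof (rule Phragmen_Lindelof_quarter_sector[where f = "\<lambda>v. f (u * v)"])
      show "(\<lambda>v. f (u * v)) holomorphic_on UNIV"
        by (rule holomorphic_on_compose_gen[where g = f, unfolded o_def, OF _ hol])
           (auto intro!: holomorphic_intros)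
      show "norm (f (u * v)) \<le> C * exp (k * norm v)" for v
        using growth[of "u * v"] that(2) by (simp add: norm_mult)
    qed (use that pos in auto)
    moreover have "u \<noteq> 0" using that(2) by auto
    ultimately show ?thesis by simp
  qed
  have cnj_e: "1 / e = cnj e"
    using e0 complex_norm_square[of e] by (simp add: field_simps)
  show ?thesis
  proof (cases "Re z \<ge> 0")
    case True
    show ?thesis
    proof (rule main[of z e])
      have "z / e = z * cnj e" using cnj_e by (metis divide_inverse mult_1 inverse_eq_divide)
      then show "\<bar>Im (z / e)\<bar> \<le> Re (z / e)"
        using True z by (cases z) (auto simp: e abs_le_iff field_simps)
      show "norm (f (e * v)) \<le> M" if "\<bar>Im v\<bar> = Re v" for v
      proof (cases "Im v \<ge> 0")
        case True
        then have eq: "Im v = Re v" using that by simp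
        have "e * v = \<i> * of_real (sqrt 2 * Re v)" "Re v \<ge> 0"
          using that eq by (auto simp: e complex_eq_iff field_simps)
        then show ?thesis using imag[of "sqrt 2 * Re v"] by simp
      next
        case False
        then have eq: "Im v = - Re v" using that by simp
        have "e * v = of_real (sqrt 2 * Re v)"
          using that eq by (auto simp: e complex_eq_iff field_simps)
        then show ?thesis using real[of "sqrt 2 * Re v"] by simp
      qed
    qed (use e0 in auto)
  next
    case False
    show ?thesis
    proof (rule main[of z "\<i> * e"])
      have "z / (\<i> * e) = - \<i> * (z * (1 / e))" using e0
        by (simp add: field_simps)
      then have "z / (\<i> * e) = - \<i> * (z * cnj e)" unfolding cnj_e .
      then have "Re (z / (\<i> * e)) = sqrt 2 / 2 * (Im z - Re z)" "Im (z / (\<i> * e)) = sqrt 2 / 2 * (- (Re z + Im z))"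
        by (simp_all add: e algebra_simps)
      moreover have "\<bar>Re z + Im z\<bar> \<le> Im z - Re z" using False z by auto
      ultimately show "\<bar>Im (z / (\<i> * e))\<bar> \<le> Re (z / (\<i> * e))"
        by (simp only: abs_mult abs_minus_cancel) simp
      show "norm (f (\<i> * e * v)) \<le> M" if "\<bar>Im v\<bar> = Re v" for v
      proof (cases "Im v \<ge> 0")
        case True
        then have eq: "Im v = Re v" using that by simp
        have "\<i> * e * v = of_real (- sqrt 2 * Re v)"
          using that eq by (auto simp: e complex_eq_iff field_simps)
        then show ?thesis using real[of "- sqrt 2 * Re v"] by simp
      next
        case False
        then have eq: "Im v = - Re v" using that by simp
        have "\<i> * e * v = \<i> * of_real (sqrt 2 * Re v)" "Re v \<ge> 0"
          using that eq by (auto simp: e complex_eq_iff field_simps)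
        then show ?thesis using imag[of "sqrt 2 * Re v"] by (simp add: mult.assoc)
      qed
    qed (use e0 in \<open>auto simp: norm_mult\<close>)
  qed
qed

text \<open>The factor \<open>exp (\<i> * k * z)\<close> has modulus 1 on the real line and cancels
  the growth on the positive imaginary axis, so the product is bounded by \<open>C\<close> on
  both.\<close>

lemma bounded_on_reals_imp_bound_upper:
  assumes hol: "f holomorphic_on UNIV"
    and growth: "\<And>z. norm (f z) \<le> C * exp (k * norm z)"
    and real: "\<And>x::real. norm (f (of_real x)) \<le> C"
    and pos: "C > 0" "k > 0" and z: "Im z \<ge> 0"
  shows "norm (f z) \<le> C * exp (k * Im z)"
proof -
  have "norm (f z * exp (\<i> * of_real k * z)) \<le> C"
  proof (rule Phragmen_Lindelof_half_plane[where f = "\<lambda>z. f z * exp (\<i> * of_real k * z)"])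
    show "(\<lambda>z. f z * exp (\<i> * of_real k * z)) holomorphic_on UNIV"
      by (intro holomorphic_intros hol)
    show "norm (f w * exp (\<i> * of_real k * w)) \<le> C * exp ((2 * k) * norm w)" for w
    proof -
      have "- (k * Im w) \<le> k * norm w"
        using mult_left_mono[of "- Im w" "norm w" k] abs_Im_le_cmod[of w] pos by simp
      then have "norm (f w) * exp (- (k * Im w)) \<le> (C * exp (k * norm w)) * exp (k * norm w)"
        using growth[of w] by (intro mult_mono) (auto intro: order_trans[OF norm_ge_zero])
      also have "\<dots> = C * exp ((2 * k) * norm w)" by (simp add: mult_exp_exp)
      finally show ?thesis by (simp add: norm_mult)
    qed
    show "norm (f (of_real x) * exp (\<i> * of_real k * of_real x)) \<le> C" for x
      using real[of x] by (simp add: norm_mult)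
    show "norm (f (\<i> * of_real y) * exp (\<i> * of_real k * (\<i> * of_real y))) \<le> C" if "y \<ge> 0" for y
    proof -
      have "norm (f (\<i> * of_real y)) * exp (- (k * y)) \<le> (C * exp (k * y)) * exp (- (k * y))"
        using growth[of "\<i> * of_real y"] that by (intro mult_right_mono) (auto simp: norm_mult)
      also have "\<dots> = C" by (simp add: mult_exp_exp)
      finally show ?thesis by (simp add: norm_mult)
    qed
  qed (use pos z in auto)
  then have "norm (f z) * exp (- (k * Im z)) \<le> C" by (simp add: norm_mult)
  then show ?thesis by (simp add: exp_minus field_simps)
qed

text \<open>A primitive \<open>\<Phi>\<close> of \<open>F\<close> is bounded on the reals, hence
  grows with \<open>\<bar>Im z\<bar>\<close> only, and a Cauchy estimate on unit circles returns
  this to \<open>F\<close>. The loss \<open>\<eta>\<close> absorbs the factor \<open>norm z\<close>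
  that integrating the growth bound produces.\<close>

lemma exp_type_integrable_bound:
  assumes hol: "F holomorphic_on UNIV"
    and growth: "\<And>z. norm (F z) \<le> C * exp (k * norm z)"
    and int: "\<And>a b::real. a \<le> b \<Longrightarrow> integral {a..b} (\<lambda>x. norm (F (of_real x))) \<le> M"
    and pos: "C > 0" "k > 0" "\<eta> > 0"
  shows "\<exists>B>0. \<forall>z. norm (F z) \<le> B * exp ((k + \<eta>) * \<bar>Im z\<bar>)"
proof -
  obtain \<Phi>0 where \<Phi>0: "\<And>z. (\<Phi>0 has_field_derivative F z) (at z)"
    using holomorphic_convex_primitive'[OF convex_UNIV open_UNIV hol] by auto
  define \<Phi> where "\<Phi> z = \<Phi>0 z - \<Phi>0 0" for z
  have der: "(\<Phi> has_field_derivative F z) (at z)" for z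
    unfolding \<Phi>_def by (auto intro!: derivative_eq_intros \<Phi>0)
  have hol\<Phi>: "\<Phi> holomorphic_on UNIV"
    using der by (auto simp: holomorphic_on_def field_differentiable_def)
  have contF: "continuous_on UNIV F" using hol by (rule holomorphic_on_imp_continuous_on)
  have real_diff: "norm (\<Phi> (of_real b) - \<Phi> (of_real a)) \<le> M" if "a \<le> b" for a b :: real
  proof -
    have hi: "((\<lambda>t. F (of_real t)) has_integral (\<Phi> (of_real b) - \<Phi> (of_real a))) {a..b}"
      by (rule fundamental_theorem_of_calculus[OF that])
         (auto intro!: has_vector_derivative_real_field der)
    have "norm (integral {a..b} (\<lambda>t. F (of_real t))) \<le> integral {a..b} (\<lambda>x. norm (F (of_real x)))"
      by (intro integral_norm_bound_integral integrable_continuous_real continuous_intros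
            continuous_on_compose2[OF contF]) auto
    then show ?thesis using int[OF that] integral_unique[OF hi] by simp
  qed
  have \<Phi>_real: "norm (\<Phi> (of_real x)) \<le> M" for x :: real
    using real_diff[of 0 x] real_diff[of x 0] by (cases "x \<ge> 0") (auto simp: \<Phi>_def norm_minus_commute)
  \<comment> \<open>One constant has to dominate both the growth of \<open>\<Phi>\<close>, where
    \<open>norm z \<le> exp (\<eta> * norm z) / \<eta>\<close> costs \<open>C / \<eta>\<close>, and
    its bound \<open>M\<close> on the reals.\<close>
  define A where "A = C / \<eta> + \<bar>M\<bar>"
  have A: "A > 0" "M \<le> A" using pos by (auto simp: A_def add_pos_nonneg intro: order_trans[OF abs_ge_self])
  have \<Phi>_growth: "norm (\<Phi> z) \<le> A * exp ((k + \<eta>) * norm z)" for z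
  proof -
    have "norm (\<Phi> z - \<Phi> 0) \<le> (C * exp (k * norm z)) * norm (z - 0)"
    proof (rule field_differentiable_bound[of "cball 0 (norm z)" \<Phi> F])
      show "(\<Phi> has_field_derivative F w) (at w within cball 0 (norm z))" for w
        by (rule has_field_derivative_at_within[OF der])
      show "norm (F w) \<le> C * exp (k * norm z)" if "w \<in> cball 0 (norm z)" for w
        using that pos by (intro order_trans[OF growth]) auto
    qed auto
    then have "norm (\<Phi> z) \<le> C * exp (k * norm z) * norm z" by (simp add: \<Phi>_def)
    also have "\<dots> \<le> C * exp (k * norm z) * (exp (\<eta> * norm z) / \<eta>)"
    proof (intro mult_left_mono)
      show "norm z \<le> exp (\<eta> * norm z) / \<eta>"
      using less_eq_real_def exp_ge_add_one_self[of "\<eta> * norm z"] pos by (simp add: field_simps) linarith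
    qed (use pos in auto)
    also have "C * exp (k * norm z) * (exp (\<eta> * norm z) / \<eta>) = C / \<eta> * exp ((k + \<eta>) * norm z)"
      by (simp add: distrib_right exp_add)
    also have "\<dots> \<le> A * exp ((k + \<eta>) * norm z)"
      by (intro mult_right_mono) (auto simp: A_def)
    finally show ?thesis .
  qed
  have \<Phi>_bound: "norm (\<Phi> z) \<le> A * exp ((k + \<eta>) * \<bar>Im z\<bar>)" for z
  proof (cases "Im z \<ge> 0")
    case True
    then show ?thesis
      using bounded_on_reals_imp_bound_upper[OF hol\<Phi> \<Phi>_growth _ \<open>A > 0\<close>] \<Phi>_real A pos
      by (smt (verit))
  next
    case False
    have "norm (\<Phi> (- (- z))) \<le> A * exp ((k + \<eta>) * Im (- z))"
    proof (rule bounded_on_reals_imp_bound_upper[where f = "\<lambda>z. \<Phi> (- z)"])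
      show "(\<lambda>z. \<Phi> (- z)) holomorphic_on UNIV"
        by (rule holomorphic_on_compose_gen[where g = \<Phi>, unfolded o_def, OF _ hol\<Phi>])
           (auto intro!: holomorphic_intros)
      show "norm (\<Phi> (- of_real x)) \<le> A" for x
        using \<Phi>_real[of "-x"] A by simp
    qed (use A pos False \<Phi>_growth[of "- _"] in auto)
    then show ?thesis using False by simp
  qed
  have "norm (F z) \<le> (A * exp (k + \<eta>)) * exp ((k + \<eta>) * \<bar>Im z\<bar>)" for z
  proof -
    have "norm ((deriv ^^ 1) \<Phi> z) \<le> fact 1 * (A * exp ((k + \<eta>) * (\<bar>Im z\<bar> + 1))) / 1 ^ 1"
    proof (rule Cauchy_inequality)
      show "norm (\<Phi> w) \<le> A * exp ((k + \<eta>) * (\<bar>Im z\<bar> + 1))" if "norm (z - w) = 1" for w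
      proof -
        have "\<bar>Im w\<bar> \<le> \<bar>Im z\<bar> + 1" using abs_Im_le_cmod[of "z - w"] that by auto
        then show ?thesis using A pos by (intro order_trans[OF \<Phi>_bound]) auto
      qed
    qed (auto intro: holomorphic_on_subset[OF hol\<Phi>] holomorphic_on_imp_continuous_on)
    then show ?thesis
      using DERIV_imp_deriv[OF der[of z]] by (simp add: distrib_left exp_add mult_ac)
  qed
  then show ?thesis using A by (intro exI[of _ "A * exp (k + \<eta>)"]) auto
qed

text \<open>Cauchy's theorem on a half-disc. The number \<open>c\<close> is a coefficient at
  infinity, not a residue inside: \<open>c / z\<close> contributes \<open>\<i> * pi * c\<close> on
  every upper semicircle, and the remainder at most \<open>C * pi / R\<close>.\<close>

lemma integral_reals_eq_semicircle_limit:
  assumes cont: "continuous_on {z. Im z \<ge> 0} g" and hol: "g holomorphic_on {z. Im z > 0}"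
    and bound: "\<And>z. Im z \<ge> 0 \<Longrightarrow> norm z \<ge> R0 \<Longrightarrow> norm (g z - c / z) \<le> C / norm z ^ 2"
  shows "((\<lambda>R. integral {-R..R} (\<lambda>x. g (of_real x))) \<longlongrightarrow> - (\<i> * pi * c)) at_top"
proof -
  have key: "norm (integral {-R..R} (\<lambda>x. g (of_real x)) - (- (\<i> * pi * c))) \<le> C * pi / R"
    if R: "R > 0" "R \<ge> R0" for R
  proof -
    define H where "H = {z. Im z \<ge> 0}"
    define p where "p = linepath (of_real (-R)) (of_real R) +++ part_circlepath 0 R 0 pi"
    have ends: "pathfinish (linepath (of_real (-R)) (of_real R)) = pathstart (part_circlepath 0 R 0 pi)"
      by simp
    have convH: "convex H" unfolding H_def by (rule convex_halfspace_Im_ge)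
    have intH: "interior H = {z. Im z > 0}"
      unfolding H_def using interior_halfspace_ge[of "\<i>" 0] by (simp add: inner_complex_def)
    have semi: "Im z \<ge> 0 \<and> norm z = R" if "z \<in> path_image (part_circlepath 0 R 0 pi)" for z
      using that R by (auto simp: path_image_part_circlepath norm_mult Im_exp sin_ge_zero)
    have lineH: "path_image (linepath (of_real (-R)) (of_real R)) \<subseteq> H"
      by (auto simp: H_def closed_segment_def)
    have circH: "path_image (part_circlepath 0 R 0 pi) \<subseteq> H"
      using semi by (auto simp: H_def)
    have zero: "(g has_contour_integral 0) p"
      unfolding p_def
    proof (rule Cauchy_theorem_convex[of H _ "{}"])
      show "continuous_on H g" using cont by (simp add: H_def)
      show "g field_differentiable at x" if "x \<in> interior H - {}" for x
        using that hol intH by (metis DiffD1 holomorphic_on_imp_differentiable_at open_halfspace_Im_gt)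
      show "path_image (linepath (of_real (-R)) (of_real R) +++ part_circlepath 0 R 0 pi) \<subseteq> H"
        using lineH circH by (simp add: path_image_join)
    qed (use convH R in \<open>auto simp: exp_eq_polar cis_pi\<close>)
    have ci_line: "g contour_integrable_on linepath (of_real (-R)) (of_real R)"
      using lineH cont by (intro contour_integrable_continuous_linepath)
         (auto simp: H_def intro: continuous_on_subset)
    have ci_circ: "g contour_integrable_on part_circlepath 0 R 0 pi"
      using circH cont by (intro contour_integrable_continuous_part_circlepath)
         (auto simp: H_def intro: continuous_on_subset)
    have sum0: "contour_integral (linepath (of_real (-R)) (of_real R)) g
        + contour_integral (part_circlepath 0 R 0 pi) g = 0"
      using contour_integral_unique[OF zero] ci_line ci_circ ends
      unfolding p_def by (simp add: contour_integral_join)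
    have line: "contour_integral (linepath (of_real (-R)) (of_real R)) g = integral {-R..R} (\<lambda>x. g (of_real x))"
      using R by (subst contour_integral_linepath_Reals_eq) auto
    have "((\<lambda>z. c / z) has_contour_integral (\<i> * pi * c)) (part_circlepath 0 R 0 pi)"
    proof -
      have "((\<lambda>x. c / (R * cis x) * R * \<i> * cis x) has_integral (\<i> * c * pi)) {0..pi}"
        using has_integral_const_real[of "\<i> * c" 0 pi] R
        by (simp add: scaleR_conv_of_real mult_ac)
      then show ?thesis using R
        by (subst has_contour_integral_part_circlepath_iff) (auto simp: mult_ac)
    qed
    then have cz: "(\<lambda>z. c / z) contour_integrable_on part_circlepath 0 R 0 pi"
      "contour_integral (part_circlepath 0 R 0 pi) (\<lambda>z. c / z) = \<i> * pi * c"
      by (auto simp: contour_integral_unique has_contour_integral_integrable)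
    have "norm (contour_integral (part_circlepath 0 R 0 pi) (\<lambda>z. g z - c / z)) \<le> C / R ^ 2 * R * \<bar>pi - 0\<bar>"
    proof (rule contour_integral_bound_part_circlepath)
      show "(\<lambda>z. g z - c / z) contour_integrable_on part_circlepath 0 R 0 pi"
        by (intro contour_integrable_diff ci_circ cz)
      show "0 \<le> C / R ^ 2"
        using bound[of "of_real R"] R by (auto intro: order_trans[OF norm_ge_zero])
      show "norm (g x - c / x) \<le> C / R ^ 2" if "x \<in> path_image (part_circlepath 0 R 0 pi)" for x
        using bound[of x] semi[OF that] R by auto
    qed (use R in auto)
    moreover have "contour_integral (part_circlepath 0 R 0 pi) (\<lambda>z. g z - c / z)
      = - integral {-R..R} (\<lambda>x. g (of_real x)) - \<i> * pi * c"
      using contour_integral_diff[OF ci_circ cz(1)] cz(2) sum0 unfolding line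
      by (simp add: add_eq_0_iff)
    ultimately have "norm (- integral {-R..R} (\<lambda>x. g (of_real x)) - \<i> * pi * c) \<le> C * pi / R"
      using R by (simp add: power2_eq_square field_simps)
    also have "norm (- integral {-R..R} (\<lambda>x. g (of_real x)) - \<i> * pi * c) =
      norm (integral {-R..R} (\<lambda>x. g (of_real x)) - (- (\<i> * pi * c)))"
      by (metis minus_diff_commute norm_minus_commute norm_minus_cancel diff_minus_eq_add add.commute minus_add_distrib uminus_add_conv_diff)
    finally show ?thesis .
  qed
  show ?thesis
  proof (rule Lim_null[THEN iffD2], rule Lim_null_comparison)
    show "\<forall>\<^sub>F R in at_top. norm (integral {-R..R} (\<lambda>x. g (of_real x)) - (- (\<i> * pi * c))) \<le> C * pi / R"
      using eventually_gt_at_top[of 0] eventually_ge_at_top[of R0]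
      by eventually_elim (rule key)
    show "((\<lambda>R. C * pi / R) \<longlongrightarrow> 0) at_top"
      by real_asymp
  qed
qed

section \<open>The lower bound\<close>

text \<open>Removable singularity of the difference quotient; the value at \<open>c\<close> records
  whether the zero is simple.\<close>

lemma entire_factor_zero:
  fixes f :: "complex \<Rightarrow> complex"
  assumes "f holomorphic_on UNIV" "f c = 0"
  obtains g where "g holomorphic_on UNIV" "\<And>z. f z = (z - c) * g z" "g c = deriv f c"
proof
  show "(\<lambda>z. if z = c then deriv f c else (f z - f c) / (z - c)) holomorphic_on UNIV"
    by (rule pole_lemma[OF assms(1)]) simp
qed (use assms in auto)

section \<open>Hyperbolic inequalities\<close>

lemma sinh_gt_self:
  fixes x :: real
  assumes "x > 0" shows "sinh x > x"
proof -
  have "sinh 0 - 0 < sinh x - x"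
  proof (rule DERIV_pos_imp_increasing_open[OF assms])
    show "\<exists>d. ((\<lambda>x. sinh x - x) has_real_derivative d) (at y) \<and> d > 0" if "0 < y" for y
      using that cosh_real_ge_1[of y] cosh_real_one_iff[of y]
      by (intro exI[of _ "cosh y - 1"] conjI) (auto intro!: derivative_eq_intros simp: less_le)
  qed (auto intro!: continuous_intros)
  then show ?thesis by simp
qed

lemma tanh_less_self:
  fixes x :: real
  assumes "x > 0" shows "tanh x < x"
proof -
  have "0 - tanh 0 < x - tanh x"
  proof (rule DERIV_pos_imp_increasing_open[OF assms])
    show "\<exists>d. ((\<lambda>x. x - tanh x) has_real_derivative d) (at y) \<and> d > 0" if "0 < y" for y
      using that by (intro exI[of _ "(tanh y)\<^sup>2"]) (auto intro!: derivative_eq_intros)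
  qed (auto intro!: continuous_intros)
  then show ?thesis by simp
qed

text \<open>The sign of the derivative reduces to
  \<open>\<alpha> < sinh \<alpha> * cosh \<alpha>\<close>, since
  \<open>q * x / 2 \<le> \<alpha>\<close>. It gives uniqueness of the zero on the imaginary axis
  below; with \<open>q = 2\<close> and \<open>s = 0\<close> it says that \<open>tanh x / x\<close>
  decreases.\<close>

lemma tanh_shift_div_strict_antimono:
  fixes q s :: real
  assumes "q > 0" "s \<ge> 0" "0 < y" "y < w"
  shows "tanh ((q * w + s) / 2) / w < tanh ((q * y + s) / 2) / y"
proof (rule DERIV_neg_imp_decreasing[OF \<open>y < w\<close>])
  fix x assume "y \<le> x" "x \<le> w"
  then have x: "x > 0" using assms by simp
  define \<alpha> where "\<alpha> = (q * x + s) / 2"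
  define c where "c = cosh \<alpha>"
  have \<alpha>: "\<alpha> > 0" "q * x / 2 \<le> \<alpha>" using assms x by (auto simp: \<alpha>_def add_pos_nonneg)
  have c: "c \<ge> 1" by (simp add: c_def cosh_real_ge_1)
  have "(1 - (tanh \<alpha>)\<^sup>2) * c\<^sup>2 = 1"
  proof -
    have "tanh \<alpha> * c = sinh \<alpha>" using c by (simp add: tanh_def c_def)
    moreover have "(1 - (tanh \<alpha>)\<^sup>2) * c\<^sup>2 = c\<^sup>2 - (tanh \<alpha> * c)\<^sup>2"
      by (simp add: algebra_simps power_mult_distrib)
    ultimately show ?thesis using cosh_square_eq[of \<alpha>] by (simp add: c_def)
  qed
  then have sech: "1 - (tanh \<alpha>)\<^sup>2 = 1 / c\<^sup>2" using c by (simp add: field_simps)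
  have "(1 - (tanh \<alpha>)\<^sup>2) * (q * x / 2) \<le> 1 / c\<^sup>2 * \<alpha>"
    unfolding sech using \<alpha> c by (intro mult_left_mono) auto
  also have "\<dots> < 1 / c\<^sup>2 * (sinh \<alpha> * c)"
  proof (intro mult_strict_left_mono)
    have "\<alpha> * 1 < sinh \<alpha> * c" using sinh_gt_self[OF \<alpha>(1)] c \<alpha> by (intro mult_less_le_imp_less) auto
    then show "\<alpha> < sinh \<alpha> * c" by simp
  qed (use c in auto)
  also have "\<dots> = tanh \<alpha>" using c by (simp add: tanh_def c_def power2_eq_square)
  finally have neg: "((1 - (tanh \<alpha>)\<^sup>2) * (q / 2) * x - tanh \<alpha>) / x\<^sup>2 < 0"
    using x by (simp add: divide_less_0_iff)
  have "((\<lambda>x. tanh ((q * x + s) / 2) / x) has_real_derivative ((1 - (tanh \<alpha>)\<^sup>2) * (q / 2) * x - tanh \<alpha>) / x\<^sup>2) (at x)"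
    using x unfolding \<alpha>_def
    by (auto intro!: derivative_eq_intros simp: power2_eq_square)
  with neg show "\<exists>d. ((\<lambda>x. tanh ((q * x + s) / 2) / x) has_real_derivative d) (at x) \<and> d < 0" by blast
qed

section \<open>Zeros of \<open>1 - \<theta>\<close> in the closed upper half-plane\<close>

text \<open>This is \<open>1 - \<theta>\<close> multiplied by \<open>a + \<i> * t * z\<close>. For
  \<open>t > 0\<close> that denominator vanishes in the upper half-plane, at
  \<open>\<i> * a / t\<close>; clearing it leaves an entire function.\<close>

definition char_fun :: "real \<Rightarrow> real \<Rightarrow> real \<Rightarrow> real \<Rightarrow> complex \<Rightarrow> complex" where
  "char_fun a t q s z =
     (of_real a + \<i> * of_real t * z)
     - of_real (exp (- s)) * exp (\<i> * of_real q * z) * (of_real a - \<i> * of_real t * z)"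

lemma char_fun_holomorphic [holomorphic_intros]: "char_fun a t q s holomorphic_on A"
  unfolding char_fun_def [abs_def] by (intro holomorphic_intros)

text \<open>A zero off the imaginary axis would force \<open>sinh (q * y + s) \<le> q * y\<close>,
  because \<open>\<bar>sin (q * x)\<bar> \<le> q * \<bar>x\<bar>\<close>. On the axis the equation
  says that the strictly decreasing \<open>tanh ((q * y + s) / 2) / y\<close> takes the same value
  at \<open>y\<close> and at \<open>a\<close>.\<close>

lemma char_fun_zero_unique:
  fixes a q s :: real
  defines "t \<equiv> tanh ((q * a + s) / 2)"
  assumes pos: "a > 0" "q > 0" "s > 0" and z: "Im z \<ge> 0" "char_fun a t q s z = 0"
  shows "z = \<i> * of_real a"
proof -
  define x y X where "x = Re z" and "y = Im z" and "X = exp (q * y + s)"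
  define c \<sigma> where "c = cos (q * x)" and "\<sigma> = sin (q * x)"
  have cs: "c\<^sup>2 + \<sigma>\<^sup>2 = 1" by (simp add: c_def \<sigma>_def)
  have t: "t > 0" using pos by (simp add: t_def add_pos_pos)
  have y0: "y \<ge> 0" using z by (simp add: y_def)
  have "q * y + s > 0" using y0 pos by (simp add: add_nonneg_pos)
  then have X: "X > 1" by (simp add: X_def)
  have "of_real (exp (- s)) * exp (\<i> * of_real q * z) = Complex (c / X) (\<sigma> / X)"
  proof -
    have "exp (\<i> * of_real q * z) = exp (Complex (- q * y) (q * x))"
      by (rule arg_cong[of _ _ exp]) (auto simp: complex_eq_iff x_def y_def)
    then show ?thesis
      by (auto simp: complex_eq_iff Re_exp Im_exp c_def \<sigma>_def X_def exp_add exp_minus field_simps)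
  qed
  with z(2) have "of_real a + \<i> * of_real t * z = Complex (c / X) (\<sigma> / X) * (of_real a - \<i> * of_real t * z)"
    by (simp add: char_fun_def)
  then have "a - t * y = c / X * (a + t * y) + \<sigma> / X * (t * x)"
    "t * x = \<sigma> / X * (a + t * y) - c / X * (t * x)"
    by (auto simp: complex_eq_iff x_def y_def)
  then have "X * (a - t * y) = X * (c / X * (a + t * y) + \<sigma> / X * (t * x))"
    "X * (t * x) = X * (\<sigma> / X * (a + t * y) - c / X * (t * x))" by simp_all
  then have e: "X * (a - t * y) = c * (a + t * y) + \<sigma> * (t * x)"
    "X * (t * x) = \<sigma> * (a + t * y) - c * (t * x)"
    using X unfolding distrib_left right_diff_distrib by (simp_all add: mult.assoc[symmetric])
  \<comment> \<open>\<open>N\<close> is the squared modulus of \<open>X + cis (q * x)\<close>, the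
    determinant of the linear system \<open>e\<close> in the unknowns \<open>t * y\<close> and
    \<open>t * x\<close>.\<close>
  define N where "N = X\<^sup>2 + 2 * c * X + 1"
  have 1: "a * (X\<^sup>2 - 1) = t * y * N" and 2: "2 * a * \<sigma> * X = t * x * N"
    using e cs unfolding N_def by algebra+
  have y: "y > 0"
  proof (rule ccontr)
    assume "\<not> y > 0"
    then have "X\<^sup>2 = 1" using 1 y0 pos by simp
    then show False using X by (simp add: power2_eq_1_iff)
  qed
  have "x = 0"
  proof (rule ccontr)
    assume x: "x \<noteq> 0"
    have N: "t * N = 2 * a * \<sigma> * X / x" using 2 x by (simp add: field_simps)
    have "\<sigma> / x \<le> \<bar>\<sigma>\<bar> / \<bar>x\<bar>" by (metis abs_divide abs_ge_self)
    also have "\<bar>\<sigma>\<bar> \<le> q * \<bar>x\<bar>" using abs_sin_x_le_abs_x[of "q * x"] pos by (simp add: \<sigma>_def abs_mult)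
    finally have "\<sigma> / x \<le> q" using x by (simp add: divide_right_mono field_simps)
    then have "2 * a * X * (\<sigma> / x) \<le> 2 * a * X * q" using pos X by (intro mult_left_mono) auto
    then have "t * N \<le> 2 * a * X * q" unfolding N by (simp add: mult_ac)
    then have "y * (t * N) \<le> y * (2 * a * X * q)" using y by (intro mult_left_mono) auto
    then have "a * (X\<^sup>2 - 1) \<le> a * (2 * X * (q * y))" unfolding 1 by (simp add: mult_ac)
    then have "X\<^sup>2 - 1 \<le> 2 * X * (q * y)" using pos by simp
    then have "X - 1 / X \<le> 2 * (q * y)" using X by (simp add: field_simps power2_eq_square)
    moreover have "X - 1 / X = 2 * sinh (q * y + s)"
    proof -
      have "1 / X = exp (- (q * y + s))" unfolding X_def by (simp only: exp_minus inverse_eq_divide)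
      then show ?thesis unfolding sinh_def X_def by simp
    qed
    ultimately show False using sinh_gt_self[of "q * y + s"] \<open>q * y + s > 0\<close> pos by simp
  qed
  then have "c = 1" "\<sigma> = 0" by (auto simp: c_def \<sigma>_def)
  with 1 have "a * ((X - 1) * (X + 1)) = t * y * (X + 1) * (X + 1)"
    by (simp add: N_def power2_eq_square algebra_simps)
  then have "a * (X - 1) = t * y * (X + 1)" using X by simp
  moreover have "tanh ((q * y + s) / 2) = (X - 1) / (X + 1)"
  proof -
    have "exp (- 2 * ((q * y + s) / 2)) = exp (- (q * y + s))" by (rule arg_cong[of _ _ exp]) simp
    also have "\<dots> = 1 / X" unfolding X_def by (simp only: exp_minus inverse_eq_divide)
    finally have e': "exp (- 2 * ((q * y + s) / 2)) = 1 / X" .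
    have "1 - 1 / X = (X - 1) / X" "1 + 1 / X = (X + 1) / X" using X by (simp_all add: field_simps)
    then show ?thesis unfolding tanh_real_altdef e' using X by simp
  qed
  ultimately have "a * tanh ((q * y + s) / 2) = t * y" using X by simp
  then have eq: "tanh ((q * y + s) / 2) / y = tanh ((q * a + s) / 2) / a"
    using y pos by (simp add: t_def field_simps)
  have "y = a"
    using tanh_shift_div_strict_antimono[OF pos(2) less_imp_le[OF pos(3)] y, of a]
      tanh_shift_div_strict_antimono[OF pos(2) less_imp_le[OF pos(3)] pos(1), of y] eq by (cases y a rule: linorder_cases) auto
  then show ?thesis using \<open>x = 0\<close> by (simp add: complex_eq_iff x_def y_def)
qed

lemma exp_minus_tanh: "exp (- (2 * v)) * (1 + tanh v) = 1 - tanh (v::real)"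
proof -
  have "1 + exp (- (2 * v)) \<noteq> 0" by (smt (verit) exp_gt_zero)
  then show ?thesis by (simp add: tanh_real_altdef field_simps)
qed

text \<open>The choice of \<open>t\<close> is exactly what turns
  \<open>exp (- s) * exp (- (q * a)) * (1 + t)\<close> into \<open>1 - t\<close>.\<close>

lemma char_fun_zero:
  fixes a q s :: real
  defines "t \<equiv> tanh ((q * a + s) / 2)"
  shows "char_fun a t q s (\<i> * of_real a) = 0"
proof -
  have "exp (- s) * exp (- (q * a)) * (1 + t) = 1 - t"
  proof -
    have "exp (- s) * exp (- (q * a)) = exp (- (2 * ((q * a + s) / 2)))"
      unfolding mult_exp_exp by (simp add: algebra_simps)
    then show ?thesis using exp_minus_tanh[of "(q * a + s) / 2"] by (simp only: t_def)
  qed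
  then have "exp (- s) * exp (- (q * a)) * (a + t * a) = a - t * a"
    by (metis (no_types, opaque_lifting) distrib_right left_diff_distrib mult.assoc mult_1)
  moreover have "char_fun a t q s (\<i> * of_real a) = of_real (a - t * a - exp (- s) * exp (- (q * a)) * (a + t * a))"
    unfolding char_fun_def of_real_diff of_real_mult of_real_add exp_of_real[symmetric] of_real_minus
    by (simp add: algebra_simps)
  ultimately show ?thesis by simp
qed

text \<open>The zero is simple: up to the factor \<open>\<i>\<close> the derivative is real, and
  after multiplication by \<open>1 + E\<close> its positivity becomes
  \<open>q * a < sinh (q * a + s)\<close>.\<close>

lemma char_fun_deriv_nonzero:
  fixes a q s :: real
  defines "t \<equiv> tanh ((q * a + s) / 2)"
  assumes pos: "a > 0" "q > 0" "s > 0"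
  shows "deriv (char_fun a t q s) (\<i> * of_real a) \<noteq> 0"
proof -
  define E where "E = exp (- s) * exp (- (q * a))"
  define v where "v = (q * a + s) / 2"
  have E: "E = exp (- (2 * v))" unfolding E_def v_def mult_exp_exp by (simp add: algebra_simps)
  have tE: "E * (1 + t) = 1 - t" using exp_minus_tanh[of v] by (simp add: E t_def v_def)
  have "(char_fun a t q s has_field_derivative
     (\<i> * t - of_real (exp (- s)) * (exp (\<i> * q * (\<i> * a)) * (\<i> * q) * (of_real a - \<i> * t * (\<i> * a)) + exp (\<i> * q * (\<i> * a)) * (- (\<i> * t)))))
     (at (\<i> * of_real a))"
    unfolding char_fun_def [abs_def] by (auto intro!: derivative_eq_intros simp: algebra_simps)
  then have "deriv (char_fun a t q s) (\<i> * of_real a) =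
     \<i> * t - of_real (exp (- s)) * (exp (\<i> * q * (\<i> * a)) * (\<i> * q) * (of_real a - \<i> * t * (\<i> * a)) + exp (\<i> * q * (\<i> * a)) * (- (\<i> * t)))"
    by (rule DERIV_imp_deriv)
  also have "exp (\<i> * q * (\<i> * a)) = of_real (exp (- (q * a)))"
    unfolding exp_of_real[symmetric] by (simp add: algebra_simps)
  also have "\<i> * t - of_real (exp (- s)) * (of_real (exp (- (q * a))) * (\<i> * q) * (of_real a - \<i> * t * (\<i> * a)) + of_real (exp (- (q * a))) * (- (\<i> * t)))
     = \<i> * of_real (t + E * t - q * a * (E * (1 + t)))"
    unfolding E_def by (simp add: algebra_simps)
  finally have D: "deriv (char_fun a t q s) (\<i> * of_real a) = \<i> * of_real (t + E * t - q * a * (E * (1 + t)))" .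
  have "t + E * t - q * a * (E * (1 + t)) > 0"
  proof -
    have E0: "E > 0" by (simp add: E)
    have t1: "t * (1 + E) = 1 - E" using tE by algebra
    have "2 * v > 0" using pos by (simp add: v_def add_pos_pos)
    have "q * a < 2 * v" using pos by (simp add: v_def)
    also have "\<dots> < sinh (2 * v)" using sinh_gt_self[OF \<open>2 * v > 0\<close>] .
    also have "\<dots> = (1 / E - E) / 2"
      by (simp add: sinh_def E exp_minus inverse_eq_divide)
    finally have "q * a * (2 * E) < 1 - E\<^sup>2" using E0 by (simp add: field_simps power2_eq_square)
    moreover have "(t + E * t - q * a * (E * (1 + t))) * (1 + E) = (1 - E\<^sup>2) - q * a * (2 * E)"
      using t1 E0 tE by algebra
    ultimately have "(t + E * t - q * a * (E * (1 + t))) * (1 + E) > 0" by simp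
    then show ?thesis using E0 by (simp add: zero_less_mult_iff)
  qed
  then show ?thesis unfolding D mult_eq_0_iff of_real_eq_0_iff by simp
qed

text \<open>Up to the constants \<open>a\<close>, the second term is at most
  \<open>exp (- s)\<close> times \<open>t * norm z\<close>, so a fixed fraction of the first term
  survives. The radius is large enough to absorb the constants.\<close>

lemma norm_char_fun_ge:
  assumes "a > 0" "t > 0" "s > 0" "q > 0" "Im z \<ge> 0"
    "norm z \<ge> 4 * a / (t * (1 - exp (- s)))"
  shows "norm (char_fun a t q s z) \<ge> t * (1 - exp (- s)) / 2 * norm z"
proof -
  define r where "r = exp (- s)"
  have r: "0 < r" "r < 1" using assms by (auto simp: r_def)
  have 1: "norm (of_real a + \<i> * of_real t * z) \<ge> t * norm z - a"
    using norm_triangle_ineq2[of "\<i> * of_real t * z" "- of_real a"] assms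
    by (simp add: norm_mult add.commute)
  have "norm (of_real a - \<i> * of_real t * z) \<le> a + t * norm z"
    using norm_triangle_ineq4[of "of_real a" "\<i> * of_real t * z"] assms by (simp add: norm_mult)
  moreover have "norm (exp (\<i> * of_real q * z)) \<le> 1" using assms by simp
  ultimately have "norm (exp (\<i> * of_real q * z) * (of_real a - \<i> * of_real t * z)) \<le> 1 * (a + t * norm z)"
    unfolding norm_mult by (intro mult_mono) auto
  then have "r * norm (exp (\<i> * of_real q * z) * (of_real a - \<i> * of_real t * z)) \<le> r * (a + t * norm z)"
    using r by simp
  then have 2: "norm (of_real r * exp (\<i> * of_real q * z) * (of_real a - \<i> * of_real t * z)) \<le> r * (a + t * norm z)"
    using r by (simp add: norm_mult mult.assoc)
  have "t * (1 - r) * norm z \<ge> 4 * a" using assms r unfolding r_def[symmetric]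
    by (simp add: field_simps)
  moreover have "r * a \<le> a" using r assms by simp
  ultimately have "t * (1 - r) * norm z - a - r * a \<ge> t * (1 - r) * norm z / 2"
    by linarith
  then have "t * norm z - a - r * (a + t * norm z) \<ge> t * (1 - r) / 2 * norm z"
    by (simp add: algebra_simps)
  moreover have "norm (char_fun a t q s z) \<ge> norm (of_real a + \<i> * of_real t * z)
      - norm (of_real r * exp (\<i> * of_real q * z) * (of_real a - \<i> * of_real t * z))"
    unfolding char_fun_def r_def by (rule norm_triangle_ineq2)
  ultimately show ?thesis using 1 2 unfolding r_def by linarith
qed

section \<open>The positive kernel and its point mass at the origin\<close>

lemma Re_Cayley:
  fixes A N :: complex
  assumes "A \<noteq> N"
  shows "Re (1 + 2 * N / (A - N)) = ((norm A)\<^sup>2 - (norm N)\<^sup>2) / (norm (A - N))\<^sup>2"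
proof -
  have "1 + 2 * N / (A - N) = (A + N) / (A - N)" using assms by (simp add: field_simps)
  then show ?thesis
    by (simp add: complex_div_cnj[of "A + N"] cmod_power2)
       (simp add: power2_eq_square algebra_simps)
qed

text \<open>This is \<open>Re ((1 + \<theta>) / (1 - \<theta>))\<close> on the real line: with
  \<open>A\<close> and \<open>N\<close> the two terms of \<open>char_fun\<close> it is
  \<open>Re (1 + 2 * N / (A - N))\<close>, and \<open>norm N = exp (- s) * norm A\<close>
  there.\<close>

definition approx_kernel :: "real \<Rightarrow> real \<Rightarrow> real \<Rightarrow> real \<Rightarrow> real \<Rightarrow> real" where
  "approx_kernel a t q s x =
     (1 - (exp (- s))\<^sup>2) * (a\<^sup>2 + t\<^sup>2 * x\<^sup>2) / (norm (char_fun a t q s (of_real x)))\<^sup>2"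

text \<open>Once the simple zero at \<open>\<i> * a\<close> is cancelled,
  \<open>F * 2 * \<theta> / (1 - \<theta>)\<close> is regular on the closed upper half-plane with
  decay \<open>1 / norm z ^ 2\<close>, so its integrals tend to 0. Its real part is
  \<open>F * P - F\<close> for the kernel \<open>P\<close>, and \<open>P \<ge> 0\<close> allows
  restriction to a neighbourhood of 0.\<close>

lemma integral_approx_kernel_le:
  fixes a q s :: real and F :: "complex \<Rightarrow> complex"
  defines "t \<equiv> tanh ((q * a + s) / 2)"
  assumes pos: "a > 0" "q > 0" "s > 0" "\<delta> > 0"
    and hol: "F holomorphic_on UNIV" and zero: "F (\<i> * of_real a) = 0"
    and real: "\<And>x::real. F (of_real x) \<in> \<real>" "\<And>x::real. Re (F (of_real x)) \<ge> 0"
    and bound: "\<And>z. Im z \<ge> 0 \<Longrightarrow> norm z \<ge> 1 \<Longrightarrow> norm (F z) \<le> C * exp (q * Im z) / norm z ^ 2"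
    and I: "\<And>R. R > 0 \<Longrightarrow> integral {-R..R} (\<lambda>x. Re (F (of_real x))) \<le> I"
  shows "(\<lambda>x. Re (F (of_real x)) * approx_kernel a t q s x) integrable_on {-\<delta>..\<delta>}"
    and "integral {-\<delta>..\<delta>} (\<lambda>x. Re (F (of_real x)) * approx_kernel a t q s x) \<le> I"
proof -
  define D where "D = char_fun a t q s"
  define r where "r = exp (- s)"
  have r: "0 < r" "r < 1" using pos by (auto simp: r_def)
  have t: "t > 0" using pos by (simp add: t_def add_pos_pos)
  have holD: "D holomorphic_on UNIV" unfolding D_def by (rule char_fun_holomorphic)
  have D0: "z = \<i> * of_real a" if "Im z \<ge> 0" "D z = 0" for z
    using char_fun_zero_unique[OF pos(1-3) that(1)] that(2) by (simp add: D_def t_def)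
  obtain F2 where F2: "F2 holomorphic_on UNIV" "\<And>z. F z = (z - \<i> * of_real a) * F2 z"
    using entire_factor_zero[OF hol zero] by metis
  obtain D1 where D1: "D1 holomorphic_on UNIV" "\<And>z. D z = (z - \<i> * of_real a) * D1 z"
      "D1 (\<i> * of_real a) = deriv D (\<i> * of_real a)"
    using entire_factor_zero[OF holD] char_fun_zero[of a q s] unfolding D_def t_def by metis
  have D1_nz: "D1 z \<noteq> 0" if "Im z \<ge> 0" for z
    using D0[OF that] D1(2)[of z] D1(3) char_fun_deriv_nonzero[OF pos(1-3)]
    by (auto simp: D_def t_def)
  \<comment> \<open>\<open>E / D\<close> is \<open>2 * \<theta> / (1 - \<theta>)\<close>.\<close>
  define E where "E z = 2 * of_real r * exp (\<i> * of_real q * z) * (of_real a - \<i> * of_real t * z)" for z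
  define g where "g z = F2 z * E z / D1 z" for z
  have holg: "g holomorphic_on {z. D1 z \<noteq> 0}"
    unfolding g_def E_def
    by (intro holomorphic_intros holomorphic_on_subset[OF F2(1)] holomorphic_on_subset[OF D1(1)]) auto
  have g_eq: "g z = F z * E z / D z" if "z \<noteq> \<i> * of_real a" for z
    using that by (simp add: g_def F2(2) D1(2))
  have lim_g: "((\<lambda>R. integral {-R..R} (\<lambda>x. g (of_real x))) \<longlongrightarrow> - (\<i> * pi * 0)) at_top"
  proof (rule integral_reals_eq_semicircle_limit)
    show "continuous_on {z. Im z \<ge> 0} g"
      by (rule holomorphic_on_imp_continuous_on, rule holomorphic_on_subset[OF holg]) (use D1_nz in auto)
    show "g holomorphic_on {z. Im z > 0}"
      by (rule holomorphic_on_subset[OF holg]) (use D1_nz in auto)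
    \<comment> \<open>This radius makes \<open>norm_char_fun_ge\<close> applicable and exceeds both
      \<open>a\<close>, so that \<open>z\<close> is not the zero, and 1, where \<open>bound\<close>
      starts.\<close>
    fix z assume z: "Im z \<ge> 0" "norm z \<ge> 4 * a / (t * (1 - r)) + a + 1"
    have p: "4 * a / (t * (1 - r)) > 0" using pos t r by simp
    have z1: "norm z \<ge> 1" "norm z > a" "norm z \<ge> 4 * a / (t * (1 - r))" using z p pos by linarith+
    have zia: "z \<noteq> \<i> * of_real a" using z1 pos by (auto simp: norm_mult)
    have "a \<le> t * norm z"
    proof -
      have "a \<le> 4 * a / (1 - r)" using pos r by (simp add: field_simps)
      also have "\<dots> = t * (4 * a / (t * (1 - r)))" using t r by (simp add: field_simps)
      also have "\<dots> \<le> t * norm z" using z1 t by (intro mult_left_mono) auto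
      finally show ?thesis .
    qed
    moreover have "norm (of_real a - \<i> * of_real t * z) \<le> a + t * norm z"
      using norm_triangle_ineq4[of "of_real a" "\<i> * of_real t * z"] pos t by (simp add: norm_mult)
    ultimately have "norm (of_real a - \<i> * of_real t * z) \<le> 2 * t * norm z" by linarith
    moreover have "norm (2 * of_real r * exp (\<i> * of_real q * z)) \<le> 2 * exp (- (q * Im z))"
      using r by (simp add: norm_mult)
    ultimately have E: "norm (E z) \<le> 2 * exp (- (q * Im z)) * (2 * t * norm z)"
      unfolding E_def norm_mult[of _ "of_real a - \<i> * of_real t * z"] by (intro mult_mono) auto
    have D: "norm (D z) \<ge> t * (1 - r) / 2 * norm z"
      using norm_char_fun_ge[of a t s q z] pos t z z1 unfolding D_def r_def by auto
    have D_pos: "t * (1 - r) / 2 * norm z > 0" using t r z1(1) by (intro mult_pos_pos) auto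
    \<comment> \<open>The factor \<open>exp (- (q * Im z))\<close> of \<open>E\<close> cancels the
      growth of \<open>F\<close>, which is why \<open>\<theta>\<close> carries the same
      \<open>q\<close> as \<open>bound\<close>.\<close>
    have "norm (g z) = norm (F z) * norm (E z) / norm (D z)" by (simp add: g_eq[OF zia] norm_mult norm_divide)
    also have "\<dots> \<le> (C * exp (q * Im z) / norm z ^ 2) * (2 * exp (- (q * Im z)) * (2 * t * norm z)) / (t * (1 - r) / 2 * norm z)"
      using bound[OF z(1) z1(1)] E D D_pos t
      by (intro frac_le mult_mono mult_nonneg_nonneg order_trans[OF norm_ge_zero bound[OF z(1) z1(1)]]) auto
    also have "\<dots> = (8 * C / (1 - r)) / norm z ^ 2"
    proof -
      define u where "u = 1 - r"
      have "u > 0" "norm z > 0" using r z1(1) by (auto simp: u_def)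
      then show ?thesis using t unfolding u_def[symmetric]
        by (simp add: exp_minus field_simps power2_eq_square)
    qed
    finally show "norm (g z - 0 / z) \<le> (8 * C / (1 - r)) / norm z ^ 2" by simp
  qed
  have contF: "continuous_on UNIV F" using hol by (rule holomorphic_on_imp_continuous_on)
  have contRF: "continuous_on A (\<lambda>x. Re (F (of_real x)))" for A :: "real set"
    by (intro continuous_intros continuous_on_compose2[OF contF]) auto
  have contg: "continuous_on A (\<lambda>x. g (of_real x))" for A :: "real set"
    by (rule continuous_on_compose2[OF holomorphic_on_imp_continuous_on[OF holg]])
       (auto intro!: continuous_intros D1_nz)
  let ?P = "approx_kernel a t q s"
  have P: "Re (F (of_real x)) * ?P x = Re (F (of_real x)) + Re (g (of_real x))" for x :: real
  proof -
    define A N where "A = of_real a + \<i> * of_real t * of_real x"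
      and "N = of_real r * exp (\<i> * of_real q * of_real x) * (of_real a - \<i> * of_real t * of_real x)"
    have DA: "D (of_real x) = A - N" by (simp add: D_def char_fun_def A_def N_def r_def)
    have xa: "of_real x \<noteq> \<i> * of_real a" using pos by (auto simp: complex_eq_iff)
    have "D (of_real x) \<noteq> 0" using D0[of "of_real x"] xa by auto
    then have "A \<noteq> N" using DA by auto
    have nA: "(norm A)\<^sup>2 = a\<^sup>2 + t\<^sup>2 * x\<^sup>2" unfolding A_def by (simp add: cmod_power2 power_mult_distrib)
    have nN: "(norm N)\<^sup>2 = r\<^sup>2 * (a\<^sup>2 + t\<^sup>2 * x\<^sup>2)"
      unfolding N_def norm_mult power_mult_distrib using r by (simp add: cmod_power2 power_mult_distrib)
    have "?P x = ((norm A)\<^sup>2 - (norm N)\<^sup>2) / (norm (A - N))\<^sup>2"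
      unfolding nA nN approx_kernel_def DA[symmetric] D_def r_def by (simp add: algebra_simps)
    also have "\<dots> = Re (1 + 2 * N / (A - N))" by (rule Re_Cayley[OF \<open>A \<noteq> N\<close>, symmetric])
    finally have "?P x = Re (1 + 2 * N / (A - N))" .
    moreover have "g (of_real x) = F (of_real x) * (2 * N / (A - N))"
      unfolding g_eq[OF xa] DA by (simp add: E_def N_def mult_ac)
    moreover obtain f where "F (of_real x) = of_real f" using real(1)[of x] by (auto elim: Reals_cases)
    moreover define Q where "Q = 2 * N / (A - N)"
    ultimately show ?thesis unfolding Q_def[symmetric] by (simp add: distrib_left)
  qed
  have intP: "(\<lambda>x. Re (F (of_real x)) * ?P x) integrable_on {c..d}" for c d
    unfolding P by (intro integrable_continuous_real continuous_intros contRF contg)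
  show "(\<lambda>x. Re (F (of_real x)) * ?P x) integrable_on {-\<delta>..\<delta>}" by (rule intP)
  have P0: "?P x \<ge> 0" for x unfolding approx_kernel_def using r by (simp add: r_def power_le_one)
  have le: "integral {-\<delta>..\<delta>} (\<lambda>x. Re (F (of_real x)) * ?P x) \<le> I + Re (integral {-R..R} (\<lambda>x. g (of_real x)))"
    if "R \<ge> \<delta>" for R
  proof -
    have "integral {-\<delta>..\<delta>} (\<lambda>x. Re (F (of_real x)) * ?P x) \<le> integral {-R..R} (\<lambda>x. Re (F (of_real x)) * ?P x)"
      using that P0 real by (intro integral_subset_le intP) auto
    also have "\<dots> = integral {-R..R} (\<lambda>x. Re (F (of_real x))) + integral {-R..R} (\<lambda>x. Re (g (of_real x)))"
      unfolding P by (intro integral_add integrable_continuous_real continuous_intros contRF contg)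
    also have "integral {-R..R} (\<lambda>x. Re (g (of_real x))) = Re (integral {-R..R} (\<lambda>x. g (of_real x)))"
      using integral_linear[OF integrable_continuous_real[OF contg] bounded_linear_Re, of "-R" R]
      by (simp add: o_def)
    also have "integral {-R..R} (\<lambda>x. Re (F (of_real x))) \<le> I" using I that pos by simp
    finally show ?thesis by simp
  qed
  have "((\<lambda>R. I + Re (integral {-R..R} (\<lambda>x. g (of_real x)))) \<longlongrightarrow> I + Re (- (\<i> * pi * 0))) at_top"
    by (intro tendsto_intros lim_g)
  then show "integral {-\<delta>..\<delta>} (\<lambda>x. Re (F (of_real x)) * ?P x) \<le> I"
    using eventually_mono[OF eventually_ge_at_top[of \<delta>] le]
    by (intro tendsto_lowerbound[of "\<lambda>R. I + Re (integral {-R..R} (\<lambda>x. g (of_real x)))"]) auto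
qed

text \<open>When \<open>M\<close> and \<open>A\<close> have equal modulus, the squared modulus of
  \<open>A - r * M\<close> splits into a radial part and \<open>r\<close> times that of
  \<open>A - M\<close>. The latter is governed by \<open>a * sin y - t * x * cos y\<close> at
  \<open>y = q * x / 2\<close>; \<open>\<kappa>\<close> collects its slope
  \<open>a * q / 2 - t\<close> at 0 and the Taylor remainder.\<close>

lemma norm_char_fun_real_le:
  fixes a t q s x :: real
  assumes "a > 0" "q > 0" "s > 0" "0 \<le> t" "t \<le> 1"
  defines "\<kappa> \<equiv> 2 / a * (\<bar>a * q / 2 - t\<bar> + (a * q\<^sup>2 / 8 + q / 2) * \<bar>x\<bar>)"
  shows "(norm (char_fun a t q s (of_real x)))\<^sup>2 \<le> (a\<^sup>2 + t\<^sup>2 * x\<^sup>2) * ((1 - exp (- s))\<^sup>2 + \<kappa>\<^sup>2 * x\<^sup>2)"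
proof -
  define r where "r = exp (- s)"
  have r: "0 < r" "r < 1" using assms by (auto simp: r_def)
  define y where "y = q * x / 2"
  define A where "A = Complex a (t * x)"
  define M where "M = cis (2 * y) * cnj A"
  have char: "char_fun a t q s (of_real x) = A - of_real r * M"
  proof -
    have "exp (\<i> * of_real q * of_real x) = cis (2 * y)" by (simp add: cis_conv_exp y_def mult_ac)
    moreover have "of_real a + \<i> * of_real t * of_real x = A" "of_real a - \<i> * of_real t * of_real x = cnj A"
      by (simp_all add: A_def complex_eq_iff)
    ultimately show ?thesis by (simp add: char_fun_def M_def r_def mult.assoc)
  qed
  have nA: "(norm A)\<^sup>2 = a\<^sup>2 + t\<^sup>2 * x\<^sup>2" by (simp add: A_def cmod_power2 power_mult_distrib)
  have nM: "norm M = norm A" by (simp add: M_def norm_mult)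
  have split: "(norm (A - of_real r * M))\<^sup>2 = (1 - r)\<^sup>2 * (norm A)\<^sup>2 + r * (norm (A - M))\<^sup>2"
  proof -
    have "(Re M)\<^sup>2 + (Im M)\<^sup>2 = (Re A)\<^sup>2 + (Im A)\<^sup>2"
      using nM cmod_power2[of A] cmod_power2[of M] by simp
    then show ?thesis unfolding cmod_power2 by simp algebra
  qed
  define w where "w = a * sin y - t * x * cos y"
  have "A - M = cis y * (cis (- y) * A - cnj (cis (- y) * A))"
    unfolding M_def by (simp add: right_diff_distrib mult.assoc[symmetric] cis_mult cis_cnj)
  then have "norm (A - M) = norm (cis (- y) * A - cnj (cis (- y) * A))" by (simp add: norm_mult)
  also have "cis (- y) * A - cnj (cis (- y) * A) = of_real (- 2 * w) * \<i>"
    by (simp add: complex_eq_iff A_def w_def)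
  finally have nAM: "norm (A - M) = 2 * \<bar>w\<bar>" by (simp add: norm_mult)
  have sin: "\<bar>sin y - y\<bar> \<le> y\<^sup>2 / 2"
    using Maclaurin_sin_bound[of y 2] by (simp add: numeral_2_eq_2 sin_coeff_def)
  have cos: "\<bar>1 - cos y\<bar> \<le> \<bar>y\<bar>"
  proof -
    have "1 - cos y = 2 * (sin (y / 2))\<^sup>2" using cos_double_sin[of "y / 2"] by simp
    moreover have "(sin (y / 2))\<^sup>2 \<le> \<bar>y / 2\<bar>"
    proof -
      have "\<bar>sin (y / 2)\<bar> * \<bar>sin (y / 2)\<bar> \<le> 1 * \<bar>y / 2\<bar>"
        using abs_sin_x_le_abs_x[of "y / 2"] abs_sin_le_one[of "y / 2"] by (intro mult_mono) auto
      then show ?thesis by (simp add: power2_eq_square)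
    qed
    ultimately show ?thesis by simp
  qed
  have "w = (a * q / 2 - t) * x + a * (sin y - y) + t * x * (1 - cos y)"
    by (simp add: w_def y_def algebra_simps)
  also have "\<bar>\<dots>\<bar> \<le> \<bar>(a * q / 2 - t) * x\<bar> + \<bar>a * (sin y - y)\<bar> + \<bar>t * x * (1 - cos y)\<bar>" by linarith
  also have "\<bar>a * (sin y - y)\<bar> \<le> a * (y\<^sup>2 / 2)" using sin assms by (simp add: abs_mult)
  also have "\<bar>t * x * (1 - cos y)\<bar> \<le> 1 * \<bar>x\<bar> * \<bar>y\<bar>"
    unfolding abs_mult using cos assms by (intro mult_mono) auto
  also have "\<bar>(a * q / 2 - t) * x\<bar> + a * (y\<^sup>2 / 2) + 1 * \<bar>x\<bar> * \<bar>y\<bar> = a / 2 * \<kappa> * \<bar>x\<bar>"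
  proof -
    define e where "e = \<bar>a * q / 2 - t\<bar>"
    define X where "X = \<bar>x\<bar>"
    have y2: "y\<^sup>2 = q\<^sup>2 / 4 * X\<^sup>2" and ya: "\<bar>y\<bar> = q / 2 * X"
      using assms(2) by (auto simp: y_def X_def abs_mult power_divide power_mult_distrib)
    show ?thesis
      using assms(1) unfolding \<kappa>_def abs_mult e_def[symmetric] X_def[symmetric] y2 ya
      by (simp add: power2_eq_square field_simps)
  qed
  finally have "2 * \<bar>w\<bar> \<le> a * (\<kappa> * \<bar>x\<bar>)" by simp
  then have "(2 * \<bar>w\<bar>)\<^sup>2 \<le> (a * (\<kappa> * \<bar>x\<bar>))\<^sup>2" by (intro power_mono) auto
  then have "(norm (A - M))\<^sup>2 \<le> a\<^sup>2 * (\<kappa>\<^sup>2 * x\<^sup>2)" unfolding nAM by (simp add: power_mult_distrib)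
  also have "\<dots> \<le> (norm A)\<^sup>2 * (\<kappa>\<^sup>2 * x\<^sup>2)" unfolding nA by (intro mult_right_mono) auto
  finally have 1: "(norm (A - M))\<^sup>2 \<le> (norm A)\<^sup>2 * (\<kappa>\<^sup>2 * x\<^sup>2)" .
  have "r * (norm (A - M))\<^sup>2 \<le> 1 * (norm (A - M))\<^sup>2" using r by (intro mult_right_mono) auto
  then have "r * (norm (A - M))\<^sup>2 \<le> (norm A)\<^sup>2 * (\<kappa>\<^sup>2 * x\<^sup>2)" using 1 by linarith
  then have "(norm (char_fun a t q s (of_real x)))\<^sup>2 \<le> (norm A)\<^sup>2 * ((1 - r)\<^sup>2 + \<kappa>\<^sup>2 * x\<^sup>2)"
    unfolding char split by (simp add: algebra_simps)
  then show ?thesis unfolding nA r_def .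
qed

lemma integral_Lorentz:
  fixes b \<kappa> \<delta> :: real
  assumes "b > 0" "\<kappa> > 0" "\<delta> > 0"
  shows "((\<lambda>x. 1 / (b\<^sup>2 + \<kappa>\<^sup>2 * x\<^sup>2)) has_integral 2 * arctan (\<kappa> * \<delta> / b) / (\<kappa> * b)) {-\<delta>..\<delta>}"
proof -
  have "((\<lambda>x. 1 / (b\<^sup>2 + \<kappa>\<^sup>2 * x\<^sup>2)) has_integral
      arctan (\<kappa> * \<delta> / b) / (\<kappa> * b) - arctan (\<kappa> * (-\<delta>) / b) / (\<kappa> * b)) {-\<delta>..\<delta>}"
  proof (rule fundamental_theorem_of_calculus)
    fix x
    have "b\<^sup>2 + \<kappa>\<^sup>2 * x\<^sup>2 > 0" using assms by (simp add: add_pos_nonneg)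
    moreover have "1 + (\<kappa> * x / b)\<^sup>2 = (b\<^sup>2 + \<kappa>\<^sup>2 * x\<^sup>2) / b\<^sup>2"
      using assms by (simp add: field_simps)
    ultimately have "inverse (1 + (\<kappa> * x / b)\<^sup>2) * (\<kappa> / b) / (\<kappa> * b) = 1 / (b\<^sup>2 + \<kappa>\<^sup>2 * x\<^sup>2)"
      using assms by (simp add: power2_eq_square)
    moreover have "((\<lambda>x. arctan (\<kappa> * x / b) / (\<kappa> * b)) has_real_derivative
        inverse (1 + (\<kappa> * x / b)\<^sup>2) * (\<kappa> / b) / (\<kappa> * b)) (at x)"
      by (intro DERIV_cdivide DERIV_chain2[OF DERIV_arctan] DERIV_cmult_Id)
    ultimately have "((\<lambda>x. arctan (\<kappa> * x / b) / (\<kappa> * b)) has_real_derivative 1 / (b\<^sup>2 + \<kappa>\<^sup>2 * x\<^sup>2)) (at x)"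
      by simp
    then show "((\<lambda>x. arctan (\<kappa> * x / b) / (\<kappa> * b)) has_vector_derivative 1 / (b\<^sup>2 + \<kappa>\<^sup>2 * x\<^sup>2)) (at x within {-\<delta>..\<delta>})"
      by (simp add: has_real_derivative_iff_has_vector_derivative[symmetric] has_field_derivative_at_within)
  qed (use assms in auto)
  moreover have "arctan (\<kappa> * (-\<delta>) / b) = - arctan (\<kappa> * \<delta> / b)" by (simp flip: arctan_minus)
  ultimately show ?thesis by simp
qed

lemma tanh_diff_le: "tanh y - tanh x \<le> y - x" if "x \<le> y" for x y :: real
proof -
  have "y - tanh y \<ge> x - tanh x"
  proof (rule DERIV_nonneg_imp_nondecreasing[OF that])
    show "\<exists>d. ((\<lambda>x. x - tanh x) has_real_derivative d) (at y) \<and> d \<ge> 0" for y :: real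
      by (intro exI[of _ "(tanh y)\<^sup>2"]) (auto intro!: derivative_eq_intros)
  qed
  then show ?thesis by simp
qed

text \<open>Near 0 the kernel dominates a Lorentz profile with one fixed \<open>\<kappa>\<close>,
  whose integral is explicit. The term \<open>s / 2\<close> in \<open>\<kappa>\<close> pays for
  replacing \<open>t\<close> by \<open>tanh (a * q / 2)\<close>.\<close>

lemma kernel_lower_bound:
  fixes a q s :: real and F :: "complex \<Rightarrow> complex"
  assumes pos: "a > 0" "q > 0" "s > 0" "\<delta> > 0"
    and hol: "F holomorphic_on UNIV" and zero: "F (\<i> * of_real a) = 0"
    and real: "\<And>x::real. F (of_real x) \<in> \<real>" "\<And>x::real. Re (F (of_real x)) \<ge> 0"
    and bound: "\<And>z. Im z \<ge> 0 \<Longrightarrow> norm z \<ge> 1 \<Longrightarrow> norm (F z) \<le> C * exp (q * Im z) / norm z ^ 2"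
    and I: "\<And>R. R > 0 \<Longrightarrow> integral {-R..R} (\<lambda>x. Re (F (of_real x))) \<le> I"
    and m: "m \<ge> 0" "\<And>x. \<bar>x\<bar> \<le> \<delta> \<Longrightarrow> m \<le> Re (F (of_real x))"
  defines "\<kappa> \<equiv> 2 / a * ((a * q / 2 - tanh (a * q / 2)) + s / 2 + (a * q\<^sup>2 / 8 + q / 2) * \<delta>)"
  shows "m * ((1 + exp (- s)) * (2 * arctan (\<kappa> * \<delta> / (1 - exp (- s))) / \<kappa>)) \<le> I"
proof -
  define t where "t = tanh ((q * a + s) / 2)"
  define r where "r = exp (- s)"
  have r: "0 < r" "r < 1" using pos by (auto simp: r_def)
  have t: "0 \<le> t" "t \<le> 1" using pos tanh_real_lt_1[of "(q * a + s) / 2"] by (auto simp: t_def)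
  have "tanh (a * q / 2) \<le> t" unfolding t_def using pos by (simp add: mult.commute)
  moreover have "t - tanh (a * q / 2) \<le> s / 2"
    using tanh_diff_le[of "a * q / 2" "(q * a + s) / 2"] pos by (simp add: t_def field_simps)
  moreover have less: "tanh (a * q / 2) < a * q / 2" using pos by (intro tanh_less_self) auto
  ultimately have abs: "\<bar>a * q / 2 - t\<bar> \<le> (a * q / 2 - tanh (a * q / 2)) + s / 2"
    and "(a * q / 2 - tanh (a * q / 2)) + s / 2 > 0"
    using pos by linarith+
  then have "\<kappa> > 0"
    unfolding \<kappa>_def using pos less by (intro mult_pos_pos add_pos_pos) auto
  have kernel: "m * ((1 - r\<^sup>2) * (1 / ((1 - r)\<^sup>2 + \<kappa>\<^sup>2 * x\<^sup>2))) \<le> Re (F (of_real x)) * approx_kernel a t q s x"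
    if x: "x \<in> {-\<delta>..\<delta>}" for x
  proof -
    have ax: "\<bar>x\<bar> \<le> \<delta>" using x by auto
    define D where "D = (norm (char_fun a t q s (of_real x)))\<^sup>2"
    define \<kappa>' where "\<kappa>' = 2 / a * (\<bar>a * q / 2 - t\<bar> + (a * q\<^sup>2 / 8 + q / 2) * \<bar>x\<bar>)"
    have "0 \<le> \<kappa>'" unfolding \<kappa>'_def using pos
      by (intro mult_nonneg_nonneg add_nonneg_nonneg) auto
    moreover have "\<kappa>' \<le> \<kappa>" unfolding \<kappa>_def \<kappa>'_def
      by (intro mult_left_mono add_mono abs ax) (use pos in auto)
    ultimately have "\<kappa>'\<^sup>2 * x\<^sup>2 \<le> \<kappa>\<^sup>2 * x\<^sup>2" by (intro mult_right_mono power_mono) auto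
    have pA: "a\<^sup>2 + t\<^sup>2 * x\<^sup>2 > 0" using pos by (simp add: add_pos_nonneg)
    have "D \<le> (a\<^sup>2 + t\<^sup>2 * x\<^sup>2) * ((1 - r)\<^sup>2 + \<kappa>'\<^sup>2 * x\<^sup>2)"
      unfolding D_def r_def \<kappa>'_def using pos t by (intro norm_char_fun_real_le) auto
    also have "\<dots> \<le> (a\<^sup>2 + t\<^sup>2 * x\<^sup>2) * ((1 - r)\<^sup>2 + \<kappa>\<^sup>2 * x\<^sup>2)"
      using pA \<open>\<kappa>'\<^sup>2 * x\<^sup>2 \<le> \<kappa>\<^sup>2 * x\<^sup>2\<close> by (intro mult_left_mono) auto
    finally have D: "D \<le> (a\<^sup>2 + t\<^sup>2 * x\<^sup>2) * ((1 - r)\<^sup>2 + \<kappa>\<^sup>2 * x\<^sup>2)" .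
    have pL: "(1 - r)\<^sup>2 + \<kappa>\<^sup>2 * x\<^sup>2 > 0" using r by (simp add: add_pos_nonneg)
    have r2: "0 \<le> 1 - r\<^sup>2" using r by (simp add: power_le_one)
    have "char_fun a t q s (of_real x) \<noteq> 0"
      using char_fun_zero_unique[OF pos(1-3), of "of_real x"] pos
      by (auto simp: t_def complex_eq_iff)
    then have "D > 0" by (simp add: D_def)
    have "(1 - r\<^sup>2) * (1 / ((1 - r)\<^sup>2 + \<kappa>\<^sup>2 * x\<^sup>2)) \<le> (1 - r\<^sup>2) * ((a\<^sup>2 + t\<^sup>2 * x\<^sup>2) / D)"
      using D \<open>D > 0\<close> pL pA r2 by (intro mult_left_mono) (auto simp: field_simps)
    also have "\<dots> = approx_kernel a t q s x" by (simp add: approx_kernel_def D_def r_def)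
    finally have K: "(1 - r\<^sup>2) * (1 / ((1 - r)\<^sup>2 + \<kappa>\<^sup>2 * x\<^sup>2)) \<le> approx_kernel a t q s x" .
    show ?thesis
      using K m(2)[OF ax] m(1) real(2) r2 pL by (intro mult_mono) auto
  qed
  have L: "((\<lambda>x. m * ((1 - r\<^sup>2) * (1 / ((1 - r)\<^sup>2 + \<kappa>\<^sup>2 * x\<^sup>2)))) has_integral
      m * ((1 - r\<^sup>2) * (2 * arctan (\<kappa> * \<delta> / (1 - r)) / (\<kappa> * (1 - r))))) {-\<delta>..\<delta>}"
    using r pos \<open>\<kappa> > 0\<close> by (intro has_integral_mult_right integral_Lorentz) auto
  have "m * ((1 - r\<^sup>2) * (2 * arctan (\<kappa> * \<delta> / (1 - r)) / (\<kappa> * (1 - r)))) \<le>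
      integral {-\<delta>..\<delta>} (\<lambda>x. Re (F (of_real x)) * approx_kernel a t q s x)"
    using integral_approx_kernel_le(1)[OF pos hol zero real bound I] kernel
    unfolding t_def[symmetric]
    by (intro has_integral_le[OF L integrable_integral]) auto
  also have "\<dots> \<le> I"
    using integral_approx_kernel_le(2)[OF pos hol zero real bound I] by (simp add: t_def)
  also have "(1 - r\<^sup>2) * (2 * arctan (\<kappa> * \<delta> / (1 - r)) / (\<kappa> * (1 - r))) =
      (1 + r) * (2 * arctan (\<kappa> * \<delta> / (1 - r)) / \<kappa>)"
    using r \<open>\<kappa> > 0\<close> by (simp add: field_simps power2_eq_square)
  finally show ?thesis by (simp add: r_def)
qed

text \<open>As \<open>s\<close> decreases to 0 the profile concentrates at 0: the arctangent tends
  to \<open>pi / 2\<close>, and the mass to \<open>2 * pi / \<kappa>\<close> with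
  \<open>\<kappa>\<close> taken at \<open>s = 0\<close>.\<close>

lemma kernel_lower_bound_limit_s:
  fixes a q :: real and F :: "complex \<Rightarrow> complex"
  assumes pos: "a > 0" "q > 0" "\<delta> > 0"
    and hol: "F holomorphic_on UNIV" and zero: "F (\<i> * of_real a) = 0"
    and real: "\<And>x::real. F (of_real x) \<in> \<real>" "\<And>x::real. Re (F (of_real x)) \<ge> 0"
    and bound: "\<And>z. Im z \<ge> 0 \<Longrightarrow> norm z \<ge> 1 \<Longrightarrow> norm (F z) \<le> C * exp (q * Im z) / norm z ^ 2"
    and I: "\<And>R. R > 0 \<Longrightarrow> integral {-R..R} (\<lambda>x. Re (F (of_real x))) \<le> I"
    and m: "m \<ge> 0" "\<And>x. \<bar>x\<bar> \<le> \<delta> \<Longrightarrow> m \<le> Re (F (of_real x))"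
  shows "m * (pi * a / ((a * q / 2 - tanh (a * q / 2)) + (a * q\<^sup>2 / 8 + q / 2) * \<delta>)) \<le> I"
proof -
  define A where "A = a * q / 2 - tanh (a * q / 2)"
  define B where "B = (a * q\<^sup>2 / 8 + q / 2) * \<delta>"
  have A: "A > 0" unfolding A_def using tanh_less_self[of "a * q / 2"] pos by simp
  have B: "B > 0" unfolding B_def using pos by (auto intro!: mult_pos_pos add_pos_pos)
  have "((\<lambda>s. m * ((1 + exp (- s)) * (2 * arctan (2 / a * (A + s / 2 + B) * \<delta> / (1 - exp (- s))) / (2 / a * (A + s / 2 + B)))))
      \<longlongrightarrow> m * ((1 + exp (- 0)) * (2 * (pi / 2) / (2 / a * (A + 0 / 2 + B))))) (at_right 0)"
  proof (intro tendsto_intros)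
    have 1: "filterlim (\<lambda>s::real. 1 / (1 - exp (- s))) at_top (at_right 0)" by real_asymp
    have "((\<lambda>s. 2 / a * (A + s / 2 + B) * \<delta>) \<longlongrightarrow> 2 / a * (A + 0 / 2 + B) * \<delta>) (at_right 0)"
      by (intro tendsto_intros) auto
    from filterlim_tendsto_pos_mult_at_top[OF this _ 1]
    have "filterlim (\<lambda>s. 2 / a * (A + s / 2 + B) * \<delta> / (1 - exp (- s))) at_top (at_right 0)"
      using A B pos by (simp add: add_pos_pos)
    from filterlim_compose[OF tendsto_arctan_at_top this]
    show "((\<lambda>s. arctan (2 / a * (A + s / 2 + B) * \<delta> / (1 - exp (- s)))) \<longlongrightarrow> pi / 2) (at_right 0)" .
  qed (use A B pos in auto)
  moreover have "\<forall>\<^sub>F s in at_right 0. m * ((1 + exp (- s)) * (2 * arctan (2 / a * (A + s / 2 + B) * \<delta> / (1 - exp (- s))) / (2 / a * (A + s / 2 + B)))) \<le> I"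
    using kernel_lower_bound[OF pos(1,2) _ pos(3) hol zero real bound I m]
    unfolding A_def B_def by (auto simp: eventually_at_filter intro!: always_eventually)
  ultimately have "m * ((1 + exp (- 0)) * (2 * (pi / 2) / (2 / a * (A + 0 / 2 + B)))) \<le> I"
    by (intro tendsto_upperbound[where F = "at_right (0::real)"]) auto
  also have "(1 + exp (- 0)) * (2 * (pi / 2) / (2 / a * (A + 0 / 2 + B))) = pi * a / (A + B)"
    using A B pos by (simp add: field_simps)
  finally show ?thesis by (simp add: A_def B_def)
qed

text \<open>By continuity any \<open>m\<close> below \<open>Re (F 0)\<close> is a lower bound near
  0, so \<open>\<delta>\<close> tends to 0 first, and then \<open>m\<close> to
  \<open>Re (F 0)\<close>.\<close>

lemma kernel_lower_bound_limit:
  fixes a q :: real and F :: "complex \<Rightarrow> complex"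
  assumes pos: "a > 0" "q > 0"
    and hol: "F holomorphic_on UNIV" and zero: "F (\<i> * of_real a) = 0"
    and real: "\<And>x::real. F (of_real x) \<in> \<real>" "\<And>x::real. Re (F (of_real x)) \<ge> 0"
    and bound: "\<And>z. Im z \<ge> 0 \<Longrightarrow> norm z \<ge> 1 \<Longrightarrow> norm (F z) \<le> C * exp (q * Im z) / norm z ^ 2"
    and I: "\<And>R. R > 0 \<Longrightarrow> integral {-R..R} (\<lambda>x. Re (F (of_real x))) \<le> I"
  shows "Re (F 0) * (pi * a / (a * q / 2 - tanh (a * q / 2))) \<le> I"
proof -
  define A where "A = a * q / 2 - tanh (a * q / 2)"
  define B where "B = (a * q\<^sup>2 / 8 + q / 2)"
  have A: "A > 0" unfolding A_def using tanh_less_self[of "a * q / 2"] pos by simp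
  have m_bound: "m * (pi * a / A) \<le> I" if m: "0 \<le> m" "m < Re (F 0)" for m
  proof -
    have "isCont F (of_real 0)"
      using holomorphic_on_imp_continuous_on[OF hol] by (simp add: continuous_on_eq_continuous_at)
    then have "isCont (\<lambda>x::real. F (of_real x)) 0" by (rule isCont_o2[rotated]) simp
    then have "((\<lambda>x::real. F (of_real x)) \<longlongrightarrow> F (of_real 0)) (at 0)" by (simp add: isCont_def)
    then have "((\<lambda>x::real. Re (F (of_real x))) \<longlongrightarrow> Re (F (of_real 0))) (at 0)" by (rule tendsto_Re)
    then have "((\<lambda>x::real. Re (F (of_real x))) \<longlongrightarrow> Re (F (of_real 0))) (nhds 0)"
      using tendsto_at_iff_tendsto_nhds[of "\<lambda>x::real. Re (F (of_real x))" 0] by simp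
    then have "\<forall>\<^sub>F x in nhds 0. m < Re (F (of_real x))" using m by (intro order_tendstoD) auto
    then obtain d where d: "d > 0" "\<And>x. \<bar>x\<bar> < d \<Longrightarrow> m < Re (F (of_real x))"
      by (auto simp: eventually_nhds_metric dist_real_def)
    have "((\<lambda>\<delta>. m * (pi * a / (A + B * \<delta>))) \<longlongrightarrow> m * (pi * a / (A + B * 0))) (at_right 0)"
      using A by (intro tendsto_intros) auto
    moreover have "\<forall>\<^sub>F \<delta> in at_right 0. m * (pi * a / (A + B * \<delta>)) \<le> I"
      using eventually_at_right_less[of 0] eventually_at_right_real[OF d(1)]
    proof eventually_elim
      case (elim \<delta>)
      show ?case
        unfolding A_def B_def
      proof (rule kernel_lower_bound_limit_s[OF pos _ hol zero real bound I])
        show "m \<le> Re (F (of_real x))" if "\<bar>x\<bar> \<le> \<delta>" for x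
          using d(2)[of x] that elim by simp
      qed (use elim m in auto)
    qed
    ultimately show ?thesis by (simp add: tendsto_upperbound)
  qed
  show ?thesis
  \<comment> \<open>In this case no \<open>m\<close> with \<open>0 \<le> m < Re (F 0)\<close>
    exists, and the claim is just \<open>0 \<le> I\<close>.\<close>
  proof (cases "Re (F 0) = 0")
    case True
    have "0 \<le> integral {-1..1} (\<lambda>x. Re (F (of_real x)))"
      using real by (intro Henstock_Kurzweil_Integration.integral_nonneg integrable_continuous_real
          continuous_intros continuous_on_compose2[OF holomorphic_on_imp_continuous_on[OF hol]]) auto
    also have "\<dots> \<le> I" by (rule I) simp
    finally show ?thesis using True by simp
  next
    case False
    then have "Re (F 0) > 0" using real(2)[of 0] by simp
    have "((\<lambda>m. m * (pi * a / A)) \<longlongrightarrow> Re (F 0) * (pi * a / A)) (at_left (Re (F 0)))"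
      by (intro tendsto_intros)
    moreover have "\<forall>\<^sub>F m in at_left (Re (F 0)). m * (pi * a / A) \<le> I"
      using eventually_at_left_real[OF \<open>Re (F 0) > 0\<close>] by eventually_elim (rule m_bound, auto)
    ultimately show ?thesis unfolding A_def by (simp add: tendsto_upperbound)
  qed
qed

section \<open>The Fejer factor and the bound for admissible pairs\<close>

text \<open>The entire function with value \<open>sin z / z\<close> at \<open>z ^ 2\<close>, as a
  power series so that no branch of the square root enters.\<close>

definition sinc_sqrt :: "complex \<Rightarrow> complex" where
  "sinc_sqrt \<zeta> = (\<Sum>n. of_real (sin_coeff (2 * n + 1)) * \<zeta> ^ n)"

lemma sin_odd_sums:
  "(\<lambda>n. z * (of_real (sin_coeff (2 * n + 1)) * (z\<^sup>2) ^ n)) sums sin (z :: complex)"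
proof -
  have eq: "z ^ (2 * n + 1) = z * (z\<^sup>2) ^ n" for n
    by (simp flip: power_mult)
  have "(\<lambda>n. sin_coeff (2 * n + 1) *\<^sub>R z ^ (2 * n + 1)) sums sin z"
    using sin_converges[of z]
    by (subst sums_mono_reindex[of "\<lambda>n. 2 * n + 1"])
       (auto simp: strict_mono_def sin_coeff_def elim!: oddE)
  then show ?thesis unfolding eq by (simp add: scaleR_conv_of_real mult_ac)
qed

lemma sinc_sqrt_sums: "(\<lambda>n. of_real (sin_coeff (2 * n + 1)) * \<zeta> ^ n) sums sinc_sqrt \<zeta>"
proof -
  have "summable (\<lambda>n. of_real (sin_coeff (2 * n + 1)) * \<zeta> ^ n)"
  proof (cases "\<zeta> = 0")
    case True
    then show ?thesis by (intro summable_finite[of "{0}"]) auto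
  next
    case False
    have "summable (\<lambda>n. csqrt \<zeta> * (of_real (sin_coeff (2 * n + 1)) * ((csqrt \<zeta>)\<^sup>2) ^ n))"
      by (rule sums_summable[OF sin_odd_sums])
    then show ?thesis using False by (subst (asm) summable_cmult_iff) simp
  qed
  then show ?thesis unfolding sinc_sqrt_def by (rule summable_sums)
qed

lemma sinc_sqrt_power2: "z * sinc_sqrt (z\<^sup>2) = sin z"
  by (rule sums_unique2[OF sums_mult[OF sinc_sqrt_sums] sin_odd_sums])

lemma sinc_sqrt_0 [simp]: "sinc_sqrt 0 = 1"
proof -
  have "(\<lambda>n. of_real (sin_coeff (2 * n + 1)) * 0 ^ n :: complex) sums (of_real (sin_coeff (2 * 0 + 1)) * 0 ^ 0)"
    by (rule sums_If_finite_set'[of _ _ "{0}", OF sums_zero, THEN sums_cong[THEN iffD1, rotated]]) auto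
  then show ?thesis using sinc_sqrt_sums[of 0] by (simp add: sums_unique2 sin_coeff_def)
qed

lemma holomorphic_on_sinc_sqrt: "sinc_sqrt holomorphic_on A"
proof -
  have "sinc_sqrt field_differentiable at z" for z
  proof -
    have "sinc_sqrt holomorphic_on ball 0 (norm z + 1)"
      by (rule power_series_holomorphic[where a = "\<lambda>n. of_real (sin_coeff (2 * n + 1))"])
         (use sinc_sqrt_sums in auto)
    then show ?thesis
      by (rule holomorphic_on_imp_differentiable_at) auto
  qed
  then show ?thesis
    by (auto simp: holomorphic_on_def field_differentiable_at_within)
qed

lemma sinc_sqrt_compose_holomorphic [holomorphic_intros]:
  "f holomorphic_on A \<Longrightarrow> (\<lambda>z. sinc_sqrt (f z)) holomorphic_on A"
  using holomorphic_on_compose[of f A sinc_sqrt] holomorphic_on_sinc_sqrt by (simp add: o_def)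

lemma cnj_sinc_sqrt: "cnj (sinc_sqrt \<zeta>) = sinc_sqrt (cnj \<zeta>)"
proof -
  have "(\<lambda>n. cnj (of_real (sin_coeff (2 * n + 1)) * \<zeta> ^ n)) sums cnj (sinc_sqrt \<zeta>)"
    using sinc_sqrt_sums[of \<zeta>] by (simp only: sums_cnj)
  then show ?thesis using sinc_sqrt_sums[of "cnj \<zeta>"] by (simp add: sums_unique2)
qed

lemma norm_sin_le: "norm (sin z) \<le> exp \<bar>Im z\<bar>" for z :: complex
proof -
  have "norm (sin z) = norm (exp (\<i> * z) - exp (- (\<i> * z))) / 2"
    by (simp add: sin_exp_eq norm_divide norm_mult)
  also have "norm (exp (\<i> * z) - exp (- (\<i> * z))) \<le> exp (- Im z) + exp (Im z)"
    by (rule order_trans[OF norm_triangle_ineq4]) simp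
  also have "\<dots> \<le> 2 * exp \<bar>Im z\<bar>" by (auto simp: abs_if)
  finally show ?thesis by simp
qed

text \<open>For a finite integral the growth of \<open>F\<close> depends on \<open>Im z\<close>
  alone. The factor \<open>\<phi>\<close> supplies the missing decay; it lies in
  \<open>[0, 1]\<close> on the reals and equals 1 at 0, so the integral does not grow and
  \<open>F 0\<close> is kept. The type rises to \<open>2 * pi + \<eta>\<close>, and
  \<open>\<eta>\<close> tends to 0.\<close>

lemma gap_lower_bound:
  fixes F :: "complex \<Rightarrow> complex"
  assumes a: "a > 0" and F: "F \<in> exp_type_class (2 * pi)" and zero: "F (\<i> * of_real a) = 0"
    and real: "\<And>x::real. F (of_real x) \<in> \<real>" "\<And>x::real. Re (F (of_real x)) \<ge> 0"
    and one: "Re (F 0) \<ge> 1"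
  shows "ennreal (pi * a / (pi * a - tanh (pi * a))) \<le> (\<integral>\<^sup>+x. ennreal (Re (F (of_real x))) \<partial>lborel)"
proof (cases "(\<integral>\<^sup>+x. ennreal (Re (F (of_real x))) \<partial>lborel) = \<infinity>")
  case False
  define f where "f x = Re (F (of_real x))" for x :: real
  have hol: "F holomorphic_on UNIV" using F by (simp add: exp_type_class_def)
  have cont: "continuous_on A f" for A :: "real set"
    unfolding f_def
    by (intro continuous_intros continuous_on_compose2[OF holomorphic_on_imp_continuous_on[OF hol]]) auto
  obtain I where I: "I \<ge> 0" "(\<integral>\<^sup>+x. ennreal (f x) \<partial>lborel) = ennreal I"
    using False by (cases "\<integral>\<^sup>+x. ennreal (f x) \<partial>lborel" rule: ennreal_cases) (auto simp: f_def)
  have f_int: "(f has_integral I) UNIV"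
    using I real cont by (intro nn_integral_has_integral borel_measurable_continuous_onI) (auto simp: f_def)
  have int_le: "integral {c..d} f \<le> I" for c d
    using real by (intro has_integral_subset_le[OF _ integrable_integral f_int] integrable_continuous_real cont)
      (auto simp: f_def)
  have normF: "norm (F (of_real x)) = f x" for x :: real
    using real[of x] by (auto simp: f_def elim!: Reals_cases)
  have bound: "1 * (pi * a / (a * (2 * pi + \<eta>) / 2 - tanh (a * (2 * pi + \<eta>) / 2))) \<le> I" if \<eta>: "\<eta> > 0" for \<eta>
  proof -
    obtain C where C: "C > 0" "\<And>z. norm (F z) \<le> C * exp ((2 * pi + \<eta> / 4) * norm z)"
      using F \<eta> by (auto simp: exp_type_class_def dest!: spec[of _ "\<eta> / 4"])
    obtain B where B: "B > 0" "\<And>z. norm (F z) \<le> B * exp ((2 * pi + \<eta> / 4 + \<eta> / 4) * \<bar>Im z\<bar>)"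
      using exp_type_integrable_bound[OF hol C(2), of I "\<eta> / 4"] C(1) \<eta> int_le normF by (auto simp: add_pos_pos)
    \<comment> \<open>Of the excess type \<open>\<eta>\<close>, one quarter comes from the
      definition of the class, one from \<open>exp_type_integrable_bound\<close>, and
      \<open>2 * \<epsilon>\<close> from the squared sine.\<close>
    define \<epsilon> where "\<epsilon> = \<eta> / 4"
    have \<epsilon>: "\<epsilon> > 0" using \<eta> by (simp add: \<epsilon>_def)
    define \<phi> where "\<phi> z = (sinc_sqrt ((of_real \<epsilon> * z)\<^sup>2))\<^sup>2" for z
    have \<phi>_eq: "\<phi> z * (of_real \<epsilon> * z)\<^sup>2 = (sin (of_real \<epsilon> * z))\<^sup>2" for z
      unfolding \<phi>_def by (simp add: power_mult_distrib[symmetric] sinc_sqrt_power2[symmetric] mult.commute)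
    have \<phi>_real: "\<phi> (of_real x) \<in> \<real>" "0 \<le> Re (\<phi> (of_real x))" "Re (\<phi> (of_real x)) \<le> 1" for x :: real
    proof -
      define s where "s = sinc_sqrt ((of_real \<epsilon> * of_real x)\<^sup>2)"
      have "cnj s = s" by (simp add: s_def cnj_sinc_sqrt)
      then obtain r where r: "s = of_real r" by (metis Reals_cases Reals_cnj_iff)
      have "\<bar>\<epsilon> * x\<bar> * \<bar>r\<bar> \<le> \<bar>\<epsilon> * x\<bar>"
      proof -
        have "of_real (\<epsilon> * x * r) = (of_real (sin (\<epsilon> * x)) :: complex)"
          using sinc_sqrt_power2[of "of_real \<epsilon> * of_real x"] r unfolding s_def by (simp add: sin_of_real[symmetric])
        then have "\<epsilon> * x * r = sin (\<epsilon> * x)" by (simp only: of_real_eq_iff)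
        then show ?thesis using abs_sin_x_le_abs_x[of "\<epsilon> * x"] by (simp flip: abs_mult)
      qed
      then have "\<bar>r\<bar> \<le> 1"
      proof (cases "x = 0")
        case True
        then show ?thesis using r by (simp add: s_def)
      next
        case False
        then have "\<bar>\<epsilon> * x\<bar> > 0" using \<epsilon> by simp
        with \<open>\<bar>\<epsilon> * x\<bar> * \<bar>r\<bar> \<le> \<bar>\<epsilon> * x\<bar>\<close> show ?thesis by simp
      qed
      then have "r\<^sup>2 \<le> 1" by (simp add: abs_square_le_1)
      moreover have "\<phi> (of_real x) = of_real (r\<^sup>2)" using r by (simp add: \<phi>_def s_def)
      ultimately show "\<phi> (of_real x) \<in> \<real>" "0 \<le> Re (\<phi> (of_real x))" "Re (\<phi> (of_real x)) \<le> 1" by auto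
    qed
    define F1 where "F1 z = F z * \<phi> z" for z
    have ReF1: "Re (F1 (of_real x)) = f x * Re (\<phi> (of_real x))" "F1 (of_real x) \<in> \<real>" for x :: real
      using real(1)[of x] \<phi>_real(1)[of x] by (auto simp: F1_def f_def complex_is_Real_iff)
    have holF1: "F1 holomorphic_on UNIV" unfolding F1_def \<phi>_def by (intro holomorphic_intros hol)
    have "Re (F1 0) * (pi * a / (a * (2 * pi + \<eta>) / 2 - tanh (a * (2 * pi + \<eta>) / 2))) \<le> I"
    proof (rule kernel_lower_bound_limit[OF a _ holF1])
      show "F1 (\<i> * of_real a) = 0" by (simp add: F1_def zero)
      show "0 \<le> Re (F1 (of_real x))" for x using real \<phi>_real by (simp add: ReF1 f_def)
      show "integral {-R..R} (\<lambda>x. Re (F1 (of_real x))) \<le> I" for R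
      proof -
        have "integral {-R..R} (\<lambda>x. Re (F1 (of_real x))) \<le> integral {-R..R} f"
        proof (intro integral_le integrable_continuous_real cont)
          show "continuous_on {-R..R} (\<lambda>x. Re (F1 (of_real x)))"
            by (intro continuous_intros
                continuous_on_compose2[OF holomorphic_on_imp_continuous_on[OF holF1]]) auto
          show "Re (F1 (of_real x)) \<le> f x" for x
            using \<phi>_real[of x] real(2)[of x] by (simp add: ReF1 f_def mult_left_le)
        qed
        then show ?thesis using int_le by (rule order_trans)
      qed
      fix z assume z: "Im z \<ge> 0" "norm z \<ge> 1"
      have "norm (\<phi> z) * (\<epsilon> * norm z)\<^sup>2 = (norm (sin (of_real \<epsilon> * z)))\<^sup>2"
        using arg_cong[OF \<phi>_eq[of z], of norm] \<epsilon> by (simp add: norm_mult norm_power)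
      also have "\<dots> \<le> (exp \<bar>\<epsilon> * Im z\<bar>)\<^sup>2"
        using norm_sin_le[of "of_real \<epsilon> * z"] by (intro power_mono) auto
      also have "\<dots> = exp (2 * \<epsilon> * Im z)" using z \<epsilon> by (simp flip: exp_double)
      finally have "norm (\<phi> z) \<le> exp (2 * \<epsilon> * Im z) / (\<epsilon> * norm z)\<^sup>2"
      proof (subst pos_le_divide_eq)
        have "norm z > 0" using z(2) by linarith
        then show "(\<epsilon> * norm z)\<^sup>2 > 0" using \<epsilon> by simp
      qed
      moreover have "norm (F z) \<le> B * exp ((2 * pi + \<eta> / 2) * Im z)"
        using B(2)[of z] z by (simp add: add.commute)
      ultimately have "norm (F1 z) \<le> (B * exp ((2 * pi + \<eta> / 2) * Im z)) * (exp (2 * \<epsilon> * Im z) / (\<epsilon> * norm z)\<^sup>2)"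
        unfolding F1_def norm_mult using B by (intro mult_mono) auto
      also have "\<dots> = B / \<epsilon>\<^sup>2 * (exp ((2 * pi + \<eta> / 2) * Im z) * exp (2 * \<epsilon> * Im z)) / norm z ^ 2"
        by (simp add: power_mult_distrib)
      also have "exp ((2 * pi + \<eta> / 2) * Im z) * exp (2 * \<epsilon> * Im z) = exp ((2 * pi + \<eta>) * Im z)"
        by (simp add: mult_exp_exp \<epsilon>_def algebra_simps)
      finally show "norm (F1 z) \<le> B / \<epsilon>\<^sup>2 * exp ((2 * pi + \<eta>) * Im z) / norm z ^ 2" .
    qed (use ReF1 \<eta> in \<open>auto simp: add_pos_pos\<close>)
    moreover have "Re (F1 0) = Re (F 0)" by (simp add: F1_def \<phi>_def)
    moreover have "0 \<le> pi * a / (a * (2 * pi + \<eta>) / 2 - tanh (a * (2 * pi + \<eta>) / 2))"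
    proof -
      have "a * (2 * pi + \<eta>) / 2 > 0" using a \<eta> by (simp add: add_pos_pos)
      from tanh_less_self[OF this] show ?thesis using a by simp
    qed
    ultimately show ?thesis
      using mult_right_mono[OF one, of "pi * a / (a * (2 * pi + \<eta>) / 2 - tanh (a * (2 * pi + \<eta>) / 2))"] by simp
  qed
  have "tanh (pi * a) < pi * a" using a by (intro tanh_less_self) simp
  then have "((\<lambda>\<eta>. 1 * (pi * a / (a * (2 * pi + \<eta>) / 2 - tanh (a * (2 * pi + \<eta>) / 2)))) \<longlongrightarrow>
      1 * (pi * a / (a * (2 * pi + 0) / 2 - tanh (a * (2 * pi + 0) / 2)))) (at_right 0)"
    by (intro tendsto_intros) (auto simp: mult.commute)
  moreover have "\<forall>\<^sub>F \<eta> in at_right 0. 1 * (pi * a / (a * (2 * pi + \<eta>) / 2 - tanh (a * (2 * pi + \<eta>) / 2))) \<le> I"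
    using eventually_at_right_less[of 0] by eventually_elim (rule bound)
  ultimately have "1 * (pi * a / (a * (2 * pi + 0) / 2 - tanh (a * (2 * pi + 0) / 2))) \<le> I"
    by (rule tendsto_upperbound) simp
  then have "pi * a / (pi * a - tanh (pi * a)) \<le> I" by (simp add: mult.commute)
  then show ?thesis using I unfolding f_def by (simp add: ennreal_leI)
qed simp

lemma exp_type_class_diff:
  assumes "F \<in> exp_type_class \<delta>" "G \<in> exp_type_class \<delta>"
  shows "(\<lambda>z. F z - G z) \<in> exp_type_class \<delta>"
  unfolding exp_type_class_def
proof safe
  show "(\<lambda>z. F z - G z) holomorphic_on UNIV"
    using assms by (intro holomorphic_intros) (auto simp: exp_type_class_def)
  fix \<epsilon> :: real assume "\<epsilon> > 0"
  then obtain C D where "C > 0" "D > 0" "\<And>z. norm (F z) \<le> C * exp ((\<delta> + \<epsilon>) * norm z)"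
      "\<And>z. norm (G z) \<le> D * exp ((\<delta> + \<epsilon>) * norm z)"
    using assms unfolding exp_type_class_def by blast
  then show "\<exists>C>0. \<forall>z. norm (F z - G z) \<le> C * exp ((\<delta> + \<epsilon>) * norm z)"
    by (intro exI[of _ "C + D"] conjI allI)
       (auto simp: distrib_right intro!: order_trans[OF norm_triangle_ineq4] add_mono)
qed

lemma admissible_pair_gap_ge:
  assumes a: "a > 0" and adm: "admissible_pair a S T"
  shows "gap_integral S T \<ge> ennreal (pi * a / (pi * a - tanh (pi * a)))"
proof -
  define F where "F z = T z - S z" for z
  have S: "S (of_real x) \<in> \<real>" "Re (S (of_real x)) \<le> step0 x" for x
    using adm by (auto simp: admissible_pair_def minorant_on_reals_def)
  have T: "T (of_real x) \<in> \<real>" "step0 x \<le> Re (T (of_real x))" for x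
    using adm by (auto simp: admissible_pair_def majorant_on_reals_def)
  \<comment> \<open>As \<open>step0 0 = 1\<close>, the inequality at 0 itself is too weak; the left
    limit gives the sharper bound.\<close>
  have "Re (S 0) \<le> 0"
  proof -
    have "S holomorphic_on UNIV" using adm by (simp add: admissible_pair_def exp_type_class_def)
    then have "isCont S (of_real 0)"
      using holomorphic_on_imp_continuous_on[of S UNIV] by (simp add: continuous_on_eq_continuous_at)
    then have "isCont (\<lambda>x::real. S (of_real x)) 0" by (rule isCont_o2[rotated]) simp
    then have "((\<lambda>x::real. Re (S (of_real x))) \<longlongrightarrow> Re (S (of_real 0))) (at_left 0)"
      by (intro tendsto_Re) (simp add: isCont_def filterlim_at_split)
    moreover have "\<forall>\<^sub>F x in at_left 0. Re (S (of_real x)) \<le> 0"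
    proof -
      have "\<forall>\<^sub>F x in at_left 0. x < (0::real)" by (simp add: eventually_at_filter)
      then show ?thesis
      proof eventually_elim
        case (elim x)
        then show ?case using S(2)[of x] by (simp add: step0_def)
      qed
    qed
    ultimately show ?thesis by (simp add: tendsto_upperbound)
  qed
  have "ennreal (pi * a / (pi * a - tanh (pi * a))) \<le> (\<integral>\<^sup>+x. ennreal (Re (F (of_real x))) \<partial>lborel)"
  proof (rule gap_lower_bound[OF a])
    show "F \<in> exp_type_class (2 * pi)" "F (\<i> * of_real a) = 0"
      using adm by (auto simp: admissible_pair_def F_def [abs_def] intro!: exp_type_class_diff)
    show "F (of_real x) \<in> \<real>" for x using S T by (simp add: F_def)
    show "0 \<le> Re (F (of_real x))" for x using S(2)[of x] T(2)[of x] by (simp add: F_def)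
    show "1 \<le> Re (F 0)" using T(2)[of 0] \<open>Re (S 0) \<le> 0\<close> by (simp add: F_def step0_def)
  qed
  then show ?thesis by (simp add: F_def gap_integral_def)
qed

section \<open>Interpolation by divided differences\<close>

lemma has_integral_Lorentz_atLeast:
  fixes y c :: real
  assumes "y > 0"
  shows "((\<lambda>v. 1 / (v\<^sup>2 + y\<^sup>2)) has_integral (pi / 2 - arctan (c / y)) / y) {c..}"
proof -
  have pos: "v\<^sup>2 + y\<^sup>2 > 0" for v :: real using assms by (simp add: add_nonneg_pos)
  have "(\<integral>\<^sup>+v. ennreal (1 / (v\<^sup>2 + y\<^sup>2)) * indicator {c..} v \<partial>lborel) = ennreal ((pi / 2) / y - arctan (c / y) / y)"
  proof (rule nn_integral_FTC_atLeast)
    show "((\<lambda>v. arctan (v / y) / y) has_real_derivative 1 / (x\<^sup>2 + y\<^sup>2)) (at x)" for x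
    proof -
      have "1 + (x / y)\<^sup>2 = (x\<^sup>2 + y\<^sup>2) / y\<^sup>2" using assms by (simp add: field_simps)
      then have "inverse (1 + (x / y)\<^sup>2) * (1 / y) / y = 1 / (x\<^sup>2 + y\<^sup>2)"
        using assms by (simp add: power2_eq_square)
      moreover have "((\<lambda>v. arctan (v / y) / y) has_real_derivative inverse (1 + (x / y)\<^sup>2) * (1 / y) / y) (at x)"
        by (intro DERIV_cdivide DERIV_chain2[OF DERIV_arctan] DERIV_ident)
      ultimately show ?thesis by simp
    qed
    have "filterlim (\<lambda>v. v / y) at_top at_top"
      using assms by (simp add: divide_inverse filterlim_at_top_mult_tendsto_pos[OF tendsto_const _ filterlim_ident])
    from filterlim_compose[OF tendsto_arctan_at_top this]
    show "((\<lambda>v. arctan (v / y) / y) \<longlongrightarrow> (pi / 2) / y) at_top"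
      using assms by (intro tendsto_intros) auto
    show "(\<lambda>v. 1 / (v\<^sup>2 + y\<^sup>2)) \<in> borel_measurable borel"
      by measurable
  qed (use pos in \<open>auto intro: less_imp_le\<close>)
  also have "(\<integral>\<^sup>+v. ennreal (1 / (v\<^sup>2 + y\<^sup>2)) * indicator {c..} v \<partial>lborel)
      = (\<integral>\<^sup>+v. ennreal (if v \<in> {c..} then 1 / (v\<^sup>2 + y\<^sup>2) else 0) \<partial>lborel)"
    by (intro nn_integral_cong) (auto simp: indicator_def)
  finally have "(\<integral>\<^sup>+v. ennreal (if v \<in> {c..} then 1 / (v\<^sup>2 + y\<^sup>2) else 0) \<partial>lborel) = ennreal ((pi / 2 - arctan (c / y)) / y)"
    by (simp add: diff_divide_distrib)
  then have "((\<lambda>v. if v \<in> {c..} then 1 / (v\<^sup>2 + y\<^sup>2) else 0) has_integral (pi / 2 - arctan (c / y)) / y) UNIV"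
    using pos assms arctan_ubound[of "c / y"]
    by (intro nn_integral_has_integral) (auto intro: less_imp_le)
  then show ?thesis by (simp only: has_integral_restrict_UNIV)
qed

text \<open>The integral form agrees with the difference quotient off the diagonal and remains
  regular across it for entire \<open>G\<close>.\<close>

definition divdiff :: "(complex \<Rightarrow> complex) \<Rightarrow> complex \<Rightarrow> complex \<Rightarrow> complex" where
  "divdiff G \<zeta> \<eta> = integral {0..1} (\<lambda>s. deriv G (\<eta> + of_real s * (\<zeta> - \<eta>)))"

context
  fixes G :: "complex \<Rightarrow> complex"
  assumes holG: "G holomorphic_on UNIV"
begin

lemma continuous_deriv_compose:
  assumes "continuous_on A f" shows "continuous_on A (\<lambda>x. deriv G (f x))"
    and "continuous_on A (\<lambda>x. deriv (deriv G) (f x))"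
proof -
  have "deriv G holomorphic_on UNIV" using holG by (rule holomorphic_deriv) simp
  moreover from this have "deriv (deriv G) holomorphic_on UNIV" by (rule holomorphic_deriv) simp
  ultimately show "continuous_on A (\<lambda>x. deriv G (f x))" "continuous_on A (\<lambda>x. deriv (deriv G) (f x))"
    by (auto intro!: continuous_on_compose2[OF holomorphic_on_imp_continuous_on assms])
qed

lemma divdiff_eq:
  assumes "\<zeta> \<noteq> \<eta>" shows "divdiff G \<zeta> \<eta> = (G \<zeta> - G \<eta>) / (\<zeta> - \<eta>)"
proof -
  have "((\<lambda>s. (\<zeta> - \<eta>) * deriv G (\<eta> + of_real s * (\<zeta> - \<eta>))) has_integral
      G (\<eta> + of_real 1 * (\<zeta> - \<eta>)) - G (\<eta> + of_real 0 * (\<zeta> - \<eta>))) {0..1}"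
  proof (rule fundamental_theorem_of_calculus)
    fix s :: real
    have "((\<lambda>w. G (\<eta> + w * (\<zeta> - \<eta>))) has_field_derivative (\<zeta> - \<eta>) * deriv G (\<eta> + of_real s * (\<zeta> - \<eta>))) (at (of_real s))"
    proof -
      have "((\<lambda>w. \<eta> + w * (\<zeta> - \<eta>)) has_field_derivative (\<zeta> - \<eta>)) (at (of_real s))"
        by (auto intro!: derivative_eq_intros)
      from DERIV_chain2[OF holomorphic_derivI[OF holG open_UNIV UNIV_I] this]
      show ?thesis by (simp add: mult.commute)
    qed
    then show "((\<lambda>s. G (\<eta> + of_real s * (\<zeta> - \<eta>))) has_vector_derivative
        (\<zeta> - \<eta>) * deriv G (\<eta> + of_real s * (\<zeta> - \<eta>))) (at s within {0..1})"
      by (rule has_vector_derivative_real_field)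
  qed auto
  from integral_unique[OF this] have "(\<zeta> - \<eta>) * divdiff G \<zeta> \<eta> = G \<zeta> - G \<eta>"
    by (simp add: divdiff_def)
  then show ?thesis using assms by (simp add: field_simps)
qed

lemma continuous_on_divdiff:
  assumes "continuous_on A f" "continuous_on A g"
  shows "continuous_on A (\<lambda>x. divdiff G (f x) (g x))"
proof -
  have "continuous_on UNIV (\<lambda>x::complex \<times> complex. integral (cbox 0 1) (\<lambda>s. deriv G (snd x + of_real s * (fst x - snd x))))"
    by (rule integral_continuous_on_param)
       (auto simp: case_prod_unfold intro!: continuous_deriv_compose continuous_intros)
  then have "continuous_on UNIV (\<lambda>x. divdiff G (fst x) (snd x))" by (simp add: divdiff_def)
  from continuous_on_compose2[OF this continuous_on_Pair[OF assms]] show ?thesis by simp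
qed

lemma divdiff_has_derivative:
  "((\<lambda>\<zeta>. divdiff G \<zeta> \<eta>) has_field_derivative
     integral {0..1} (\<lambda>s. of_real s * deriv (deriv G) (\<eta> + of_real s * (\<zeta> - \<eta>)))) (at \<zeta>)"
proof -
  have hol': "deriv G holomorphic_on UNIV" using holG by (rule holomorphic_deriv) simp
  have "((\<lambda>\<zeta>. integral (cbox 0 1) (\<lambda>s. deriv G (\<eta> + of_real s * (\<zeta> - \<eta>)))) has_field_derivative
     integral (cbox 0 1) (\<lambda>s. of_real s * deriv (deriv G) (\<eta> + of_real s * (\<zeta> - \<eta>)))) (at \<zeta> within UNIV)"
  proof (rule leibniz_rule_field_derivative)
    fix w :: complex and s :: real
    show "((\<lambda>\<zeta>. deriv G (\<eta> + of_real s * (\<zeta> - \<eta>))) has_field_derivative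
        of_real s * deriv (deriv G) (\<eta> + of_real s * (w - \<eta>))) (at w within UNIV)"
    proof -
      have "((\<lambda>\<zeta>. \<eta> + of_real s * (\<zeta> - \<eta>)) has_field_derivative of_real s) (at w)"
        by (auto intro!: derivative_eq_intros)
      from DERIV_chain2[OF holomorphic_derivI[OF hol' open_UNIV UNIV_I] this]
      show ?thesis by (simp add: mult.commute)
    qed
    show "(\<lambda>s. deriv G (\<eta> + of_real s * (w - \<eta>))) integrable_on cbox 0 1"
      by (auto intro!: integrable_continuous_real continuous_deriv_compose continuous_intros)
  qed (auto simp: case_prod_unfold intro!: continuous_deriv_compose continuous_intros)
  then show ?thesis by (simp add: divdiff_def)
qed

lemma holomorphic_integral_divdiff:
  fixes k :: "real \<Rightarrow> complex" and f :: "real \<Rightarrow> complex"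
  assumes "continuous_on {0..N} k" "continuous_on {0..N} f"
  shows "(\<lambda>\<zeta>. integral {0..N} (\<lambda>v. k v * divdiff G \<zeta> (f v))) holomorphic_on UNIV"
proof -
  have k: "continuous_on (UNIV \<times> {0..N}) (\<lambda>x::complex \<times> real. k (snd x))"
    and f: "continuous_on (UNIV \<times> {0..N}) (\<lambda>x::complex \<times> real. f (snd x))"
    by (auto intro!: continuous_on_compose2[OF assms(1)] continuous_on_compose2[OF assms(2)] continuous_intros)
  have cont: "continuous_on (UNIV \<times> {0..N}) (\<lambda>x::complex \<times> real. integral (cbox 0 1)
      (\<lambda>s. of_real s * deriv (deriv G) (f (snd x) + of_real s * (fst x - f (snd x)))))"
    by (rule integral_continuous_on_param)
       (auto simp: case_prod_unfold intro!: continuous_deriv_compose continuous_intros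
          continuous_on_compose2[OF f])
  have "(\<lambda>\<zeta>. integral (cbox 0 N) (\<lambda>v. k v * divdiff G \<zeta> (f v))) holomorphic_on UNIV"
  proof (rule leibniz_rule_holomorphic)
    fix \<zeta> v
    show "((\<lambda>\<zeta>. k v * divdiff G \<zeta> (f v)) has_field_derivative
       k v * integral {0..1} (\<lambda>s. of_real s * deriv (deriv G) (f v + of_real s * (\<zeta> - f v)))) (at \<zeta> within UNIV)"
      by (intro DERIV_cmult divdiff_has_derivative)
    show "(\<lambda>v. k v * divdiff G \<zeta> (f v)) integrable_on cbox 0 N"
      using assms by (auto intro!: integrable_continuous_real continuous_intros continuous_on_divdiff)
    show "continuous_on (UNIV \<times> cbox 0 N) (\<lambda>(\<zeta>, v). k v * integral {0..1} (\<lambda>s. of_real s * deriv (deriv G) (f v + of_real s * (\<zeta> - f v))))"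
      using cont k by (auto simp: case_prod_unfold intro!: continuous_intros)
  qed auto
  then show ?thesis by simp
qed

text \<open>For points near the diagonal, where the quotient gives no bound: the segment lies within
  distance 1 of \<open>\<zeta>\<close>, and Cauchy estimates on unit circles reach out to
  \<open>norm \<zeta> + 2\<close>.\<close>

lemma norm_divdiff_le:
  assumes "norm (\<zeta> - \<eta>) \<le> 1" and "\<And>w. norm w \<le> norm \<zeta> + 2 \<Longrightarrow> norm (G w) \<le> M"
  shows "norm (divdiff G \<zeta> \<eta>) \<le> M"
proof -
  have "norm (integral {0..1} (\<lambda>s. deriv G (\<eta> + of_real s * (\<zeta> - \<eta>)))) \<le> integral {0..1} (\<lambda>s::real. M)"
  proof (rule integral_norm_bound_integral)
    show "(\<lambda>s. deriv G (\<eta> + of_real s * (\<zeta> - \<eta>))) integrable_on {0..1}"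
      by (auto intro!: integrable_continuous_real continuous_deriv_compose continuous_intros)
    fix s :: real assume s: "s \<in> {0..1}"
    define w where "w = \<eta> + of_real s * (\<zeta> - \<eta>)"
    have "w - \<zeta> = - (of_real (1 - s) * (\<zeta> - \<eta>))" by (simp add: w_def algebra_simps)
    then have "norm (w - \<zeta>) = (1 - s) * norm (\<zeta> - \<eta>)"
      using s by (simp only: norm_minus_cancel norm_mult norm_of_real) simp
    also have "\<dots> \<le> 1 * 1" using s assms by (intro mult_mono) auto
    finally have "norm w \<le> norm \<zeta> + 1" using norm_triangle_ineq2[of w \<zeta>] by simp
    have "norm ((deriv ^^ 1) G w) \<le> fact 1 * M / 1 ^ 1"
    proof (rule Cauchy_inequality)
      fix x assume "norm (w - x) = 1"
      then have "norm x \<le> norm \<zeta> + 2"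
        using \<open>norm w \<le> norm \<zeta> + 1\<close> norm_triangle_ineq2[of x w] by (simp add: norm_minus_commute)
      then show "norm (G x) \<le> M" by (rule assms)
    qed (auto intro: holomorphic_on_subset[OF holG] holomorphic_on_imp_continuous_on)
    then show "norm (deriv G (\<eta> + of_real s * (\<zeta> - \<eta>))) \<le> M" by (simp add: w_def)
  qed auto
  then show ?thesis by (simp add: divdiff_def)
qed

end

section \<open>The regularised Cauchy transform of the reciprocal of \<open>G\<close>\<close>

text \<open>The variable \<open>\<zeta>\<close> stands for \<open>z ^ 2\<close>, so growth of order
  \<open>1/2\<close> in \<open>\<zeta>\<close> is exponential type \<open>\<kappa>\<close> in
  \<open>z\<close>, and \<open>k v\<close> is the reciprocal of \<open>G\<close> at
  \<open>z = \<i> * v\<close>.\<close>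

locale reciprocal_transform =
  fixes G :: "complex \<Rightarrow> complex" and k :: "real \<Rightarrow> real" and A \<kappa> k0 :: real
  assumes holG: "G holomorphic_on UNIV"
    and growth: "\<And>\<zeta>. norm (G \<zeta>) \<le> A * exp (\<kappa> * sqrt (norm \<zeta>))"
    and pos: "A > 0" "\<kappa> > 0"
    and k_cont: "continuous_on UNIV k"
    and k_bound: "\<And>v. 0 \<le> k v" "\<And>v. k v \<le> k0"
    and k_G: "\<And>v. of_real (k v) * G (of_real (- (v\<^sup>2))) = 1"
begin

text \<open>Off the singularity this is \<open>(k v * G \<zeta> - 1) / (\<zeta> + v ^ 2)\<close>:
  \<open>G \<zeta>\<close> times the integrand of the Cauchy transform of \<open>k\<close>, minus
  the integrand that produces the jump. The normalisation \<open>k_G\<close> removes the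
  pole.\<close>

definition J :: "complex \<Rightarrow> real \<Rightarrow> complex" where
  "J \<zeta> v = of_real (k v) * divdiff G \<zeta> (of_real (- (v\<^sup>2)))"

definition I :: "complex \<Rightarrow> complex" where
  "I \<zeta> = integral {0..} (J \<zeta>)"

definition J_bound :: "real \<Rightarrow> real" where
  "J_bound R = (k0 * (A * exp (\<kappa> * sqrt (R + 2))) + 1) * (2 * R + 5)"

lemma J_eq:
  assumes "\<zeta> + of_real (v\<^sup>2) \<noteq> 0"
  shows "J \<zeta> v = (of_real (k v) * G \<zeta> - 1) / (\<zeta> + of_real (v\<^sup>2))"
proof -
  have "\<zeta> \<noteq> of_real (- (v\<^sup>2))" using assms by (auto simp: add_eq_0_iff)
  then have "J \<zeta> v = of_real (k v) * ((G \<zeta> - G (of_real (- (v\<^sup>2)))) / (\<zeta> - of_real (- (v\<^sup>2))))"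
    unfolding J_def by (subst divdiff_eq[OF holG]) auto
  also have "\<dots> = (of_real (k v) * G \<zeta> - of_real (k v) * G (of_real (- (v\<^sup>2)))) / (\<zeta> + of_real (v\<^sup>2))"
    by (simp add: right_diff_distrib)
  finally show ?thesis unfolding k_G .
qed

lemma continuous_on_J: "continuous_on B (J \<zeta>)"
  unfolding J_def [abs_def]
  by (intro continuous_intros continuous_on_divdiff[OF holG] continuous_on_subset[OF k_cont]) auto

text \<open>Close to the singularity the divided difference is bounded by a Cauchy estimate,
  elsewhere by the quotient. Beyond \<open>v ^ 2 = 2 * R + 1\<close> the denominator is at least
  \<open>(v ^ 2 + 1) / 4\<close>; the factor \<open>2 * R + 5\<close> serves both ranges of
  \<open>v\<close>.\<close>

lemma norm_J_le:
  assumes "v \<ge> 0" "norm \<zeta> \<le> R"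
  shows "norm (J \<zeta> v) \<le> J_bound R * (1 / (v\<^sup>2 + 1\<^sup>2))"
proof -
  define M where "M = A * exp (\<kappa> * sqrt (R + 2))"
  have M: "norm (G w) \<le> M" if "norm w \<le> R + 2" for w
  proof -
    have "A * exp (\<kappa> * sqrt (norm w)) \<le> M" unfolding M_def using pos that by simp
    with growth[of w] show ?thesis by linarith
  qed
  have k0: "k0 \<ge> 0" using k_bound[of 0] by linarith
  have R: "R \<ge> 0" using assms norm_ge_zero[of \<zeta>] by linarith
  have M0: "M > 0" using pos by (simp add: M_def)
  have num: "norm (of_real (k v) * G \<zeta> - 1) \<le> k0 * M + 1"
  proof -
    have "norm (of_real (k v) * G \<zeta>) \<le> k0 * M"
      unfolding norm_mult using k_bound[of v] M[of \<zeta>] assms k0 by (intro mult_mono) auto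
    then show ?thesis using norm_triangle_ineq4[of "of_real (k v) * G \<zeta>" 1] by simp
  qed
  have unif: "norm (J \<zeta> v) \<le> k0 * M + 1"
  proof (cases "norm (\<zeta> - of_real (- (v\<^sup>2))) \<le> 1")
    case True
    have "norm (divdiff G \<zeta> (of_real (- (v\<^sup>2)))) \<le> M"
      using assms by (intro norm_divdiff_le[OF holG True] M) auto
    then have "norm (J \<zeta> v) \<le> k0 * M"
      unfolding J_def norm_mult using k_bound[of v] k0 by (intro mult_mono) auto
    then show ?thesis by simp
  next
    case False
    then have n: "norm (\<zeta> + of_real (v\<^sup>2)) > 1" by simp
    then have "\<zeta> + of_real (v\<^sup>2) \<noteq> 0" by auto
    then have "norm (J \<zeta> v) = norm (of_real (k v) * G \<zeta> - 1) / norm (\<zeta> + of_real (v\<^sup>2))"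
      using J_eq by (simp add: norm_divide)
    also have "\<dots> \<le> (k0 * M + 1) / 1"
      using num n order_trans[OF norm_ge_zero num] by (intro frac_le) auto
    finally show ?thesis by simp
  qed
  have K: "k0 * M + 1 > 0" using k0 M0 by (simp add: add_nonneg_pos)
  have v1: "v\<^sup>2 + 1 > 0" by (simp add: add_nonneg_pos)
  have "norm (J \<zeta> v) \<le> (k0 * M + 1) * ((2 * R + 5) / (v\<^sup>2 + 1))"
  proof (cases "v\<^sup>2 \<le> 2 * R + 1")
    case True
    then have "1 \<le> (2 * R + 5) / (v\<^sup>2 + 1)" using v1 by (simp add: field_simps)
    then have "(k0 * M + 1) * 1 \<le> (k0 * M + 1) * ((2 * R + 5) / (v\<^sup>2 + 1))"
      using K by (intro mult_left_mono) auto
    then show ?thesis by (simp only: mult_1_right) (rule order_trans[OF unif])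
  next
    case False
    have "norm (\<zeta> + of_real (v\<^sup>2)) \<ge> v\<^sup>2 - norm \<zeta>"
      using norm_triangle_ineq2[of "of_real (v\<^sup>2)" "- \<zeta>"] by (simp add: add.commute norm_power)
    then have n: "norm (\<zeta> + of_real (v\<^sup>2)) \<ge> (v\<^sup>2 + 1) / 4" using False assms R by argo
    then have "\<zeta> + of_real (v\<^sup>2) \<noteq> 0" using v1 by auto
    then have "norm (J \<zeta> v) = norm (of_real (k v) * G \<zeta> - 1) / norm (\<zeta> + of_real (v\<^sup>2))"
      using J_eq by (simp add: norm_divide)
    also have "\<dots> \<le> (k0 * M + 1) / ((v\<^sup>2 + 1) / 4)"
      using num n v1 K by (intro frac_le) auto
    also have "\<dots> = (k0 * M + 1) * (4 / (v\<^sup>2 + 1))" by simp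
    also have "\<dots> \<le> (k0 * M + 1) * ((2 * R + 5) / (v\<^sup>2 + 1))"
      using K R v1 by (intro mult_left_mono divide_right_mono) auto
    finally show ?thesis .
  qed
  then show ?thesis by (simp add: J_bound_def M_def)
qed

lemma integrable_J:
  assumes "c \<ge> 0" shows "J \<zeta> integrable_on {c..}"
proof (rule integrable_on_all_intervals_integrable_bound)
  show "(\<lambda>x. if x \<in> {c..} then J \<zeta> x else 0) integrable_on cbox a b" for a b
  proof -
    have "{c..} \<inter> cbox a b = {max c a..b}" by auto
    then show ?thesis
      by (simp only: integrable_restrict_Int) (intro integrable_continuous_real continuous_on_J)
  qed
  show "norm (J \<zeta> v) \<le> J_bound (norm \<zeta>) * (1 / (v\<^sup>2 + 1\<^sup>2))" if "v \<in> {c..}" for v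
    using that assms by (intro norm_J_le) auto
  show "(\<lambda>v. J_bound (norm \<zeta>) * (1 / (v\<^sup>2 + 1\<^sup>2))) integrable_on {c..}"
    using has_integral_mult_right[OF has_integral_Lorentz_atLeast[of 1 c]] by (auto simp: integrable_on_def)
qed

lemma norm_integral_J_le:
  assumes "c \<ge> 0" "norm \<zeta> \<le> R"
  shows "norm (integral {c..} (J \<zeta>)) \<le> J_bound R * (pi / 2 - arctan c)"
proof -
  have hi: "((\<lambda>v. J_bound R * (1 / (v\<^sup>2 + 1\<^sup>2))) has_integral J_bound R * ((pi / 2 - arctan (c / 1)) / 1)) {c..}"
    by (intro has_integral_mult_right has_integral_Lorentz_atLeast) simp
  have "norm (integral {c..} (J \<zeta>)) \<le> integral {c..} (\<lambda>v. J_bound R * (1 / (v\<^sup>2 + 1\<^sup>2)))"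
    using hi assms by (intro integral_norm_bound_integral integrable_J norm_J_le) (auto simp: integrable_on_def)
  then show ?thesis using integral_unique[OF hi] by simp
qed

lemma norm_I_le: "norm (I \<zeta>) \<le> J_bound (norm \<zeta>) * (pi / 2)"
  using norm_integral_J_le[of 0 \<zeta> "norm \<zeta>"] by (simp add: I_def)

text \<open>The truncated integrals are holomorphic, and their tails, at most
  \<open>J_bound R * (pi / 2 - arctan n)\<close>, vanish uniformly on unit balls.\<close>

lemma holomorphic_I: "I holomorphic_on UNIV"
proof (rule holomorphic_uniform_sequence[of UNIV "\<lambda>n \<zeta>. integral {0..real n} (J \<zeta>)"])
  show "(\<lambda>\<zeta>. integral {0..real n} (J \<zeta>)) holomorphic_on UNIV" for n
    unfolding J_def [abs_def]
    by (intro holomorphic_integral_divdiff[OF holG] continuous_intros continuous_on_subset[OF k_cont]) auto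
  fix x :: complex
  define R where "R = norm x + 1"
  have split: "I \<zeta> = integral {0..real n} (J \<zeta>) + integral {real n..} (J \<zeta>)" for \<zeta> n
  proof -
    have "(J \<zeta> has_integral (integral {0..real n} (J \<zeta>) + integral {real n..} (J \<zeta>))) ({0..real n} \<union> {real n..})"
    proof (rule has_integral_Un)
      show "(J \<zeta> has_integral integral {0..real n} (J \<zeta>)) {0..real n}"
        by (intro integrable_integral integrable_continuous_real continuous_on_J)
      show "(J \<zeta> has_integral integral {real n..} (J \<zeta>)) {real n..}"
        by (intro integrable_integral integrable_J) simp
      have "{0..real n} \<inter> {real n..} \<subseteq> {real n}" by auto
      then show "negligible ({0..real n} \<inter> {real n..})" by (rule negligible_subset[rotated]) simp
    qed
    moreover have "{0..real n} \<union> {real n..} = {0..}" by auto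
    ultimately show ?thesis by (auto simp: I_def intro: integral_unique)
  qed
  have "uniform_limit (cball x 1) (\<lambda>n \<zeta>. integral {0..real n} (J \<zeta>)) I sequentially"
  proof (rule uniform_limitI)
    fix e :: real assume "e > 0"
    have "(\<lambda>n. J_bound R * (pi / 2 - arctan (real n))) \<longlonglongrightarrow> J_bound R * (pi / 2 - pi / 2)"
      by (intro tendsto_intros filterlim_compose[OF tendsto_arctan_at_top filterlim_real_sequentially])
    then have "\<forall>\<^sub>F n in sequentially. J_bound R * (pi / 2 - arctan (real n)) < e"
      using \<open>e > 0\<close> by (intro order_tendstoD) auto
    then show "\<forall>\<^sub>F n in sequentially. \<forall>\<zeta>\<in>cball x 1. dist (integral {0..real n} (J \<zeta>)) (I \<zeta>) < e"
    proof eventually_elim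
      case (elim n)
      show ?case
      proof
        fix \<zeta> assume "\<zeta> \<in> cball x 1"
        then have "norm \<zeta> \<le> R"
          using norm_triangle_ineq2[of \<zeta> x] by (simp add: R_def dist_norm norm_minus_commute)
        then have "norm (integral {real n..} (J \<zeta>)) < e"
          using norm_integral_J_le[of "real n" \<zeta> R] elim by simp
        then show "dist (integral {0..real n} (J \<zeta>)) (I \<zeta>) < e"
          unfolding split[of \<zeta> n] by (simp add: dist_norm)
      qed
    qed
  qed
  then show "\<exists>d>0. cball x d \<subseteq> UNIV \<and> uniform_limit (cball x d) (\<lambda>n \<zeta>. integral {0..real n} (J \<zeta>)) I sequentially"
    by (intro exI[of _ 1]) auto
qed auto

end

text \<open>The exponential margin \<open>\<epsilon>\<close> absorbs the cubic factor:
  \<open>c\<close> is chosen for \<open>1 + n \<le> c * (1 + \<epsilon> * n / 3)\<close>, which is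
  at most \<open>c * exp (\<epsilon> * n / 3)\<close>.\<close>

lemma exp_type_classI_poly:
  assumes hol: "F holomorphic_on UNIV"
    and bound: "\<And>z. norm (F z) \<le> B * (1 + norm z) ^ 3 * exp (\<delta> * norm z)"
  shows "F \<in> exp_type_class \<delta>"
  unfolding exp_type_class_def
proof safe
  fix \<epsilon> :: real assume \<epsilon>: "\<epsilon> > 0"
  define c where "c = 1 + 3 / \<epsilon>"
  have c: "c > 0" using \<epsilon> by (simp add: c_def add_pos_pos)
  have "norm (F z) \<le> (\<bar>B\<bar> * c ^ 3 + 1) * exp ((\<delta> + \<epsilon>) * norm z)" for z
  proof -
    define n where "n = norm z"
    have n: "n \<ge> 0" by (simp add: n_def)
    have "1 + n \<le> c * (1 + \<epsilon> * n / 3)" using \<epsilon> n by (simp add: c_def field_simps)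
    also have "\<dots> \<le> c * exp (\<epsilon> * n / 3)"
      using c exp_ge_add_one_self by (intro mult_left_mono) auto
    finally have "(1 + n) ^ 3 \<le> (c * exp (\<epsilon> * n / 3)) ^ 3" using n by (intro power_mono) auto
    also have "\<dots> = c ^ 3 * exp (\<epsilon> * n)"
      by (simp add: power_mult_distrib exp_of_nat_mult[symmetric])
    finally have p: "(1 + n) ^ 3 \<le> c ^ 3 * exp (\<epsilon> * n)" .
    have "norm (F z) \<le> B * (1 + n) ^ 3 * exp (\<delta> * n)" using bound[of z] by (simp add: n_def)
    also have "\<dots> \<le> \<bar>B\<bar> * (1 + n) ^ 3 * exp (\<delta> * n)"
      using n by (intro mult_right_mono) auto
    also have "\<dots> \<le> \<bar>B\<bar> * (c ^ 3 * exp (\<epsilon> * n)) * exp (\<delta> * n)"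
      using p by (intro mult_right_mono mult_left_mono) auto
    also have "\<dots> = (\<bar>B\<bar> * c ^ 3) * exp ((\<delta> + \<epsilon>) * n)" by (simp add: distrib_right exp_add)
    also have "\<dots> \<le> (\<bar>B\<bar> * c ^ 3 + 1) * exp ((\<delta> + \<epsilon>) * n)" by (intro mult_right_mono) auto
    finally show ?thesis by (simp add: n_def)
  qed
  then show "\<exists>C>0. \<forall>z. norm (F z) \<le> C * exp ((\<delta> + \<epsilon>) * norm z)"
    using c by (intro exI[of _ "\<bar>B\<bar> * c ^ 3 + 1"]) (auto intro!: add_nonneg_pos)
qed (use hol in auto)

section \<open>The majorant and the minorant built from a suitable \<open>G\<close>\<close>

text \<open>In the variable \<open>s = v ^ 2\<close>, \<open>k_convex\<close> bounds the rate of
  decrease of \<open>k (sqrt s)\<close> between \<open>a ^ 2\<close> and \<open>s\<close> by its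
  rate on \<open>[0, a ^ 2]\<close> and by its rate on \<open>[0, s]\<close>.\<close>

locale extremal_interpolation = reciprocal_transform G k A "2 * pi" "k 0"
  for G :: "complex \<Rightarrow> complex" and k :: "real \<Rightarrow> real" and A :: real +
  fixes a :: real
  assumes a: "a > 0"
    and G_real: "\<And>x::real. G (of_real x) \<in> \<real>"
    and G_nonneg: "\<And>x::real. x \<ge> 0 \<Longrightarrow> Re (G (of_real x)) \<ge> 0"
    and k_antimono: "\<And>v w. 0 \<le> v \<Longrightarrow> v \<le> w \<Longrightarrow> k w \<le> k v"
    and k_convex: "\<And>v. v > 0 \<Longrightarrow> v \<noteq> a \<Longrightarrow> (k a - k v) / (v\<^sup>2 - a\<^sup>2) \<le> (k 0 - k a) / a\<^sup>2"
      "\<And>v. v > 0 \<Longrightarrow> v \<noteq> a \<Longrightarrow> (k a - k v) / (v\<^sup>2 - a\<^sup>2) \<le> (k 0 - k v) / v\<^sup>2"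
begin

text \<open>The quotient form of the integrand is real; it fails for at most one \<open>v\<close>,
  which the integral ignores.\<close>

lemma I_real: "I (of_real r) \<in> \<real>"
proof -
  define X where "X = {v \<in> {0..}. v\<^sup>2 = - r}"
  have "X \<subseteq> {sqrt (- r)}" by (auto simp: X_def real_sqrt_unique)
  then have "finite X" by (rule finite_subset) simp
  have "Im (J (of_real r) v) = 0" if "v \<in> {0..} - X" for v
  proof -
    have "r + v\<^sup>2 \<noteq> 0" using that by (auto simp: X_def)
    then have "of_real r + of_real (v\<^sup>2) \<noteq> (0::complex)" by (metis of_real_add of_real_eq_0_iff)
    then have "J (of_real r) v \<in> \<real>"
      using G_real[of r] by (auto simp: J_eq intro!: Reals_divide Reals_diff Reals_mult Reals_add)
    then show ?thesis by (simp add: complex_is_Real_iff)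
  qed
  with \<open>finite X\<close> have "((\<lambda>v. Im (J (of_real r) v)) has_integral 0) {0..}"
    by (intro has_integral_spike_finite[OF \<open>finite X\<close> _ has_integral_0]) auto
  moreover have "((\<lambda>v. Im (J (of_real r) v)) has_integral Im (I (of_real r))) {0..}"
    unfolding I_def by (intro has_integral_Im integrable_integral integrable_J) simp
  ultimately show ?thesis by (simp add: has_integral_unique complex_is_Real_iff)
qed

text \<open>The coefficient that cancels the imaginary part of \<open>major\<close> at
  \<open>\<i> * a\<close>. It is the analogue of \<open>Q1\<close> at
  \<open>y ^ 2 = - (a ^ 2)\<close>: the principal value of the integral of
  \<open>k v / (v ^ 2 - a ^ 2)\<close>, divided by \<open>pi\<close>.\<close>

definition Q0 :: real where "Q0 = k a * Re (I (- (of_real a)\<^sup>2)) / pi"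

definition Q1 :: "real \<Rightarrow> real" where "Q1 y = integral {0..} (\<lambda>v. k v / (v\<^sup>2 + y\<^sup>2)) / pi"

lemma k_Lorentz_integrable:
  assumes "y > 0" shows "(\<lambda>v. k v / (v\<^sup>2 + y\<^sup>2)) integrable_on {0..}"
proof (rule integrable_on_all_intervals_integrable_bound)
  have p: "v\<^sup>2 + y\<^sup>2 > 0" for v using assms by (simp add: add_nonneg_pos)
  show "(\<lambda>x. if x \<in> {0..} then k x / (x\<^sup>2 + y\<^sup>2) else 0) integrable_on cbox c d" for c d
  proof -
    have "{0..} \<inter> cbox c d = {max 0 c..d}" by auto
    then show ?thesis
      using p by (simp only: integrable_restrict_Int)
        (intro integrable_continuous_real continuous_intros continuous_on_subset[OF k_cont], auto simp: less_le)
  qed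
  show "norm (k v / (v\<^sup>2 + y\<^sup>2)) \<le> k 0 * (1 / (v\<^sup>2 + y\<^sup>2))" for v
    using k_bound[of v] p[of v] by (simp add: divide_right_mono)
  show "(\<lambda>v. k 0 * (1 / (v\<^sup>2 + y\<^sup>2))) integrable_on {0..}"
    using has_integral_mult_right[OF has_integral_Lorentz_atLeast[OF assms, of 0]] by (auto simp: integrable_on_def)
qed

lemma Lorentz_has_integral:
  assumes "y > 0" shows "((\<lambda>v. 1 / (v\<^sup>2 + y\<^sup>2)) has_integral pi / (2 * y)) {0..}"
  using has_integral_Lorentz_atLeast[OF assms, of 0] by simp

text \<open>The subtracted \<open>pi / (2 * y)\<close>, multiplied by \<open>x / pi\<close> in
  \<open>major\<close>, becomes half the sign of \<open>x\<close> and completes the constant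
  \<open>1 / 2\<close> to the step.\<close>

lemma I_positive_real:
  assumes "y > 0"
  shows "Re (I (of_real (y\<^sup>2))) = Re (G (of_real (y\<^sup>2))) * (pi * Q1 y) - pi / (2 * y)"
proof -
  obtain g where g: "G (of_real (y\<^sup>2)) = of_real g" using Reals_cases[OF G_real[of "y\<^sup>2"]] by blast
  have "((\<lambda>v. Re (J (of_real (y\<^sup>2)) v)) has_integral Re (I (of_real (y\<^sup>2)))) {0..}"
    unfolding I_def by (intro has_integral_Re integrable_integral integrable_J) simp
  moreover have "Re (J (of_real (y\<^sup>2)) v) = g * (k v / (v\<^sup>2 + y\<^sup>2)) - 1 / (v\<^sup>2 + y\<^sup>2)" for v
  proof -
    have p: "y\<^sup>2 + v\<^sup>2 \<noteq> 0" using assms by (simp add: add_pos_nonneg)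
    then have "of_real (y\<^sup>2) + of_real (v\<^sup>2) \<noteq> (0::complex)" by (metis of_real_add of_real_eq_0_iff)
    then have "J (of_real (y\<^sup>2)) v = of_real ((k v * g - 1) / (y\<^sup>2 + v\<^sup>2))"
      by (subst J_eq) (simp_all add: g[unfolded of_real_power])
    then have "Re (J (of_real (y\<^sup>2)) v) = (k v * g - 1) / (y\<^sup>2 + v\<^sup>2)" by (simp only: Re_complex_of_real)
    then show ?thesis by (simp add: diff_divide_distrib mult.commute add.commute)
  qed
  moreover have "((\<lambda>v. g * (k v / (v\<^sup>2 + y\<^sup>2)) - 1 / (v\<^sup>2 + y\<^sup>2)) has_integral (g * (pi * Q1 y) - pi / (2 * y))) {0..}"
  proof (intro has_integral_diff has_integral_mult_right Lorentz_has_integral assms)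
    show "((\<lambda>v. k v / (v\<^sup>2 + y\<^sup>2)) has_integral pi * Q1 y) {0..}"
      using integrable_integral[OF k_Lorentz_integrable[OF assms]] by (simp add: Q1_def)
  qed
  ultimately have "Re (I (of_real (y\<^sup>2))) = g * (pi * Q1 y) - pi / (2 * y)"
    by (simp add: has_integral_unique)
  then show ?thesis using g by simp
qed

text \<open>Since \<open>k a\<close> times the value of \<open>G\<close> at \<open>- (a ^ 2)\<close>
  is 1, multiplying \<open>J\<close> by \<open>- k a\<close> clears \<open>G\<close>; only
  \<open>v = a\<close> is exceptional.\<close>

lemma Q0_has_integral:
  "((\<lambda>v. (k a - k v) / (v\<^sup>2 - a\<^sup>2)) has_integral - (pi * Q0)) {0..}"
proof -
  have "((\<lambda>v. Re (J (of_real (- (a\<^sup>2))) v)) has_integral Re (I (of_real (- (a\<^sup>2))))) {0..}"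
    unfolding I_def by (intro has_integral_Re integrable_integral integrable_J) simp
  then have h1: "((\<lambda>v. (- k a) * Re (J (of_real (- (a\<^sup>2))) v)) has_integral (- k a) * Re (I (of_real (- (a\<^sup>2))))) {0..}"
    by (rule has_integral_mult_right)
  have h2: "(k a - k v) / (v\<^sup>2 - a\<^sup>2) = (- k a) * Re (J (of_real (- (a\<^sup>2))) v)" if "v \<in> {0..} - {a}" for v
  proof -
    have "v\<^sup>2 \<noteq> a\<^sup>2" using that a by auto
    then have nz: "- (a\<^sup>2) + v\<^sup>2 \<noteq> 0" by simp
    then have nz': "of_real (- (a\<^sup>2)) + of_real (v\<^sup>2) \<noteq> (0::complex)" by (metis of_real_add of_real_eq_0_iff)
    obtain g where g: "G (of_real (- (a\<^sup>2))) = of_real g" using Reals_cases[OF G_real[of "- (a\<^sup>2)"]] by blast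
    have "of_real (k a * g) = (1::complex)" using k_G[of a] unfolding g by simp
    then have kg: "k a * g = 1" by (simp only: of_real_eq_1_iff)
    have "J (of_real (- (a\<^sup>2))) v = (of_real (k v) * of_real g - 1) / (of_real (- (a\<^sup>2)) + of_real (v\<^sup>2))"
      using J_eq[OF nz'] unfolding g .
    also have "\<dots> = of_real ((k v * g - 1) / (- (a\<^sup>2) + v\<^sup>2))"
      by (simp only: of_real_divide of_real_add of_real_diff of_real_mult of_real_1)
    finally have "Re (J (of_real (- (a\<^sup>2))) v) = (k v * g - 1) / (- (a\<^sup>2) + v\<^sup>2)" by (simp only: Re_complex_of_real)
    moreover have "k a * (k v * g - 1) = k v - k a" using kg by algebra
    ultimately have "k a * Re (J (of_real (- (a\<^sup>2))) v) = (k v - k a) / (v\<^sup>2 - a\<^sup>2)" by simp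
    then show ?thesis by (simp add: minus_divide_left)
  qed
  have "((\<lambda>v. (k a - k v) / (v\<^sup>2 - a\<^sup>2)) has_integral (- k a) * Re (I (of_real (- (a\<^sup>2))))) {0..}"
    by (rule has_integral_spike_finite[OF finite.insertI[OF finite.emptyI] h2 h1])
  then show ?thesis by (simp add: Q0_def)
qed

lemma Q0_nonpos: "Q0 \<le> 0"
proof -
  have "0 \<le> - (pi * Q0)"
  proof (rule has_integral_nonneg[OF Q0_has_integral])
    fix v :: real assume "v \<in> {0..}"
    then show "0 \<le> (k a - k v) / (v\<^sup>2 - a\<^sup>2)"
      using a k_antimono[of v a] k_antimono[of a v] power_mono[of v a 2] power_mono[of a v 2]
      by (cases "v \<le> a") (auto intro: divide_nonneg_nonneg divide_nonpos_nonpos)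
  qed
  then show ?thesis using pi_gt_zero by (auto simp: mult_le_0_iff)
qed

lemma Q1_nonneg: "Q1 y \<ge> 0"
proof -
  have "0 \<le> integral {0..} (\<lambda>v. k v / (v\<^sup>2 + y\<^sup>2))"
  proof (cases "(\<lambda>v. k v / (v\<^sup>2 + y\<^sup>2)) integrable_on {0..}")
    case True
    then show ?thesis
      by (rule Henstock_Kurzweil_Integration.integral_nonneg) (simp add: k_bound(1))
  qed (simp add: not_integrable_integral)
  then show ?thesis by (simp add: Q1_def)
qed

text \<open>For the slope \<open>X\<close>, adding \<open>y ^ 2\<close> times the first bound of
  \<open>k_convex\<close> to \<open>v ^ 2\<close> times the second gives
  \<open>X * (v ^ 2 + y ^ 2) \<le> c * y ^ 2 + k 0 - k v\<close>, which integrates to the bound for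
  \<open>Q1 y - Q0\<close>. The opposite difference is nonpositive by the signs of \<open>Q0\<close>
  and \<open>Q1\<close>.\<close>

lemma Q_diff_le:
  assumes y: "y > 0"
  shows "\<bar>Q0 - Q1 y\<bar> \<le> ((k 0 - k a) * y / a\<^sup>2 + k 0 / y) / 2"
proof -
  define c where "c = (k 0 - k a) / a\<^sup>2"
  have c: "c \<ge> 0" using k_bound(2)[of a] by (simp add: c_def)
  have k0: "k 0 \<ge> 0" by (rule k_bound(1))
  have y2: "v\<^sup>2 + y\<^sup>2 > 0" for v using y by (simp add: add_nonneg_pos)
  have Q1_hi: "((\<lambda>v. k v / (v\<^sup>2 + y\<^sup>2)) has_integral pi * Q1 y) {0..}"
    using integrable_integral[OF k_Lorentz_integrable[OF y]] by (simp add: Q1_def)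
  define h where "h v = (c * y\<^sup>2 + k 0) * (1 / (v\<^sup>2 + y\<^sup>2)) - k v / (v\<^sup>2 + y\<^sup>2)" for v
  have h_hi: "(h has_integral ((c * y\<^sup>2 + k 0) * (pi / (2 * y)) - pi * Q1 y)) {0..}"
    unfolding h_def [abs_def] by (intro has_integral_diff has_integral_mult_right Lorentz_has_integral y Q1_hi)
  have le: "(k a - k v) / (v\<^sup>2 - a\<^sup>2) \<le> h v" if v: "v > 0" "v \<noteq> a" for v
  proof -
    define X where "X = (k a - k v) / (v\<^sup>2 - a\<^sup>2)"
    have "X \<le> c" "X \<le> (k 0 - k v) / v\<^sup>2" using k_convex[OF v] by (auto simp: X_def c_def)
    then have "X * y\<^sup>2 \<le> c * y\<^sup>2" "X * v\<^sup>2 \<le> k 0 - k v"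
      using v by (auto simp: field_simps intro: mult_right_mono)
    then have "X * (v\<^sup>2 + y\<^sup>2) \<le> c * y\<^sup>2 + k 0 - k v" by (simp add: distrib_left)
    then have "X \<le> (c * y\<^sup>2 + k 0 - k v) / (v\<^sup>2 + y\<^sup>2)" using y2[of v] by (simp add: field_simps)
    then show ?thesis by (simp add: X_def h_def diff_divide_distrib)
  qed
  \<comment> \<open>\<open>k_convex\<close> gives no information at 0 and \<open>a\<close>, so the
    integrand is replaced by \<open>h\<close> there.\<close>
  have "((\<lambda>v. if v \<in> {0, a} then h v else (k a - k v) / (v\<^sup>2 - a\<^sup>2)) has_integral - (pi * Q0)) {0..}"
    by (rule has_integral_spike_finite[OF _ _ Q0_has_integral, of "{0, a}"]) auto
  then have "- (pi * Q0) \<le> (c * y\<^sup>2 + k 0) * (pi / (2 * y)) - pi * Q1 y"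
    by (rule has_integral_le[OF _ h_hi]) (use le in auto)
  then have "pi * (Q1 y - Q0) \<le> pi * ((c * y\<^sup>2 + k 0) / (2 * y))"
  proof -
    have "(c * y\<^sup>2 + k 0) * (pi / (2 * y)) = pi * ((c * y\<^sup>2 + k 0) / (2 * y))" by simp
    with \<open>- (pi * Q0) \<le> _\<close> show ?thesis unfolding right_diff_distrib by linarith
  qed
  then have 1: "Q1 y - Q0 \<le> (c * y\<^sup>2 + k 0) / (2 * y)" by (rule mult_left_le_imp_le) simp
  also have "\<dots> = (c * y + k 0 / y) / 2" using y by (simp add: field_simps power2_eq_square)
  finally have "Q1 y - Q0 \<le> (c * y + k 0 / y) / 2" .
  moreover have "Q0 - Q1 y \<le> (c * y + k 0 / y) / 2"
  proof -
    have "0 \<le> (c * y + k 0 / y) / 2" using c k0 y by simp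
    then show ?thesis using Q0_nonpos Q1_nonneg[of y] by linarith
  qed
  ultimately have "\<bar>Q0 - Q1 y\<bar> \<le> (c * y + k 0 / y) / 2" by (intro abs_leI) auto
  then show ?thesis by (simp add: c_def)
qed

text \<open>The constant \<open>k 0 / 2\<close> gives value 1 at 0; the coefficient of
  \<open>z ^ 2\<close> cancels the real part at \<open>\<i> * a\<close>, and \<open>Q0\<close> the
  imaginary part.\<close>

definition major :: "complex \<Rightarrow> complex" where
  "major z = 1 / 2 + G (z\<^sup>2) * (of_real ((k a + k 0) / (2 * a\<^sup>2)) * z\<^sup>2 + of_real (k 0 / 2) + of_real Q0 * z)
     - z / of_real pi * I (z\<^sup>2)"

definition gap :: "complex \<Rightarrow> complex" where
  "gap z = of_real (k 0 / a\<^sup>2) * (z\<^sup>2 + of_real (a\<^sup>2)) * G (z\<^sup>2)"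

definition minor :: "complex \<Rightarrow> complex" where
  "minor z = major z - gap z"

lemma major_real:
  "major (of_real x) \<in> \<real>"
  unfolding major_def
  using G_real[of "x\<^sup>2"] I_real[of "x\<^sup>2"] by (auto intro!: Reals_divide Reals_diff Reals_mult Reals_add simp flip: of_real_power)

lemma gap_real: "gap (of_real x) = of_real (k 0 / a\<^sup>2 * (x\<^sup>2 + a\<^sup>2) * Re (G (of_real (x\<^sup>2))))"
proof -
  have "G ((of_real x)\<^sup>2) = of_real (Re (G (of_real (x\<^sup>2))))"
    using G_real[of "x\<^sup>2"] by (metis Reals_cases Re_complex_of_real of_real_power)
  then show ?thesis by (simp add: gap_def)
qed

lemma gap_0: "gap 0 = 1"
  using k_G[of 0] a by (simp add: gap_def)

lemma major_0: "major 0 = 1"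
  using k_G[of 0] by (simp add: major_def mult.commute)

lemma Re_major:
  assumes "x \<noteq> 0"
  shows "Re (major (of_real x)) =
    step0 x + Re (G (of_real (x\<^sup>2))) * (((k a + k 0) * x\<^sup>2 / a\<^sup>2 + k 0) / 2 + (Q0 - Q1 \<bar>x\<bar>) * x)"
proof -
  define g where "g = Re (G (of_real (x\<^sup>2)))"
  have g: "G ((of_real x)\<^sup>2) = of_real g"
    using G_real[of "x\<^sup>2"] by (metis Reals_cases Re_complex_of_real of_real_power g_def)
  obtain i where i: "I ((of_real x)\<^sup>2) = of_real i"
    using I_real[of "x\<^sup>2"] by (auto elim: Reals_cases)
  have "i = g * (pi * Q1 \<bar>x\<bar>) - pi / (2 * \<bar>x\<bar>)"
    using I_positive_real[of "\<bar>x\<bar>"] assms i by (simp add: g_def)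
  moreover have "major (of_real x) = of_real (1 / 2 + g * ((k a + k 0) / (2 * a\<^sup>2) * x\<^sup>2 + k 0 / 2 + Q0 * x) - x / pi * i)"
    unfolding major_def g i by simp
  ultimately have "Re (major (of_real x)) = 1 / 2 + g * ((k a + k 0) / (2 * a\<^sup>2) * x\<^sup>2 + k 0 / 2 + Q0 * x) - x / pi * (g * (pi * Q1 \<bar>x\<bar>) - pi / (2 * \<bar>x\<bar>))"
    by (simp only: Re_complex_of_real)
  also have "\<dots> = (1 / 2 + x / (2 * \<bar>x\<bar>)) + g * (((k a + k 0) * x\<^sup>2 / a\<^sup>2 + k 0) / 2 + (Q0 - Q1 \<bar>x\<bar>) * x)"
    using a by (simp add: field_simps)
  also have "1 / 2 + x / (2 * \<bar>x\<bar>) = step0 x" using assms by (auto simp: step0_def abs_if)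
  finally show ?thesis by (simp add: g_def)
qed

text \<open>For \<open>x \<noteq> 0\<close> the excess of \<open>major\<close> over the step is
  \<open>g\<close> times \<open>(U + V + k 0) / 2 + d\<close> with
  \<open>2 * \<bar>d\<bar> \<le> U - V + k 0\<close>. Hence it lies between \<open>g * V\<close> and
  \<open>g * (U + k 0)\<close>, and the latter is exactly the gap.\<close>

lemma major_minor_bounds:
  shows "step0 x \<le> Re (major (of_real x))" "Re (minor (of_real x)) \<le> step0 x"
proof -
  define g where "g = Re (G (of_real (x\<^sup>2)))"
  have g: "g \<ge> 0" unfolding g_def by (intro G_nonneg) simp
  have "step0 x \<le> Re (major (of_real x)) \<and> Re (minor (of_real x)) \<le> step0 x"
  proof (cases "x = 0")
    case True
    then show ?thesis by (simp add: minor_def major_0 gap_0 step0_def)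
  next
    case False
    define y where "y = \<bar>x\<bar>"
    define d where "d = (Q0 - Q1 y) * x"
    have y: "y > 0" "x\<^sup>2 = y\<^sup>2" using False by (auto simp: y_def)
    have "\<bar>d\<bar> \<le> ((k 0 - k a) * y / a\<^sup>2 + k 0 / y) / 2 * y"
      unfolding d_def abs_mult y_def[symmetric] using y by (intro mult_right_mono Q_diff_le) auto
    also have "\<dots> = ((k 0 - k a) * y\<^sup>2 / a\<^sup>2 + k 0) / 2"
      using y by (simp add: field_simps power2_eq_square)
    finally have d: "\<bar>d\<bar> \<le> ((k 0 - k a) * y\<^sup>2 / a\<^sup>2 + k 0) / 2" .
    define U V where "U = k 0 * y\<^sup>2 / a\<^sup>2" and "V = k a * y\<^sup>2 / a\<^sup>2"
    have split: "(k 0 - k a) * y\<^sup>2 / a\<^sup>2 = U - V" "(k a + k 0) * y\<^sup>2 / a\<^sup>2 = U + V"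
      by (simp_all add: U_def V_def algebra_simps add_divide_distrib diff_divide_distrib)
    have "0 \<le> V" using k_bound by (simp add: V_def)
    have d2: "2 * \<bar>d\<bar> \<le> U - V + k 0" using d unfolding split by simp
    have nn: "0 \<le> ((k a + k 0) * y\<^sup>2 / a\<^sup>2 + k 0) / 2 + d"
      unfolding split using d2 \<open>0 \<le> V\<close> by (simp add: field_simps)
    have np: "((k a + k 0) * y\<^sup>2 / a\<^sup>2 + k 0) / 2 + d - k 0 / a\<^sup>2 * (y\<^sup>2 + a\<^sup>2) \<le> 0"
    proof -
      have "k 0 / a\<^sup>2 * (y\<^sup>2 + a\<^sup>2) = U + k 0" using a by (simp add: U_def field_simps)
      then show ?thesis unfolding split using d2 by (simp add: field_simps)
    qed
    have M: "Re (major (of_real x)) = step0 x + g * (((k a + k 0) * y\<^sup>2 / a\<^sup>2 + k 0) / 2 + d)"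
      unfolding Re_major[OF False] by (simp add: g_def d_def y_def)
    have "Re (minor (of_real x)) = step0 x + g * (((k a + k 0) * y\<^sup>2 / a\<^sup>2 + k 0) / 2 + d - k 0 / a\<^sup>2 * (y\<^sup>2 + a\<^sup>2))"
      unfolding minor_def minus_complex.sel M gap_real Re_complex_of_real g_def[symmetric]
      unfolding y(2)
      by (simp add: right_diff_distrib mult_ac)
    then show ?thesis using M nn np g by (simp add: mult_nonneg_nonpos)
  qed
  then show "step0 x \<le> Re (major (of_real x))" "Re (minor (of_real x)) \<le> step0 x" by auto
qed

lemma gap_zero: "gap (\<i> * of_real a) = 0"
  by (simp add: gap_def power_mult_distrib)

lemma major_zero: "major (\<i> * of_real a) = 0"
proof -
  have sq: "(\<i> * of_real a)\<^sup>2 = - ((of_real a)\<^sup>2 :: complex)" by (simp add: power_mult_distrib)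
  have "I (- ((of_real a)\<^sup>2)) \<in> \<real>" using I_real[of "- (a\<^sup>2)"] by simp
  then obtain i where i: "I (- ((of_real a)\<^sup>2)) = of_real i" by (auto elim: Reals_cases)
  have "G (of_real (- (a\<^sup>2))) \<in> \<real>" by (rule G_real)
  then obtain g where g: "G (- ((of_real a)\<^sup>2)) = of_real g" by (auto elim: Reals_cases)
  have "of_real (k a * g) = (1::complex)" using k_G[of a] g by simp
  then have kg: "k a * g = 1" by (simp only: of_real_eq_1_iff)
  have re: "1 / 2 + g * (- ((k a + k 0) / (2 * a\<^sup>2) * a\<^sup>2) + k 0 / 2) = 0"
  proof -
    have "(k a + k 0) / (2 * a\<^sup>2) * a\<^sup>2 = (k a + k 0) / 2" using a by simp
    then have "1 / 2 + g * (- ((k a + k 0) / (2 * a\<^sup>2) * a\<^sup>2) + k 0 / 2) = 1 / 2 - (k a * g) / 2"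
      by (simp add: algebra_simps add_divide_distrib)
    then show ?thesis by (simp add: kg)
  qed
  have im: "g * (Q0 * a) - a / pi * i = 0"
  proof -
    have "g * (Q0 * a) = (k a * g) * (a / pi * i)" by (simp add: Q0_def i)
    then show ?thesis by (simp add: kg)
  qed
  have "major (\<i> * of_real a) = of_real (1 / 2 + g * (- ((k a + k 0) / (2 * a\<^sup>2) * a\<^sup>2) + k 0 / 2))
      + \<i> * of_real (g * (Q0 * a) - a / pi * i)"
  proof -
    define \<alpha> where "\<alpha> = (k a + k 0) / (2 * a\<^sup>2)"
    show ?thesis unfolding major_def sq i g \<alpha>_def[symmetric] by (simp add: algebra_simps)
  qed
  then show ?thesis unfolding re im by simp
qed

lemma norm_G_power2: "norm (G (z\<^sup>2)) \<le> A * exp (2 * pi * norm z)"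
  using growth[of "z\<^sup>2"] by (simp add: norm_power)

lemma gap_exp_type: "gap \<in> exp_type_class (2 * pi)"
proof (rule exp_type_classI_poly)
  show "gap holomorphic_on UNIV"
    unfolding gap_def
    by (intro holomorphic_intros holomorphic_on_compose_gen[OF _ holG, unfolded o_def]) auto
  fix z :: complex
  define n where "n = norm z"
  have n: "n \<ge> 0" by (simp add: n_def)
  have k0: "k 0 \<ge> 0" by (rule k_bound(1))
  have "norm (z\<^sup>2 + of_real (a\<^sup>2)) \<le> n\<^sup>2 + a\<^sup>2"
    using norm_triangle_ineq[of "z\<^sup>2" "of_real (a\<^sup>2)"] by (simp add: n_def norm_power)
  also have "\<dots> \<le> (1 + a\<^sup>2) * (1 + n) ^ 3"
  proof -
    have "n\<^sup>2 \<le> (1 + n) ^ 3" "1 \<le> (1 + n) ^ 3"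
      using n by (auto simp: power3_eq_cube power2_eq_square algebra_simps intro: add_nonneg_nonneg)
    then have "n\<^sup>2 + a\<^sup>2 * 1 \<le> (1 + n) ^ 3 + a\<^sup>2 * (1 + n) ^ 3"
      by (intro add_mono mult_left_mono) auto
    then show ?thesis by (simp add: distrib_right)
  qed
  finally have p: "norm (z\<^sup>2 + of_real (a\<^sup>2)) \<le> (1 + a\<^sup>2) * (1 + n) ^ 3" .
  have "norm (gap z) = k 0 / a\<^sup>2 * norm (z\<^sup>2 + of_real (a\<^sup>2)) * norm (G (z\<^sup>2))"
    unfolding gap_def norm_mult norm_of_real using k0 by simp
  also have "\<dots> \<le> k 0 / a\<^sup>2 * ((1 + a\<^sup>2) * (1 + n) ^ 3) * (A * exp (2 * pi * n))"
    using p k0 norm_G_power2[of z] n unfolding n_def by (intro mult_mono) auto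
  finally show "norm (gap z) \<le> (k 0 / a\<^sup>2 * (1 + a\<^sup>2) * A) * (1 + norm z) ^ 3 * exp (2 * pi * norm z)"
    by (simp add: n_def mult_ac)
qed

lemma major_exp_type: "major \<in> exp_type_class (2 * pi)"
proof (rule exp_type_classI_poly)
  show "major holomorphic_on UNIV"
    unfolding major_def
    by (intro holomorphic_intros holomorphic_on_compose_gen[OF _ holG, unfolded o_def]
        holomorphic_on_compose_gen[OF _ holomorphic_I, unfolded o_def]) auto
  fix z :: complex
  define n where "n = norm z"
  define E where "E = exp (2 * pi * n)"
  define P where "P = (1 + n) ^ 3"
  define c where "c = \<bar>(k a + k 0) / (2 * a\<^sup>2)\<bar> + \<bar>k 0 / 2\<bar> + \<bar>Q0\<bar>"
  have n: "n \<ge> 0" by (simp add: n_def)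
  have k0: "k 0 \<ge> 0" by (rule k_bound(1))
  have E: "E \<ge> 1" using n by (simp add: E_def)
  have "1 * 1 \<le> P * E" using n E by (intro mult_mono) (auto simp: P_def)
  then have one: "1 / 2 \<le> P * E" by simp
  have nP: "n\<^sup>2 \<le> P" "1 \<le> P" "n \<le> P" "n * (2 * n\<^sup>2 + 5) / 2 \<le> 5 * P"
    using n unfolding P_def by (auto simp: power3_eq_cube power2_eq_square algebra_simps intro: add_nonneg_nonneg)
  have 1: "norm (G (z\<^sup>2) * (of_real ((k a + k 0) / (2 * a\<^sup>2)) * z\<^sup>2 + of_real (k 0 / 2) + of_real Q0 * z)) \<le> (A * E) * (c * P)"
    unfolding norm_mult
  proof (intro mult_mono)
    show "norm (G (z\<^sup>2)) \<le> A * E" using norm_G_power2[of z] by (simp add: E_def n_def)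
    have "norm (of_real ((k a + k 0) / (2 * a\<^sup>2)) * z\<^sup>2 + of_real (k 0 / 2) + of_real Q0 * z) \<le>
        norm (of_real ((k a + k 0) / (2 * a\<^sup>2)) * z\<^sup>2) + norm (complex_of_real (k 0 / 2)) + norm (of_real Q0 * z)"
      by (intro order_trans[OF norm_triangle_ineq] add_mono order_refl norm_triangle_ineq)
    also have "\<dots> = \<bar>(k a + k 0) / (2 * a\<^sup>2)\<bar> * n\<^sup>2 + \<bar>k 0 / 2\<bar> * 1 + \<bar>Q0\<bar> * n"
      unfolding norm_mult norm_of_real by (simp add: n_def norm_power)
    also have "\<dots> \<le> \<bar>(k a + k 0) / (2 * a\<^sup>2)\<bar> * P + \<bar>k 0 / 2\<bar> * P + \<bar>Q0\<bar> * P"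
      by (intro add_mono mult_left_mono nP) auto
    finally show "norm (of_real ((k a + k 0) / (2 * a\<^sup>2)) * z\<^sup>2 + of_real (k 0 / 2) + of_real Q0 * z) \<le> c * P"
      by (simp add: c_def distrib_right)
  qed (use pos E in auto)
  have 2: "norm (z / of_real pi * I (z\<^sup>2)) \<le> (k 0 * (A * exp (4 * pi)) + 1) * (5 * P) * E"
  proof -
    \<comment> \<open>The 2 under the root in \<open>J_bound\<close> costs only the constant factor
      \<open>exp (4 * pi)\<close>.\<close>
    have "sqrt (n\<^sup>2 + 2) \<le> n + 2" using n by (intro real_le_lsqrt) (auto simp: power2_eq_square algebra_simps)
    then have "2 * pi * sqrt (n\<^sup>2 + 2) \<le> 2 * pi * (n + 2)" by (intro mult_left_mono) auto
    then have "exp (2 * pi * sqrt (n\<^sup>2 + 2)) \<le> exp (2 * pi * (n + 2))" by simp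
    also have "\<dots> = exp (4 * pi) * E" by (simp add: E_def mult_exp_exp algebra_simps)
    finally have "k 0 * (A * exp (2 * pi * sqrt (n\<^sup>2 + 2))) \<le> k 0 * (A * (exp (4 * pi) * E))"
      using k0 pos by (intro mult_left_mono) auto
    then have "k 0 * (A * exp (2 * pi * sqrt (n\<^sup>2 + 2))) + 1 \<le> (k 0 * (A * exp (4 * pi)) + 1) * E"
      using E by (simp add: algebra_simps)
    then have Jb: "J_bound (n\<^sup>2) \<le> (k 0 * (A * exp (4 * pi)) + 1) * E * (2 * n\<^sup>2 + 5)"
      unfolding J_bound_def by (intro mult_right_mono) auto
    have "norm (z / of_real pi * I (z\<^sup>2)) = n / pi * norm (I (z\<^sup>2))"
      by (simp add: norm_mult norm_divide n_def)
    also have "\<dots> \<le> n / pi * (J_bound (n\<^sup>2) * (pi / 2))"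
      using norm_I_le[of "z\<^sup>2"] n by (intro mult_left_mono) (auto simp: n_def norm_power)
    also have "\<dots> = n / 2 * J_bound (n\<^sup>2)" by simp
    also have "\<dots> \<le> n / 2 * ((k 0 * (A * exp (4 * pi)) + 1) * E * (2 * n\<^sup>2 + 5))"
      using Jb n by (intro mult_left_mono) auto
    also have "\<dots> = ((k 0 * (A * exp (4 * pi)) + 1) * E) * (n * (2 * n\<^sup>2 + 5) / 2)" by simp
    also have "\<dots> \<le> ((k 0 * (A * exp (4 * pi)) + 1) * E) * (5 * P)"
      using nP(4) k0 pos E by (intro mult_left_mono) auto
    finally show ?thesis by (simp add: mult_ac)
  qed
  have "norm (major z) \<le> 1 / 2 + (A * E) * (c * P) + (k 0 * (A * exp (4 * pi)) + 1) * (5 * P) * E"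
    unfolding major_def
    by (intro order_trans[OF norm_triangle_ineq4] order_trans[OF norm_triangle_ineq] add_mono 1 2) simp
  also have "\<dots> \<le> P * E + (A * E) * (c * P) + (k 0 * (A * exp (4 * pi)) + 1) * (5 * P) * E"
    using one by simp
  also have "\<dots> = (1 + A * c + (k 0 * (A * exp (4 * pi)) + 1) * 5) * P * E" by (simp add: algebra_simps)
  finally show "norm (major z) \<le> (1 + A * c + (k 0 * (A * exp (4 * pi)) + 1) * 5) * (1 + norm z) ^ 3 * exp (2 * pi * norm z)"
    by (simp add: P_def E_def n_def)
qed

end

section \<open>The extremal functions\<close>

text \<open>The derivative of \<open>sinh (p * w) / sinh (q * w)\<close> has the sign of
  \<open>p * tanh (q * w) - q * tanh (p * w)\<close>, and \<open>tanh x / x\<close> decreases. The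
  product form admits \<open>x = 0\<close>.\<close>

lemma sinh_ratio_antimono:
  fixes p q x y :: real
  assumes "0 < p" "p < q" "0 \<le> x" "x \<le> y"
  shows "sinh (p * y) * sinh (q * x) \<le> sinh (p * x) * sinh (q * y)"
proof (cases "x = 0")
  case False
  then have x: "x > 0" using assms by simp
  have "sinh (p * y) / sinh (q * y) \<le> sinh (p * x) / sinh (q * x)"
  proof (rule DERIV_nonpos_imp_nonincreasing[OF assms(4)])
    fix w assume "x \<le> w" "w \<le> y"
    then have w: "w > 0" using x by simp
    have s: "sinh (q * w) > 0" "sinh (p * w) > 0" using w assms by auto
    have "tanh (q * w) / (q * w) < tanh (p * w) / (p * w)"
      using tanh_shift_div_strict_antimono[of 2 0 "p * w" "q * w"] w assms by simp
    then have "p * tanh (q * w) \<le> q * tanh (p * w)" using w assms by (simp add: field_simps)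
    then have "(p * tanh (q * w)) * (cosh (p * w) * cosh (q * w)) \<le> (q * tanh (p * w)) * (cosh (p * w) * cosh (q * w))"
      by (intro mult_right_mono) auto
    then have "p * cosh (p * w) * sinh (q * w) \<le> q * sinh (p * w) * cosh (q * w)"
      by (simp add: tanh_def mult_ac)
    then have "(cosh (p * w) * p * sinh (q * w) - sinh (p * w) * (cosh (q * w) * q)) / (sinh (q * w) * sinh (q * w)) \<le> 0"
      by (simp add: divide_nonpos_nonneg mult_ac)
    moreover have "((\<lambda>w. sinh (p * w) / sinh (q * w)) has_real_derivative
       (cosh (p * w) * p * sinh (q * w) - sinh (p * w) * (cosh (q * w) * q)) / (sinh (q * w) * sinh (q * w))) (at w)"
      using s by (auto intro!: derivative_eq_intros)
    ultimately show "\<exists>d. ((\<lambda>w. sinh (p * w) / sinh (q * w)) has_real_derivative d) (at w) \<and> d \<le> 0"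
      by blast
  qed
  moreover have "sinh (q * x) > 0" "sinh (q * y) > 0" using x assms by auto
  ultimately show ?thesis by (simp add: field_simps)
qed simp

lemma sinh_div_mono:
  fixes x y :: real
  assumes "0 < x" "x \<le> y" shows "sinh x / x \<le> sinh y / y"
proof (rule DERIV_nonneg_imp_nondecreasing[OF assms(2)])
  fix w assume "x \<le> w" "w \<le> y"
  then have w: "w > 0" using assms by simp
  have "tanh w * cosh w \<le> w * cosh w" using tanh_less_self[OF w] by (intro mult_right_mono) auto
  then have "(cosh w * w - sinh w * 1) / (w * w) \<ge> 0" by (simp add: tanh_def mult.commute)
  moreover have "((\<lambda>w. sinh w / w) has_real_derivative (cosh w * w - sinh w * 1) / (w * w)) (at w)"
    using w by (auto intro!: derivative_eq_intros)
  ultimately show "\<exists>d. ((\<lambda>w. sinh w / w) has_real_derivative d) (at w) \<and> d \<ge> 0" by blast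
qed

text \<open>Compactness on the unit disc; outside it the square root has modulus at least 1, and the
  bound for the sine suffices.\<close>

lemma norm_sinc_sqrt_le: "\<exists>C>0. \<forall>w. norm (sinc_sqrt w) \<le> C * exp (sqrt (norm w))"
proof -
  have "compact (sinc_sqrt ` cball 0 1)"
    by (intro compact_continuous_image holomorphic_on_imp_continuous_on holomorphic_on_sinc_sqrt) simp
  then obtain B where B: "B > 0" "\<And>w. norm w \<le> 1 \<Longrightarrow> norm (sinc_sqrt w) \<le> B"
    using compact_imp_bounded bounded_pos by (metis image_eqI mem_cball_0)
  have "norm (sinc_sqrt w) \<le> (B + 1) * exp (sqrt (norm w))" for w
  proof (cases "norm w \<le> 1")
    case True
    have "B * 1 \<le> (B + 1) * exp (sqrt (norm w))" using B by (intro mult_mono) auto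
    then show ?thesis using B(2)[OF True] by simp
  next
    case False
    define z where "z = csqrt w"
    have z: "z\<^sup>2 = w" "norm z = sqrt (norm w)" by (simp_all add: z_def)
    have "norm z \<ge> 1" using False unfolding z by simp
    then have "1 * norm (sinc_sqrt w) \<le> norm z * norm (sinc_sqrt w)" by (intro mult_right_mono) auto
    also have "\<dots> = norm (sin z)" using sinc_sqrt_power2[of z] unfolding z(1) by (metis norm_mult)
    also have "\<dots> \<le> exp \<bar>Im z\<bar>" by (rule norm_sin_le)
    also have "\<dots> \<le> 1 * exp (sqrt (norm w))" using abs_Im_le_cmod[of z] by (simp add: z(2))
    also have "\<dots> \<le> (B + 1) * exp (sqrt (norm w))" using B by (intro mult_right_mono) auto
    finally show ?thesis by simp
  qed
  then show ?thesis using B by (intro exI[of _ "B + 1"]) auto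
qed

text \<open>At \<open>z ^ 2\<close> and multiplied by \<open>z\<close> this is the integral of
  \<open>sinh (a * \<tau>) * sin (z * \<tau>)\<close>, so it represents \<open>b\<close>. For
  \<open>a > 0\<close> the density is nonnegative, which makes positivity and monotonicity on the
  negative axis visible.\<close>

definition sine_avg :: "real \<Rightarrow> complex \<Rightarrow> complex" where
  "sine_avg a \<zeta> = integral {0..pi} (\<lambda>\<tau>. of_real (\<tau> * sinh (a * \<tau>)) * sinc_sqrt (of_real (\<tau>\<^sup>2) * \<zeta>))"

lemma continuous_sinc_sqrt_compose:
  assumes "continuous_on A f" shows "continuous_on A (\<lambda>x. sinc_sqrt (f x))"
    and "continuous_on A (\<lambda>x. deriv sinc_sqrt (f x))"
proof -
  have "deriv sinc_sqrt holomorphic_on UNIV"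
    using holomorphic_on_sinc_sqrt by (rule holomorphic_deriv) simp
  then show "continuous_on A (\<lambda>x. sinc_sqrt (f x))" "continuous_on A (\<lambda>x. deriv sinc_sqrt (f x))"
    by (auto intro!: continuous_on_compose2[OF holomorphic_on_imp_continuous_on assms] holomorphic_on_sinc_sqrt)
qed

lemma sine_avg_integrable: "(\<lambda>\<tau>. of_real (\<tau> * sinh (a * \<tau>)) * sinc_sqrt (of_real (\<tau>\<^sup>2) * \<zeta>)) integrable_on {0..pi}"
  by (intro integrable_continuous_real continuous_intros continuous_sinc_sqrt_compose)

lemma holomorphic_sine_avg: "sine_avg a holomorphic_on UNIV"
proof -
  have "(\<lambda>\<zeta>. integral (cbox 0 pi) (\<lambda>\<tau>. of_real (\<tau> * sinh (a * \<tau>)) * sinc_sqrt (of_real (\<tau>\<^sup>2) * \<zeta>))) holomorphic_on UNIV"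
  proof (rule leibniz_rule_holomorphic)
    fix \<zeta> :: complex and \<tau> :: real
    have "((\<lambda>\<zeta>. of_real (\<tau>\<^sup>2) * \<zeta>) has_field_derivative of_real (\<tau>\<^sup>2)) (at \<zeta>)"
      using DERIV_cmult_Id by blast
    from DERIV_chain2[OF holomorphic_derivI[OF holomorphic_on_sinc_sqrt open_UNIV UNIV_I] this]
    show "((\<lambda>\<zeta>. of_real (\<tau> * sinh (a * \<tau>)) * sinc_sqrt (of_real (\<tau>\<^sup>2) * \<zeta>)) has_field_derivative
        of_real (\<tau> * sinh (a * \<tau>)) * (deriv sinc_sqrt (of_real (\<tau>\<^sup>2) * \<zeta>) * of_real (\<tau>\<^sup>2))) (at \<zeta> within UNIV)"
      by (intro DERIV_cmult)
    show "(\<lambda>\<tau>. of_real (\<tau> * sinh (a * \<tau>)) * sinc_sqrt (of_real (\<tau>\<^sup>2) * \<zeta>)) integrable_on cbox 0 pi"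
      using sine_avg_integrable by simp
    show "continuous_on (UNIV \<times> cbox 0 pi) (\<lambda>(\<zeta>, \<tau>). of_real (\<tau> * sinh (a * \<tau>)) * (deriv sinc_sqrt (of_real (\<tau>\<^sup>2) * \<zeta>) * of_real (\<tau>\<^sup>2)))"
      unfolding case_prod_unfold by (intro continuous_intros continuous_sinc_sqrt_compose)
  qed auto
  then show ?thesis by (simp add: sine_avg_def [abs_def])
qed

lemma cnj_sine_avg: "cnj (sine_avg a \<zeta>) = sine_avg a (cnj \<zeta>)"
  by (simp add: sine_avg_def Henstock_Kurzweil_Integration.integral_cnj cnj_sinc_sqrt)

lemma sine_avg_real: "sine_avg a (of_real x) \<in> \<real>"
  by (simp add: Reals_cnj_iff cnj_sine_avg)

lemma norm_sine_avg_le: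
  assumes "a > 0"
  shows "\<exists>C>0. \<forall>\<zeta>. norm (sine_avg a \<zeta>) \<le> C * exp (pi * sqrt (norm \<zeta>))"
proof -
  obtain B where B: "B > 0" "\<And>w. norm (sinc_sqrt w) \<le> B * exp (sqrt (norm w))"
    using norm_sinc_sqrt_le by auto
  have "norm (sine_avg a \<zeta>) \<le> (pi * (pi * sinh (a * pi) * B)) * exp (pi * sqrt (norm \<zeta>))" for \<zeta>
  proof -
    define E where "E = exp (pi * sqrt (norm \<zeta>))"
    have "norm (sine_avg a \<zeta>) \<le> integral {0..pi} (\<lambda>\<tau>::real. pi * sinh (a * pi) * (B * E))"
      unfolding sine_avg_def
    proof (rule integral_norm_bound_integral[OF sine_avg_integrable])
      fix \<tau> :: real assume \<tau>: "\<tau> \<in> {0..pi}"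
      have "norm (sinc_sqrt (of_real (\<tau>\<^sup>2) * \<zeta>)) \<le> B * exp (sqrt (norm (of_real (\<tau>\<^sup>2) * \<zeta>)))" by (rule B)
      also have "sqrt (norm (of_real (\<tau>\<^sup>2) * \<zeta>)) = \<tau> * sqrt (norm \<zeta>)"
        using \<tau> by (simp add: norm_mult norm_power real_sqrt_mult)
      also have "B * exp (\<tau> * sqrt (norm \<zeta>)) \<le> B * E"
        using \<tau> B unfolding E_def by (intro mult_left_mono) (auto intro: mult_right_mono)
      finally have 1: "norm (sinc_sqrt (of_real (\<tau>\<^sup>2) * \<zeta>)) \<le> B * E" .
      have "norm (complex_of_real (\<tau> * sinh (a * \<tau>))) = \<tau> * sinh (a * \<tau>)"
        using \<tau> assms unfolding norm_of_real by simp
      also have "\<dots> \<le> pi * sinh (a * pi)" using \<tau> assms by (intro mult_mono) auto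
      finally show "norm (of_real (\<tau> * sinh (a * \<tau>)) * sinc_sqrt (of_real (\<tau>\<^sup>2) * \<zeta>)) \<le> pi * sinh (a * pi) * (B * E)"
        unfolding norm_mult[of "of_real (\<tau> * sinh (a * \<tau>))"] using 1 assms by (intro mult_mono) auto
    qed auto
    then show ?thesis by (simp add: E_def mult_ac)
  qed
  then show ?thesis using assms B by (intro exI[of _ "pi * (pi * sinh (a * pi) * B)"]) auto
qed

definition rho :: "real \<Rightarrow> real \<Rightarrow> real" where
  "rho a v = Re (sine_avg a (of_real (- (v\<^sup>2))))"

lemma sine_avg_minus_square: "sine_avg a (of_real (- (v\<^sup>2))) = of_real (rho a v)"
  using sine_avg_real[of a "- (v\<^sup>2)"] unfolding rho_def by (metis Reals_cases Re_complex_of_real)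

lemma rho_has_integral:
  assumes "v \<noteq> 0"
  shows "((\<lambda>\<tau>. sinh (a * \<tau>) * sinh (v * \<tau>)) has_integral v * rho a v) {0..pi}"
proof -
  have "((\<lambda>\<tau>. of_real (\<tau> * sinh (a * \<tau>)) * sinc_sqrt (of_real (\<tau>\<^sup>2) * of_real (- (v\<^sup>2)))) has_integral of_real (rho a v)) {0..pi}"
    unfolding sine_avg_minus_square[symmetric] sine_avg_def by (rule integrable_integral[OF sine_avg_integrable])
  then have "((\<lambda>\<tau>. v * Re (of_real (\<tau> * sinh (a * \<tau>)) * sinc_sqrt (of_real (\<tau>\<^sup>2) * of_real (- (v\<^sup>2))))) has_integral v * Re (of_real (rho a v))) {0..pi}"
    by (intro has_integral_mult_right has_integral_Re)
  moreover have "v * Re (of_real (\<tau> * sinh (a * \<tau>)) * sinc_sqrt (of_real (\<tau>\<^sup>2) * of_real (- (v\<^sup>2)))) = sinh (a * \<tau>) * sinh (v * \<tau>)" for \<tau>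
  proof -
    define S where "S = sinc_sqrt (of_real (\<tau>\<^sup>2) * of_real (- (v\<^sup>2)))"
    have "(\<i> * of_real (v * \<tau>)) * sinc_sqrt ((\<i> * of_real (v * \<tau>))\<^sup>2) = sin (\<i> * of_real (v * \<tau>))"
      by (rule sinc_sqrt_power2)
    also have "(\<i> * of_real (v * \<tau>))\<^sup>2 = of_real (\<tau>\<^sup>2) * of_real (- (v\<^sup>2))"
      by (simp add: power_mult_distrib)
    also have "sin (\<i> * of_real (v * \<tau>)) = \<i> * of_real (sinh (v * \<tau>))"
      unfolding sin_i_times sinh_def by (simp add: scaleR_conv_of_real exp_of_real[symmetric] exp_minus)
    finally have "of_real (v * \<tau>) * S = of_real (sinh (v * \<tau>))" unfolding S_def[symmetric] by (simp add: mult.assoc)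
    then have "v * \<tau> * Re S = sinh (v * \<tau>)" by (auto dest: arg_cong[of _ _ Re])
    then show ?thesis unfolding S_def[symmetric] by (simp add: mult_ac)
  qed
  ultimately show ?thesis by (simp only: Re_complex_of_real)
qed

lemma rho_0_has_integral: "((\<lambda>\<tau>. \<tau> * sinh (a * \<tau>)) has_integral rho a 0) {0..pi}"
proof -
  have "((\<lambda>\<tau>. of_real (\<tau> * sinh (a * \<tau>)) * sinc_sqrt (of_real (\<tau>\<^sup>2) * of_real (- (0\<^sup>2)))) has_integral of_real (rho a 0)) {0..pi}"
    unfolding sine_avg_minus_square[symmetric] sine_avg_def by (rule integrable_integral[OF sine_avg_integrable])
  from has_integral_Re[OF this] show ?thesis by simp
qed

lemma rho_0:
  assumes "a > 0" shows "rho a 0 = (a * pi * cosh (a * pi) - sinh (a * pi)) / a\<^sup>2"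
proof -
  have "((\<lambda>\<tau>. \<tau> * sinh (a * \<tau>)) has_integral
      (pi * cosh (a * pi) / a - sinh (a * pi) / a\<^sup>2) - (0 * cosh (a * 0) / a - sinh (a * 0) / a\<^sup>2)) {0..pi}"
  proof (rule fundamental_theorem_of_calculus)
    fix x :: real
    show "((\<lambda>\<tau>. \<tau> * cosh (a * \<tau>) / a - sinh (a * \<tau>) / a\<^sup>2) has_vector_derivative x * sinh (a * x)) (at x within {0..pi})"
      unfolding has_real_derivative_iff_has_vector_derivative[symmetric] using assms
      by (auto intro!: derivative_eq_intros simp: field_simps power2_eq_square)
  qed simp
  from has_integral_unique[OF rho_0_has_integral this] show ?thesis
    using assms by (simp add: field_simps power2_eq_square)
qed

lemma rho_0_pos: "a > 0 \<Longrightarrow> rho a 0 > 0"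
proof -
  assume a: "a > 0"
  have "tanh (a * pi) * cosh (a * pi) < a * pi * cosh (a * pi)"
    using tanh_less_self[of "a * pi"] a by (intro mult_strict_right_mono) auto
  then show ?thesis using a by (simp add: rho_0 tanh_def)
qed

text \<open>The quotient \<open>sinh (v * \<tau>) / v\<close> in the integrand increases with
  \<open>v\<close>; at \<open>v = 0\<close> its limit \<open>\<tau>\<close> takes its place.\<close>

lemma rho_mono:
  assumes a: "a > 0" and vw: "0 \<le> v" "v \<le> w"
  shows "rho a v \<le> rho a w"
proof (cases "v = w \<or> w = 0")
  case False
  then have w: "w > 0" "v < w" using vw by auto
  have hw: "((\<lambda>\<tau>. sinh (a * \<tau>) * sinh (w * \<tau>) / w) has_integral rho a w) {0..pi}"
    using has_integral_divide[OF rho_has_integral[of w a], of w] w by simp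
  show ?thesis
  proof (cases "v = 0")
    case True
    show ?thesis unfolding True
    proof (rule has_integral_le[OF rho_0_has_integral hw])
      fix \<tau> :: real assume "\<tau> \<in> {0..pi}"
      then have \<tau>: "\<tau> \<ge> 0" by simp
      have "w * \<tau> \<le> sinh (w * \<tau>)" using w \<tau> sinh_gt_self[of "w * \<tau>"] by (cases "\<tau> = 0") auto
      then have "\<tau> \<le> sinh (w * \<tau>) / w" using w by (simp add: field_simps)
      then have "sinh (a * \<tau>) * \<tau> \<le> sinh (a * \<tau>) * (sinh (w * \<tau>) / w)"
        using a \<tau> by (intro mult_left_mono) auto
      then show "\<tau> * sinh (a * \<tau>) \<le> sinh (a * \<tau>) * sinh (w * \<tau>) / w" by (simp add: mult.commute)
    qed
  next
    case False
    then have v: "v > 0" using vw by simp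
    have hv: "((\<lambda>\<tau>. sinh (a * \<tau>) * sinh (v * \<tau>) / v) has_integral rho a v) {0..pi}"
      using has_integral_divide[OF rho_has_integral[of v a], of v] v by simp
    show ?thesis
    proof (rule has_integral_le[OF hv hw])
      fix \<tau> :: real assume "\<tau> \<in> {0..pi}"
      then have \<tau>: "\<tau> \<ge> 0" by simp
      have "sinh (v * \<tau>) / v \<le> sinh (w * \<tau>) / w"
      proof (cases "\<tau> = 0")
        case False
        then have "\<tau> * (sinh (v * \<tau>) / (v * \<tau>)) \<le> \<tau> * (sinh (w * \<tau>) / (w * \<tau>))"
          using v w \<tau> by (intro mult_left_mono sinh_div_mono) auto
        then show ?thesis using False by simp
      qed simp
      then have "sinh (a * \<tau>) * (sinh (v * \<tau>) / v) \<le> sinh (a * \<tau>) * (sinh (w * \<tau>) / w)"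
        using a \<tau> by (intro mult_left_mono) auto
      then show "sinh (a * \<tau>) * sinh (v * \<tau>) / v \<le> sinh (a * \<tau>) * sinh (w * \<tau>) / w" by simp
    qed
  qed
qed (use vw in auto)

lemma rho_abs: "rho a \<bar>v\<bar> = rho a v"
  by (simp add: rho_def)

lemma rho_ge: "a > 0 \<Longrightarrow> rho a 0 \<le> rho a v"
  using rho_mono[of a 0 "\<bar>v\<bar>"] by (simp add: rho_abs)

lemma rho_pos: "a > 0 \<Longrightarrow> rho a v > 0"
  using rho_0_pos[of a] rho_ge[of a v] by linarith

text \<open>Integrating by parts twice writes \<open>(rho a v - rho a 0) / v\<close> as an integral of \<open>sinh (v * \<tau>)\<close>
  against a decreasing weight, while \<open>v * rho a v\<close> has the increasing weight \<open>sinh (a * \<tau>)\<close>.\<close>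

definition weight :: "real \<Rightarrow> real \<Rightarrow> real" where
  "weight a \<tau> = (sinh (a * \<tau>) - sinh (a * pi) + a * cosh (a * pi) * (pi - \<tau>)) / a\<^sup>2"

lemma weight_has_integral:
  assumes a: "a > 0" and v: "v > 0"
  shows "((\<lambda>\<tau>. weight a \<tau> * sinh (v * \<tau>)) has_integral (rho a v - rho a 0) / v) {0..pi}"
proof -
  \<comment> \<open>The weight and its derivative vanish at \<open>pi\<close>, and the weight equals
    \<open>rho a 0\<close> at 0, so the only boundary term is \<open>rho a 0 / v\<close>.\<close>
  define P where "P \<tau> = weight a \<tau> * cosh (v * \<tau>) / v - (cosh (a * \<tau>) - cosh (a * pi)) / a * sinh (v * \<tau>) / v\<^sup>2" for \<tau>
  have "((\<lambda>\<tau>. weight a \<tau> * sinh (v * \<tau>) - sinh (a * \<tau>) * sinh (v * \<tau>) / v\<^sup>2) has_integral P pi - P 0) {0..pi}"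
  proof (rule fundamental_theorem_of_calculus)
    fix x :: real
    have w': "(weight a has_real_derivative (cosh (a * x) - cosh (a * pi)) / a) (at x within {0..pi})"
      unfolding weight_def [abs_def] using a
      by (auto intro!: derivative_eq_intros simp: field_simps power2_eq_square)
    show "(P has_vector_derivative weight a x * sinh (v * x) - sinh (a * x) * sinh (v * x) / v\<^sup>2) (at x within {0..pi})"
      unfolding has_real_derivative_iff_has_vector_derivative[symmetric] P_def [abs_def] using a v
      by (auto intro!: derivative_eq_intros w' simp: field_simps power2_eq_square)
  qed simp
  moreover have "((\<lambda>\<tau>. sinh (a * \<tau>) * sinh (v * \<tau>) / v\<^sup>2) has_integral v * rho a v / v\<^sup>2) {0..pi}"
    using v by (intro has_integral_divide rho_has_integral) simp
  ultimately have "((\<lambda>\<tau>. (weight a \<tau> * sinh (v * \<tau>) - sinh (a * \<tau>) * sinh (v * \<tau>) / v\<^sup>2) + sinh (a * \<tau>) * sinh (v * \<tau>) / v\<^sup>2)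
      has_integral (P pi - P 0) + v * rho a v / v\<^sup>2) {0..pi}"
    by (rule has_integral_add)
  moreover have "P pi = 0" "P 0 = rho a 0 / v"
    using a by (simp_all add: P_def weight_def rho_0 algebra_simps)
  ultimately show ?thesis using v by (simp add: power2_eq_square diff_divide_distrib)
qed

lemma weight_antimono:
  assumes a: "a > 0" and xy: "0 \<le> x" "x \<le> y" "y \<le> pi"
  shows "weight a y \<le> weight a x"
proof (rule DERIV_nonpos_imp_nonincreasing[OF xy(2)])
  fix w assume w: "x \<le> w" "w \<le> y"
  have "cosh (a * w) \<le> cosh (a * pi)"
    using w xy a by (subst cosh_real_nonneg_le_iff) auto
  then have "(cosh (a * w) - cosh (a * pi)) / a \<le> 0" using a by (simp add: divide_nonpos_pos)
  moreover have "(weight a has_real_derivative (cosh (a * w) - cosh (a * pi)) / a) (at w)"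
    unfolding weight_def [abs_def] using a
    by (auto intro!: derivative_eq_intros simp: field_simps power2_eq_square)
  ultimately show "\<exists>d. (weight a has_real_derivative d) (at w) \<and> d \<le> 0" by blast
qed

text \<open>Chebyshev's integral inequality: the weight changes sign once relative to \<open>L * sinh (a * \<tau>)\<close>,
  and \<open>sinh (p * \<tau>) / sinh (q * \<tau>)\<close> is decreasing.\<close>

lemma rho_quotient_antimono:
  assumes a: "a > 0" and pq: "0 < p" "p < q"
  shows "(rho a q - rho a 0) / q\<^sup>2 * rho a p \<le> (rho a p - rho a 0) / p\<^sup>2 * rho a q"
proof -
  have q: "q > 0" using pq by simp
  \<comment> \<open>This \<open>L\<close> makes the integral of
    \<open>D \<tau> * sinh (q * \<tau>)\<close> vanish; the claim becomes nonnegativity of the same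
    integral with \<open>p\<close>.\<close>
  define L where "L = ((rho a q - rho a 0) / q) / (q * rho a q)"
  have L: "L \<ge> 0" using rho_pos[OF a, of q] rho_ge[OF a, of q] q by (simp add: L_def)
  define D where "D \<tau> = weight a \<tau> - L * sinh (a * \<tau>)" for \<tau>
  have D_int: "((\<lambda>\<tau>. D \<tau> * sinh (v * \<tau>)) has_integral (rho a v - rho a 0) / v - L * (v * rho a v)) {0..pi}"
    if "v > 0" for v
  proof -
    have "((\<lambda>\<tau>. weight a \<tau> * sinh (v * \<tau>) - L * (sinh (a * \<tau>) * sinh (v * \<tau>))) has_integral (rho a v - rho a 0) / v - L * (v * rho a v)) {0..pi}"
      using that a by (intro has_integral_diff has_integral_mult_right rho_has_integral weight_has_integral) auto
    then show ?thesis by (simp add: D_def left_diff_distrib mult.assoc)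
  qed
  have Dq: "(rho a q - rho a 0) / q - L * (q * rho a q) = 0"
    using q rho_pos[OF a, of q] by (simp add: L_def)
  have D_anti: "D y \<le> D x" if "0 \<le> x" "x \<le> y" "y \<le> pi" for x y
  proof -
    have "L * sinh (a * x) \<le> L * sinh (a * y)" using L a that by (intro mult_left_mono) auto
    then show ?thesis using weight_antimono[OF a that] by (simp add: D_def)
  qed
  have "continuous_on {0..pi} D"
    unfolding D_def weight_def using a by (intro continuous_intros) auto
  moreover have "D pi \<le> 0" using L a by (simp add: D_def weight_def)
  moreover have "0 \<le> D 0" using rho_0_pos[OF a] a by (simp add: D_def weight_def rho_0 algebra_simps)
  ultimately obtain \<tau>0 where \<tau>0: "0 \<le> \<tau>0" "\<tau>0 \<le> pi" "D \<tau>0 = 0"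
    using IVT2'[of D pi 0 0] by auto
  have "\<tau>0 \<noteq> 0"
  proof
    assume "\<tau>0 = 0"
    moreover have "D 0 = rho a 0" using a by (simp add: D_def weight_def rho_0 algebra_simps)
    ultimately show False using \<tau>0 rho_0_pos[OF a] by simp
  qed
  then have s0: "sinh (q * \<tau>0) > 0" using \<tau>0 q by simp
  \<comment> \<open>With this \<open>c\<close> the difference
    \<open>sinh (p * \<tau>) - c * sinh (q * \<tau>)\<close> changes sign at \<open>\<tau>0\<close>,
    just as \<open>D\<close> does, so the product is nonnegative. The subtracted integral is
    0.\<close>
  define c where "c = sinh (p * \<tau>0) / sinh (q * \<tau>0)"
  have "((\<lambda>\<tau>. D \<tau> * sinh (p * \<tau>) - c * (D \<tau> * sinh (q * \<tau>))) has_integral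
      ((rho a p - rho a 0) / p - L * (p * rho a p)) - c * ((rho a q - rho a 0) / q - L * (q * rho a q))) {0..pi}"
    by (intro has_integral_diff has_integral_mult_right D_int pq q)
  then have "0 \<le> ((rho a p - rho a 0) / p - L * (p * rho a p)) - c * ((rho a q - rho a 0) / q - L * (q * rho a q))"
  proof (rule has_integral_nonneg)
    fix \<tau> :: real assume "\<tau> \<in> {0..pi}"
    then have \<tau>: "0 \<le> \<tau>" "\<tau> \<le> pi" by auto
    have "0 \<le> D \<tau> * (sinh (p * \<tau>) - c * sinh (q * \<tau>))"
    proof (cases "\<tau> \<le> \<tau>0")
      case True
      have "sinh (p * \<tau>0) * sinh (q * \<tau>) \<le> sinh (p * \<tau>) * sinh (q * \<tau>0)"
        using pq \<tau> True by (intro sinh_ratio_antimono)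
      then have "c * sinh (q * \<tau>) \<le> sinh (p * \<tau>)" using s0 by (simp add: c_def field_simps)
      then show ?thesis using D_anti[OF \<tau>(1) True \<tau>0(2)] \<tau>0(3) by simp
    next
      case False
      then have "sinh (p * \<tau>) * sinh (q * \<tau>0) \<le> sinh (p * \<tau>0) * sinh (q * \<tau>)"
        using pq \<tau>0 by (intro sinh_ratio_antimono) auto
      then have "sinh (p * \<tau>) \<le> c * sinh (q * \<tau>)" using s0 by (simp add: c_def field_simps)
      then show ?thesis using D_anti[OF \<tau>0(1) _ \<tau>(2)] False \<tau>0(3) by (intro mult_nonpos_nonpos) auto
    qed
    then show "0 \<le> D \<tau> * sinh (p * \<tau>) - c * (D \<tau> * sinh (q * \<tau>))" by (simp add: algebra_simps)
  qed
  then have "L * (p * rho a p) \<le> (rho a p - rho a 0) / p" unfolding Dq by simp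
  then have "L * (p * rho a p) * (rho a q / p) \<le> (rho a p - rho a 0) / p * (rho a q / p)"
    using rho_pos[OF a, of q] pq by (intro mult_right_mono) auto
  also have "L * (p * rho a p) * (rho a q / p) = (rho a q - rho a 0) / q\<^sup>2 * rho a p"
    using rho_pos[OF a, of q] pq by (simp add: L_def power2_eq_square)
  finally show ?thesis by (simp add: power2_eq_square)
qed

definition k_ext :: "real \<Rightarrow> real \<Rightarrow> real" where
  "k_ext a v = 1 / (rho a v)\<^sup>2"

text \<open>As a function of \<open>v ^ 2\<close>, the reciprocal of \<open>rho\<close> at
  \<open>p ^ 2\<close> lies below its chord over \<open>[0, q ^ 2]\<close>: this is
  \<open>rho_quotient_antimono\<close> after division. Squaring positive values preserves the
  property.\<close>

lemma k_ext_slope_antimono: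
  assumes a: "a > 0" and pq: "0 < p" "p < q"
  shows "(k_ext a 0 - k_ext a q) / q\<^sup>2 \<le> (k_ext a 0 - k_ext a p) / p\<^sup>2"
proof -
  have q: "q > 0" using pq by simp
  define x y z where "x = 1 / rho a 0" and "y = 1 / rho a p" and "z = 1 / rho a q"
  have pos: "rho a 0 > 0" "rho a p > 0" "rho a q > 0" using rho_pos[OF a] by auto
  have xyz: "x > 0" "y > 0" "z > 0" using pos by (auto simp: x_def y_def z_def)
  define l where "l = p\<^sup>2 / q\<^sup>2"
  have l: "0 \<le> l" "l \<le> 1" using pq by (auto simp: l_def power_mono)
  have "y \<le> (1 - l) * x + l * z"
  proof -
    have "p\<^sup>2 / (rho a 0 * rho a p * rho a q) * ((rho a q - rho a 0) / q\<^sup>2 * rho a p) \<le>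
        p\<^sup>2 / (rho a 0 * rho a p * rho a q) * ((rho a p - rho a 0) / p\<^sup>2 * rho a q)"
      using pos by (intro mult_left_mono rho_quotient_antimono a pq) auto
    moreover have "p\<^sup>2 / (rho a 0 * rho a p * rho a q) * ((rho a q - rho a 0) / q\<^sup>2 * rho a p) = l * (x - z)"
      using pos q by (simp add: l_def x_def z_def field_simps)
    moreover have "p\<^sup>2 / (rho a 0 * rho a p * rho a q) * ((rho a p - rho a 0) / p\<^sup>2 * rho a q) = x - y"
      using pos pq by (simp add: x_def y_def field_simps)
    ultimately show ?thesis by (simp add: algebra_simps)
  qed
  then have "y\<^sup>2 \<le> ((1 - l) * x + l * z)\<^sup>2" using xyz by (intro power_mono) auto
  also have "\<dots> = (1 - l) * x\<^sup>2 + l * z\<^sup>2 - l * (1 - l) * (x - z)\<^sup>2"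
    by (simp add: power2_eq_square algebra_simps)
  also have "\<dots> \<le> (1 - l) * x\<^sup>2 + l * z\<^sup>2" using l by simp
  finally have "l * (x\<^sup>2 - z\<^sup>2) \<le> x\<^sup>2 - y\<^sup>2" by (simp add: algebra_simps)
  then have "l * (x\<^sup>2 - z\<^sup>2) / p\<^sup>2 \<le> (x\<^sup>2 - y\<^sup>2) / p\<^sup>2" by (intro divide_right_mono) auto
  moreover have "l * (x\<^sup>2 - z\<^sup>2) / p\<^sup>2 = (x\<^sup>2 - z\<^sup>2) / q\<^sup>2" using pq by (simp add: l_def)
  ultimately show ?thesis by (simp add: k_ext_def x_def y_def z_def power_divide)
qed

text \<open>The slope between \<open>a ^ 2\<close> and \<open>v ^ 2\<close> is an affine combination
  of the slopes \<open>\<alpha>\<close> and \<open>\<beta>\<close> from 0, with weights of opposite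
  sign, and so falls below the smaller of the two.\<close>

lemma k_ext_convex:
  assumes a: "a > 0" and v: "v > 0" "v \<noteq> a"
  shows "(k_ext a a - k_ext a v) / (v\<^sup>2 - a\<^sup>2) \<le> (k_ext a 0 - k_ext a a) / a\<^sup>2"
    and "(k_ext a a - k_ext a v) / (v\<^sup>2 - a\<^sup>2) \<le> (k_ext a 0 - k_ext a v) / v\<^sup>2"
proof -
  define \<alpha> \<beta> where "\<alpha> = (k_ext a 0 - k_ext a a) / a\<^sup>2" and "\<beta> = (k_ext a 0 - k_ext a v) / v\<^sup>2"
  have diff: "k_ext a a - k_ext a v = v\<^sup>2 * \<beta> - a\<^sup>2 * \<alpha>" using a v by (simp add: \<alpha>_def \<beta>_def)
  have "(v\<^sup>2 * \<beta> - a\<^sup>2 * \<alpha>) / (v\<^sup>2 - a\<^sup>2) \<le> \<alpha> \<and> (v\<^sup>2 * \<beta> - a\<^sup>2 * \<alpha>) / (v\<^sup>2 - a\<^sup>2) \<le> \<beta>"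
  proof (cases "v < a")
    case True
    then have le: "\<alpha> \<le> \<beta>" unfolding \<alpha>_def \<beta>_def by (intro k_ext_slope_antimono a v)
    have neg: "v\<^sup>2 - a\<^sup>2 < 0" using True v by (simp add: power_strict_mono)
    have "v\<^sup>2 * \<alpha> \<le> v\<^sup>2 * \<beta>" "a\<^sup>2 * \<alpha> \<le> a\<^sup>2 * \<beta>" using le by (auto intro: mult_left_mono)
    then show ?thesis using neg by (simp add: divide_le_eq algebra_simps)
  next
    case False
    then have le: "\<beta> \<le> \<alpha>" unfolding \<alpha>_def \<beta>_def using v by (intro k_ext_slope_antimono a) auto
    have pos: "v\<^sup>2 - a\<^sup>2 > 0" using False v a by (simp add: power_strict_mono)
    have "v\<^sup>2 * \<beta> \<le> v\<^sup>2 * \<alpha>" "a\<^sup>2 * \<beta> \<le> a\<^sup>2 * \<alpha>" using le by (auto intro: mult_left_mono)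
    then show ?thesis using pos by (simp add: divide_le_eq algebra_simps)
  qed
  then show "(k_ext a a - k_ext a v) / (v\<^sup>2 - a\<^sup>2) \<le> (k_ext a 0 - k_ext a a) / a\<^sup>2"
    "(k_ext a a - k_ext a v) / (v\<^sup>2 - a\<^sup>2) \<le> (k_ext a 0 - k_ext a v) / v\<^sup>2"
    unfolding diff by (auto simp: \<alpha>_def \<beta>_def)
qed

lemma extremal_interpolation_sine_avg:
  assumes a: "a > 0"
  shows "\<exists>A. extremal_interpolation (\<lambda>\<zeta>. (sine_avg a \<zeta>)\<^sup>2) (k_ext a) A a"
proof -
  obtain C where C: "C > 0" "\<And>\<zeta>. norm (sine_avg a \<zeta>) \<le> C * exp (pi * sqrt (norm \<zeta>))"
    using norm_sine_avg_le[OF a] by auto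
  have cont: "continuous_on UNIV (rho a)"
    unfolding rho_def
    by (intro continuous_intros continuous_on_compose2[OF holomorphic_on_imp_continuous_on[OF holomorphic_sine_avg]]) auto
  have "extremal_interpolation (\<lambda>\<zeta>. (sine_avg a \<zeta>)\<^sup>2) (k_ext a) (C\<^sup>2) a"
  proof
    show "(\<lambda>\<zeta>. (sine_avg a \<zeta>)\<^sup>2) holomorphic_on UNIV"
      by (intro holomorphic_intros holomorphic_sine_avg)
    show "norm ((sine_avg a \<zeta>)\<^sup>2) \<le> C\<^sup>2 * exp (2 * pi * sqrt (norm \<zeta>))" for \<zeta>
    proof -
      have "(norm (sine_avg a \<zeta>))\<^sup>2 \<le> (C * exp (pi * sqrt (norm \<zeta>)))\<^sup>2" by (intro power_mono C) auto
      also have "\<dots> = C\<^sup>2 * exp (2 * pi * sqrt (norm \<zeta>))"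
        by (simp add: power_mult_distrib exp_double[symmetric] mult.assoc)
      finally show ?thesis by (simp add: norm_power)
    qed
    show "continuous_on UNIV (k_ext a)"
      unfolding k_ext_def using rho_pos[OF a] by (intro continuous_intros cont) (auto simp: less_imp_neq[symmetric])
    show "0 \<le> k_ext a v" for v by (simp add: k_ext_def)
    have anti: "k_ext a w \<le> k_ext a v" if "0 \<le> v" "v \<le> w" for v w
      unfolding k_ext_def using rho_mono[OF a that] rho_pos[OF a, of v]
      by (intro divide_left_mono power_mono) (auto intro!: mult_pos_pos)
    then show "\<And>v w. 0 \<le> v \<Longrightarrow> v \<le> w \<Longrightarrow> k_ext a w \<le> k_ext a v" .
    show "k_ext a v \<le> k_ext a 0" for v
      using anti[of 0 "\<bar>v\<bar>"] by (simp add: k_ext_def rho_abs)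
    show "of_real (k_ext a v) * (sine_avg a (of_real (- v\<^sup>2)))\<^sup>2 = 1" for v
    proof -
      have "k_ext a v * (rho a v)\<^sup>2 = 1" using rho_pos[OF a, of v] by (simp add: k_ext_def)
      then show ?thesis unfolding sine_avg_minus_square by (simp flip: of_real_power of_real_mult)
    qed
    show "(sine_avg a (of_real x))\<^sup>2 \<in> \<real>" for x by (intro Reals_power sine_avg_real)
    show "0 \<le> Re ((sine_avg a (of_real x))\<^sup>2)" for x
      using sine_avg_real[of a x] by (auto elim!: Reals_cases simp flip: of_real_power)
  qed (use a C k_ext_convex in auto)
  then show ?thesis by blast
qed

section \<open>The integral of the extremal gap\<close>

lemma sine_avg_square:
  assumes a: "a > 0" and x: "x \<noteq> 0"
  shows "sine_avg a (of_real (x\<^sup>2)) =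
    of_real (cosh (a * pi) * (a * sin (pi * x) - tanh (a * pi) * x * cos (pi * x)) / (x * (x\<^sup>2 + a\<^sup>2)))"
proof -
  define y where "y = Re (sine_avg a (of_real (x\<^sup>2)))"
  have H: "sine_avg a (of_real (x\<^sup>2)) = of_real y"
    using sine_avg_real[of a "x\<^sup>2"] unfolding y_def by (metis Reals_cases Re_complex_of_real)
  have "((\<lambda>\<tau>. of_real (\<tau> * sinh (a * \<tau>)) * sinc_sqrt (of_real (\<tau>\<^sup>2) * of_real (x\<^sup>2))) has_integral of_real y) {0..pi}"
    unfolding H[symmetric] sine_avg_def by (rule integrable_integral[OF sine_avg_integrable])
  then have "((\<lambda>\<tau>. x * Re (of_real (\<tau> * sinh (a * \<tau>)) * sinc_sqrt (of_real (\<tau>\<^sup>2) * of_real (x\<^sup>2)))) has_integral x * Re (of_real y)) {0..pi}"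
    by (intro has_integral_mult_right has_integral_Re)
  moreover have "x * Re (of_real (\<tau> * sinh (a * \<tau>)) * sinc_sqrt (of_real (\<tau>\<^sup>2) * of_real (x\<^sup>2))) = sinh (a * \<tau>) * sin (x * \<tau>)" for \<tau>
  proof -
    define S where "S = sinc_sqrt (of_real (\<tau>\<^sup>2) * of_real (x\<^sup>2))"
    have "of_real (x * \<tau>) * sinc_sqrt ((of_real (x * \<tau>))\<^sup>2) = sin (of_real (x * \<tau>))"
      by (rule sinc_sqrt_power2)
    also have "(of_real (x * \<tau>))\<^sup>2 = (of_real (\<tau>\<^sup>2) * of_real (x\<^sup>2) :: complex)"
      by (simp add: power_mult_distrib)
    finally have "of_real (x * \<tau>) * S = of_real (sin (x * \<tau>))"
      unfolding S_def[symmetric] by (simp only: sin_of_real)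
    then have "x * \<tau> * Re S = sin (x * \<tau>)" by (auto dest: arg_cong[of _ _ Re])
    then show ?thesis unfolding S_def[symmetric] by (simp add: mult_ac)
  qed
  ultimately have 1: "((\<lambda>\<tau>. sinh (a * \<tau>) * sin (x * \<tau>)) has_integral x * y) {0..pi}"
    by (simp only: Re_complex_of_real)
  have nz: "x\<^sup>2 + a\<^sup>2 \<noteq> 0" using a by (simp add: add_nonneg_eq_0_iff)
  define P where "P \<tau> = (a * cosh (a * \<tau>) * sin (x * \<tau>) - x * sinh (a * \<tau>) * cos (x * \<tau>)) / (x\<^sup>2 + a\<^sup>2)" for \<tau>
  have "((\<lambda>\<tau>. sinh (a * \<tau>) * sin (x * \<tau>)) has_integral P pi - P 0) {0..pi}"
  proof (rule fundamental_theorem_of_calculus)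
    fix \<tau> :: real
    have "(P has_real_derivative ((a * (a * sinh (a * \<tau>) * sin (x * \<tau>) + cosh (a * \<tau>) * (x * cos (x * \<tau>)))
        - x * (a * cosh (a * \<tau>) * cos (x * \<tau>) - sinh (a * \<tau>) * (x * sin (x * \<tau>)))) / (x\<^sup>2 + a\<^sup>2))) (at \<tau> within {0..pi})"
      unfolding P_def [abs_def]
      by (intro DERIV_cdivide) (auto intro!: derivative_eq_intros simp: algebra_simps)
    also have "(a * (a * sinh (a * \<tau>) * sin (x * \<tau>) + cosh (a * \<tau>) * (x * cos (x * \<tau>)))
        - x * (a * cosh (a * \<tau>) * cos (x * \<tau>) - sinh (a * \<tau>) * (x * sin (x * \<tau>)))) = (x\<^sup>2 + a\<^sup>2) * (sinh (a * \<tau>) * sin (x * \<tau>))"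
      by (simp add: power2_eq_square algebra_simps)
    finally show "(P has_vector_derivative sinh (a * \<tau>) * sin (x * \<tau>)) (at \<tau> within {0..pi})"
      using nz x by (simp add: has_real_derivative_iff_has_vector_derivative[symmetric])
  qed simp
  then have "x * y = P pi - P 0" using 1 has_integral_unique by blast
  also have "\<dots> = cosh (a * pi) * (a * sin (pi * x) - tanh (a * pi) * x * cos (pi * x)) / (x\<^sup>2 + a\<^sup>2)"
    by (simp add: P_def tanh_def algebra_simps)
  finally have xy: "x * y = cosh (a * pi) * (a * sin (pi * x) - tanh (a * pi) * x * cos (pi * x)) / (x\<^sup>2 + a\<^sup>2)" .
  have "y = x * y / x" using x by simp
  then have "y = cosh (a * pi) * (a * sin (pi * x) - tanh (a * pi) * x * cos (pi * x)) / (x * (x\<^sup>2 + a\<^sup>2))"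
    unfolding xy by (simp add: mult.commute)
  then show ?thesis using H by simp
qed

text \<open>Symmetric truncations of a nonnegative function increase, so monotone convergence
  applies.\<close>

lemma nn_integral_eq_symmetric_limit:
  fixes f :: "real \<Rightarrow> real"
  assumes cont: "continuous_on UNIV f" and nonneg: "\<And>x. f x \<ge> 0"
    and lim: "((\<lambda>R. integral {-R..R} f) \<longlongrightarrow> L) at_top"
  shows "(\<integral>\<^sup>+x. ennreal (f x) \<partial>lborel) = ennreal L"
proof -
  define F where "F n x = (if x \<in> {- real n..real n} then f x else 0)" for n x
  have int: "f integrable_on {c..d}" for c d
    by (intro integrable_continuous_real continuous_on_subset[OF cont]) auto
  have F_int: "F n integrable_on UNIV" "integral UNIV (F n) = integral {- real n..real n} f" for n
    unfolding F_def [abs_def] by (simp_all only: integrable_restrict_UNIV integral_restrict_UNIV int)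
  have limF: "(\<lambda>n. integral UNIV (F n)) \<longlonglongrightarrow> L"
    unfolding F_int using filterlim_compose[OF lim filterlim_real_sequentially] .
  have "f integrable_on UNIV \<and> (\<lambda>n. integral UNIV (F n)) \<longlonglongrightarrow> integral UNIV f"
  proof (rule monotone_convergence_increasing)
    show "F n integrable_on UNIV" for n by (rule F_int)
    show "F n x \<le> F (Suc n) x" for n x using nonneg by (auto simp: F_def)
    show "(\<lambda>n. F n x) \<longlonglongrightarrow> f x" for x
    proof (rule tendsto_eventually)
      have "\<forall>\<^sub>F n in sequentially. \<bar>x\<bar> \<le> real n"
        using eventually_ge_at_top[of "nat \<lceil>\<bar>x\<bar>\<rceil>"] by eventually_elim linarith
      then show "\<forall>\<^sub>F n in sequentially. F n x = f x"
        by eventually_elim (auto simp: F_def)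
    qed
    show "bounded (range (\<lambda>n. integral UNIV (F n)))"
      using limF by (intro convergent_imp_bounded)
  qed
  then have "(f has_integral L) UNIV"
    using limF LIMSEQ_unique integrable_integral by blast
  then show ?thesis
    using cont nonneg by (intro nn_integral_has_integral_lborel borel_measurable_continuous_onI)
qed

lemma norm_quadrature_bound:
  fixes a :: real and z N :: complex
  assumes a: "a > 0" "norm z \<ge> 2 * a + 1" and N: "norm N \<le> 8 * norm z ^ 2"
  shows "norm (N / (2 * z\<^sup>2 * (z\<^sup>2 + of_real (a\<^sup>2)))) \<le> 8 / norm z ^ 2"
proof -
  define n where "n = norm z"
  have n: "n > 0" "2 * a \<le> n" using a by (auto simp: n_def)
  have "norm (z\<^sup>2 + of_real (a\<^sup>2)) \<ge> n\<^sup>2 - a\<^sup>2"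
    using norm_triangle_ineq2[of "z\<^sup>2" "- of_real (a\<^sup>2)"] by (simp add: n_def norm_power)
  moreover have "(2 * a)\<^sup>2 \<le> n\<^sup>2" using n a by (intro power_mono) auto
  then have "4 * a\<^sup>2 \<le> n\<^sup>2" by (simp add: power_mult_distrib)
  ultimately have d: "norm (z\<^sup>2 + of_real (a\<^sup>2)) \<ge> n\<^sup>2 / 2"
    using zero_le_power2[of a] by linarith
  have "norm (N / (2 * z\<^sup>2 * (z\<^sup>2 + of_real (a\<^sup>2)))) = norm N / (2 * n\<^sup>2 * norm (z\<^sup>2 + of_real (a\<^sup>2)))"
    unfolding norm_divide norm_mult norm_power n_def by simp
  also have "\<dots> \<le> (8 * n\<^sup>2) / (2 * n\<^sup>2 * (n\<^sup>2 / 2))"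
    using N n d unfolding n_def[symmetric] by (intro frac_le mult_left_mono) auto
  also have "\<dots> = 8 / n\<^sup>2" using n by (simp add: field_simps power2_eq_square)
  finally show ?thesis by (simp add: n_def)
qed

text \<open>The numerator of \<open>\<Psi>\<close> below vanishes at \<open>0\<close> and at \<open>\<i> * a\<close>, so in the closed upper half-plane
  \<open>\<Psi>\<close> has only a simple pole at \<open>0\<close>, and \<open>c\<close> is its residue.\<close>

lemma integral_extremal_quotient:
  fixes a :: real
  defines "t \<equiv> tanh (a * pi)"
  assumes a: "a > 0"
  defines "f \<equiv> (\<lambda>x. (a * sin (pi * x) - t * x * cos (pi * x))\<^sup>2 / (x\<^sup>2 * (x\<^sup>2 + a\<^sup>2)))"
  shows "((\<lambda>R. integral {-R..R} f) \<longlongrightarrow> pi * (a * pi - t) / a) at_top"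
proof -
  have t: "0 \<le> t" "t \<le> 1" using a tanh_real_lt_1[of "a * pi"] by (auto simp: t_def)
  define ia where "ia = \<i> * complex_of_real a"
  have ia: "ia \<noteq> 0" using a by (simp add: ia_def)
  \<comment> \<open>On the real line the numerator of \<open>f\<close> is the square of
    \<open>Im w\<close> for \<open>w = cis (pi * x) * (a - \<i> * t * x)\<close>, and twice that
    square is the real part of \<open>N\<close>. The exponential in \<open>N\<close> is bounded in
    the upper half-plane.\<close>
  define N where "N z = of_real (a\<^sup>2) + of_real (t\<^sup>2) * z\<^sup>2 - exp (2 * of_real pi * \<i> * z) * (of_real a - \<i> * of_real t * z)\<^sup>2" for z :: complex
  have holN: "N holomorphic_on UNIV" unfolding N_def by (intro holomorphic_intros)
  obtain N1 where N1: "N1 holomorphic_on UNIV" "\<And>z. N z = (z - 0) * N1 z" "N1 0 = deriv N 0"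
    using entire_factor_zero[OF holN, of 0] by (auto simp: N_def)
  have N_ia: "N ia = 0"
  proof -
    have e: "exp (- (2 * (a * pi))) * (1 + t) = 1 - t" unfolding t_def by (rule exp_minus_tanh)
    have "N ia = of_real (a\<^sup>2 * (1 - t\<^sup>2 - exp (- (2 * (a * pi))) * (1 + t)\<^sup>2))"
    proof -
      have e1: "exp (2 * of_real pi * \<i> * ia) = of_real (exp (- (2 * (a * pi))))"
        unfolding exp_of_real[symmetric] ia_def by (rule arg_cong[of _ _ exp]) (simp add: mult_ac)
      have e2: "ia\<^sup>2 = - of_real (a\<^sup>2)" by (simp add: ia_def power_mult_distrib)
      have e3: "of_real a - \<i> * of_real t * ia = of_real a * (1 + of_real t)"
        by (simp add: ia_def algebra_simps)
      show ?thesis unfolding N_def e1 e2 e3 power_mult_distrib by (simp add: algebra_simps)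
    qed
    also have "1 - t\<^sup>2 - exp (- (2 * (a * pi))) * (1 + t)\<^sup>2 = 0" using e by algebra
    finally show ?thesis by simp
  qed
  then have "N1 ia = 0" using N1(2)[of ia] ia by simp
  then obtain N2 where N2: "N2 holomorphic_on UNIV" "\<And>z. N1 z = (z - ia) * N2 z"
    using entire_factor_zero[OF N1(1)] by metis
  define c where "c = - \<i> * of_real ((a * pi - t) / a)"
  have derN: "deriv N 0 = - 2 * \<i> * of_real a * of_real (a * pi - t)"
  proof -
    have "(N has_field_derivative (0 - (2 * of_real pi * \<i> * (of_real a)\<^sup>2 + 2 * of_real a * (- \<i> * of_real t)))) (at 0)"
      unfolding N_def [abs_def] by (auto intro!: derivative_eq_intros simp: algebra_simps)
    then show ?thesis by (subst DERIV_imp_deriv) (auto simp: power2_eq_square algebra_simps)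
  qed
  have N2_0: "N2 0 = 2 * ia * c"
  proof -
    have "- ia * N2 0 = - 2 * \<i> * of_real a * of_real (a * pi - t)" using N2(2)[of 0] N1(3) derN by simp
    moreover have "- ia * (2 * ia * c) = - 2 * \<i> * of_real a * of_real (a * pi - t)"
      using a by (simp add: ia_def c_def field_simps)
    ultimately show ?thesis using ia by (metis mult_cancel_left neg_equal_0_iff_equal)
  qed
  \<comment> \<open>Passing from \<open>N2\<close> to \<open>M\<close> subtracts the polar part
    \<open>c / z\<close> from \<open>\<Psi>\<close>; by \<open>N2_0\<close> the function
    \<open>M\<close> vanishes at 0, so the pole is gone.\<close>
  define M where "M z = N2 z - 2 * c * (z + ia)" for z
  have holM: "M holomorphic_on UNIV" unfolding M_def by (intro holomorphic_intros N2(1))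
  have "M 0 = 0" by (simp add: M_def N2_0)
  then obtain M1 where M1: "M1 holomorphic_on UNIV" "\<And>z. M z = (z - 0) * M1 z"
    using entire_factor_zero[OF holM] by metis
  define g where "g z = (M1 z / 2) / (z + ia)" for z
  have nz: "z + ia \<noteq> 0" if "Im z \<ge> 0" for z
    using that a by (auto simp: ia_def complex_eq_iff)
  have holg: "g holomorphic_on {z. z + ia \<noteq> 0}"
    unfolding g_def by (intro holomorphic_intros holomorphic_on_subset[OF M1(1)]) auto
  define \<Psi> where "\<Psi> z = N z / (2 * z\<^sup>2 * (z\<^sup>2 + of_real (a\<^sup>2)))" for z
  have g_eq: "g z = \<Psi> z - c / z" if "z \<noteq> 0" "z \<noteq> ia" "z + ia \<noteq> 0" for z
  proof -
    have fact: "z\<^sup>2 + of_real (a\<^sup>2) = (z - ia) * (z + ia)"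
      by (simp add: ia_def power2_eq_square algebra_simps)
    have "N z = z * ((z - ia) * (2 * c * (z + ia) + z * M1 z))"
      using N1(2)[of z] N2(2)[of z] M1(2)[of z] by (simp add: M_def algebra_simps)
    then have "\<Psi> z = (2 * c * (z + ia) + z * M1 z) / (2 * z * (z + ia))"
      unfolding \<Psi>_def fact using that by (simp add: power2_eq_square)
    also have "\<dots> = c / z + g z" using that by (simp add: g_def add_divide_distrib)
    finally show ?thesis by simp
  qed
  \<comment> \<open>Since \<open>\<Psi>\<close> decays like \<open>1 / norm z ^ 2\<close>, the
    subtracted pole leaves \<open>- c / z\<close> as the leading term of \<open>g\<close> at
    infinity.\<close>
  have lim: "((\<lambda>R. integral {-R..R} (\<lambda>x. g (of_real x))) \<longlongrightarrow> - (\<i> * pi * (- c))) at_top"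
  proof (rule integral_reals_eq_semicircle_limit)
    show "continuous_on {z. Im z \<ge> 0} g"
      by (rule holomorphic_on_imp_continuous_on, rule holomorphic_on_subset[OF holg]) (use nz in auto)
    show "g holomorphic_on {z. Im z > 0}"
      by (rule holomorphic_on_subset[OF holg]) (use nz in auto)
    fix z assume z: "Im z \<ge> 0" "norm z \<ge> 2 * a + 1"
    have zn: "norm z > a" "norm z > 0" using z a by linarith+
    have z0: "z \<noteq> 0" "z \<noteq> ia" using zn a by (auto simp: ia_def norm_mult)
    have "norm (N z) \<le> 8 * norm z ^ 2"
    proof -
      have "norm (of_real a - \<i> * of_real t * z) \<le> a + t * norm z"
        using norm_triangle_ineq4[of "of_real a" "\<i> * of_real t * z"] a t by (simp add: norm_mult)
      also have "\<dots> \<le> norm z + 1 * norm z" using zn t by (intro add_mono mult_right_mono) auto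
      finally have "(norm (of_real a - \<i> * of_real t * z))\<^sup>2 \<le> (2 * norm z)\<^sup>2" by (intro power_mono) auto
      moreover have "norm (exp (2 * of_real pi * \<i> * z)) \<le> 1" using z(1) by simp
      ultimately have 1: "norm (exp (2 * of_real pi * \<i> * z) * (of_real a - \<i> * of_real t * z)\<^sup>2) \<le> 1 * (2 * norm z)\<^sup>2"
        unfolding norm_mult norm_power by (intro mult_mono) auto
      have "a\<^sup>2 \<le> norm z ^ 2" using zn a by (intro power_mono) auto
      moreover have "t\<^sup>2 * norm z ^ 2 \<le> 1 * norm z ^ 2" using t by (intro mult_right_mono) (auto simp: power_le_one)
      moreover have "norm (of_real (a\<^sup>2) + of_real (t\<^sup>2) * z\<^sup>2) \<le> a\<^sup>2 + t\<^sup>2 * norm z ^ 2"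
        using norm_triangle_ineq[of "of_real (a\<^sup>2)" "of_real (t\<^sup>2) * z\<^sup>2"] by (simp add: norm_mult norm_power)
      ultimately have 2: "norm (of_real (a\<^sup>2) + of_real (t\<^sup>2) * z\<^sup>2) \<le> 2 * norm z ^ 2" by simp
      have "norm (N z) \<le> 2 * norm z ^ 2 + 1 * (2 * norm z)\<^sup>2"
        unfolding N_def by (intro order_trans[OF norm_triangle_ineq4] add_mono 1 2)
      also have "\<dots> \<le> 8 * norm z ^ 2" by (simp add: power_mult_distrib)
      finally show ?thesis .
    qed
    then show "norm (g z - (- c) / z) \<le> 8 / norm z ^ 2"
      using norm_quadrature_bound[OF a z(2)] g_eq[OF z0 nz[OF z(1)]] by (simp add: \<Psi>_def)
  qed
  have Re_g: "Re (g (of_real x)) = f x" if "x \<noteq> 0" for x :: real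
  proof -
    define w where "w = cis (pi * x) * Complex a (- (t * x))"
    have xa: "of_real x \<noteq> ia" using a by (auto simp: ia_def complex_eq_iff)
    \<comment> \<open>As \<open>c\<close> is purely imaginary, removing the pole does not change the
      real part on the real line.\<close>
    have "Re (c / of_real x) = 0" by (simp add: c_def Re_divide_of_real)
    then have "Re (g (of_real x)) = Re (\<Psi> (of_real x))"
      using g_eq[of "of_real x"] that xa nz[of "of_real x"] by simp
    also have "\<Psi> (of_real x) = N (of_real x) / of_real (2 * x\<^sup>2 * (x\<^sup>2 + a\<^sup>2))"
      by (simp add: \<Psi>_def)
    also have "N (of_real x) = of_real (a\<^sup>2 + t\<^sup>2 * x\<^sup>2) - w\<^sup>2"
    proof -
      have "exp (2 * of_real pi * \<i> * of_real x) = (cis (pi * x))\<^sup>2"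
        by (simp add: cis_conv_exp exp_double[symmetric] mult_ac)
      moreover have "of_real a - \<i> * of_real t * of_real x = Complex a (- (t * x))" by (simp add: complex_eq_iff)
      ultimately show ?thesis by (simp add: N_def w_def power_mult_distrib)
    qed
    also have "Re ((of_real (a\<^sup>2 + t\<^sup>2 * x\<^sup>2) - w\<^sup>2) / of_real (2 * x\<^sup>2 * (x\<^sup>2 + a\<^sup>2))) =
        (a\<^sup>2 + t\<^sup>2 * x\<^sup>2 - Re (w\<^sup>2)) / (2 * x\<^sup>2 * (x\<^sup>2 + a\<^sup>2))"
      by (simp only: Re_divide_of_real minus_complex.sel Re_complex_of_real)
    also have "a\<^sup>2 + t\<^sup>2 * x\<^sup>2 - Re (w\<^sup>2) = 2 * (Im w)\<^sup>2"
    proof -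
      have "(norm w)\<^sup>2 = a\<^sup>2 + t\<^sup>2 * x\<^sup>2" by (simp add: w_def norm_mult cmod_power2 power_mult_distrib)
      then show ?thesis using cmod_power2[of w] by (simp add: power2_eq_square)
    qed
    also have "Im w = a * sin (pi * x) - t * x * cos (pi * x)" by (simp add: w_def algebra_simps)
    finally show ?thesis by (simp add: f_def mult.assoc)
  qed
  have contg: "continuous_on A (\<lambda>x. g (of_real x))" for A :: "real set"
    by (rule continuous_on_compose2[OF holomorphic_on_imp_continuous_on[OF holg]])
       (auto intro!: continuous_intros nz)
  have "integral {-R..R} f = Re (integral {-R..R} (\<lambda>x. g (of_real x)))" for R
  proof -
    have hi: "((\<lambda>x. Re (g (of_real x))) has_integral Re (integral {-R..R} (\<lambda>x. g (of_real x)))) {-R..R}"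
      by (intro has_integral_Re integrable_integral integrable_continuous_real contg)
    have "(f has_integral Re (integral {-R..R} (\<lambda>x. g (of_real x)))) {-R..R}"
      by (rule has_integral_spike_finite[OF finite.insertI[OF finite.emptyI, of 0] _ hi]) (simp add: Re_g)
    then show ?thesis by (rule integral_unique)
  qed
  moreover have "((\<lambda>R. Re (integral {-R..R} (\<lambda>x. g (of_real x)))) \<longlongrightarrow> Re (- (\<i> * pi * (- c)))) at_top"
    by (intro tendsto_Re lim)
  moreover have "Re (- (\<i> * pi * (- c))) = pi * (a * pi - t) / a" by (simp add: c_def)
  ultimately show ?thesis by simp
qed

text \<open>The normalisation \<open>k_ext a 0 = 1 / (rho a 0) ^ 2\<close> cancels the factor
  \<open>cosh (a * pi)\<close>, so off 0 the gap is an explicit multiple of the integrand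
  \<open>f\<close> whose integral is known.\<close>

lemma exists_extremal_pair:
  assumes a: "a > 0"
  shows "\<exists>S T. admissible_pair a S T \<and> gap_integral S T = ennreal (pi * a / (pi * a - tanh (pi * a)))"
proof -
  obtain A where "extremal_interpolation (\<lambda>\<zeta>. (sine_avg a \<zeta>)\<^sup>2) (k_ext a) A a"
    using extremal_interpolation_sine_avg[OF a] by blast
  then interpret extremal_interpolation "\<lambda>\<zeta>. (sine_avg a \<zeta>)\<^sup>2" "k_ext a" A a .
  define t where "t = tanh (a * pi)"
  have t: "t < a * pi" unfolding t_def using a by (intro tanh_less_self) simp
  define f where "f x = (a * sin (pi * x) - t * x * cos (pi * x))\<^sup>2 / (x\<^sup>2 * (x\<^sup>2 + a\<^sup>2))" for x
  define G where "G x = Re (gap (of_real x))" for x :: real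
  have G_nonneg: "G x \<ge> 0" for x
    using major_minor_bounds[of x] by (simp add: G_def minor_def)
  have G_eq: "G x = a\<^sup>2 / (a * pi - t)\<^sup>2 * f x" if "x \<noteq> 0" for x
  proof -
    define C where "C = cosh (a * pi)"
    define B where "B = a * sin (pi * x) - t * x * cos (pi * x)"
    have C: "C > 0" by (simp add: C_def)
    have p: "x\<^sup>2 + a\<^sup>2 > 0" using a by (simp add: add_nonneg_pos)
    have r0: "rho a 0 = C * (a * pi - t) / a\<^sup>2"
    proof -
      have "sinh (a * pi) = t * C" by (simp add: t_def tanh_def C_def)
      then show ?thesis unfolding rho_0[OF a] C_def[symmetric] by (simp add: algebra_simps)
    qed
    have "sine_avg a (of_real (x\<^sup>2)) = of_real (C * B / (x * (x\<^sup>2 + a\<^sup>2)))"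
      unfolding sine_avg_square[OF a that] B_def C_def t_def ..
    then have "G x = 1 / (rho a 0)\<^sup>2 / a\<^sup>2 * (x\<^sup>2 + a\<^sup>2) * (C * B / (x * (x\<^sup>2 + a\<^sup>2)))\<^sup>2"
      unfolding G_def gap_real Re_complex_of_real k_ext_def by (simp flip: of_real_power)
    also have "\<dots> = a\<^sup>2 / (a * pi - t)\<^sup>2 * (B\<^sup>2 / (x\<^sup>2 * (x\<^sup>2 + a\<^sup>2)))"
    proof -
      define u s where "u = a * pi - t" and "s = x\<^sup>2 + a\<^sup>2"
      have "u > 0" "s > 0" using t p by (auto simp: u_def s_def)
      then show ?thesis unfolding r0 u_def[symmetric] s_def[symmetric]
        using a C that by (simp add: power_divide power_mult_distrib) (simp add: power2_eq_square power4_eq_xxxx)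
    qed
    finally show ?thesis by (simp add: f_def B_def)
  qed
  have holgap: "gap holomorphic_on UNIV" using gap_exp_type by (simp add: exp_type_class_def)
  have contG: "continuous_on UNIV G"
    unfolding G_def
    by (intro continuous_intros continuous_on_compose2[OF holomorphic_on_imp_continuous_on[OF holgap]]) auto
  have int_G: "integral {-R..R} G = a\<^sup>2 / (a * pi - t)\<^sup>2 * integral {-R..R} f" for R
  proof -
    have "integral {-R..R} G = integral {-R..R} (\<lambda>x. a\<^sup>2 / (a * pi - t)\<^sup>2 * f x)"
      by (rule integral_spike[of "{0}"]) (use G_eq in auto)
    then show ?thesis by simp
  qed
  have "((\<lambda>R. a\<^sup>2 / (a * pi - t)\<^sup>2 * integral {-R..R} f) \<longlongrightarrow> a\<^sup>2 / (a * pi - t)\<^sup>2 * (pi * (a * pi - t) / a)) at_top"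
    unfolding f_def t_def by (intro tendsto_intros integral_extremal_quotient a)
  also have "a\<^sup>2 / (a * pi - t)\<^sup>2 * (pi * (a * pi - t) / a) = pi * a / (pi * a - t)"
  proof -
    define u where "u = a * pi - t"
    have "u > 0" "pi * a - t = u" using t by (auto simp: u_def mult.commute)
    then show ?thesis unfolding u_def[symmetric] using a by (simp add: power2_eq_square)
  qed
  finally have "((\<lambda>R. integral {-R..R} G) \<longlongrightarrow> pi * a / (pi * a - t)) at_top"
    unfolding int_G .
  from nn_integral_eq_symmetric_limit[OF contG G_nonneg this]
  have "gap_integral minor major = ennreal (pi * a / (pi * a - tanh (pi * a)))"
    by (simp add: gap_integral_def minor_def G_def t_def mult.commute)
  moreover have "admissible_pair a minor major"
    unfolding admissible_pair_def minorant_on_reals_def majorant_on_reals_def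
  proof (intro conjI allI)
    show "minor \<in> exp_type_class (2 * pi)"
      unfolding minor_def [abs_def] by (intro exp_type_class_diff major_exp_type gap_exp_type)
    show "minor (of_real x) \<in> \<real>" for x
      unfolding minor_def gap_real by (intro Reals_diff major_real Reals_of_real)
  qed (auto simp: major_exp_type minor_def major_zero gap_zero major_real
      intro: major_minor_bounds(1) major_minor_bounds(2)[unfolded minor_def minus_complex.sel])
  ultimately show ?thesis by blast
qed

theorem theorem2:
  fixes a :: real
  assumes "a > 0"
  shows "(\<forall>S T. admissible_pair a S T \<longrightarrow>
            gap_integral S T \<ge> ennreal (pi * a / (pi * a - tanh (pi * a)))) \<and>
         (\<exists>S T. admissible_pair a S T \<and>
            gap_integral S T = ennreal (pi * a / (pi * a - tanh (pi * a))))"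
  using admissible_pair_gap_ge[OF assms] exists_extremal_pair[OF assms] by blast

end
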